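(* Let $M$ be a compact pointed metric space which is countably 1-rectifiable, let $N$ be any pointed metric space and let $f:M\to N$ be a Lipschitz map with $f(0)=0$. The following are equivalent. (1) $f(M)$ is $\mathcal H^1$-negligible. (2) $\widehat f:\mathcal F(M)\to\mathcal F(N)$ is strong Radon-Nikodým. (3) $\widehat f$ does not fix a copy of $L_1$.
   Context: All Banach spaces are real. $\mathcal H^1$ is the 1-dimensional Hausdorff measure. A metric space $M$ is countably 1-rectifiable if there exist a countable collection of subsets $A_i\subset\mathbb R$ and Lipschitz maps $\gamma_i:A_i\to M$ such that $\mathcal H^1(M\setminus\bigcup_i\gamma_i(A_i))=0$. A pointed metric space has a distinguished point $0$. $\mathrm{Lip}_0(M)$ is the Banach space of Lipschitz functions $g:M\to\mathbb R$ with $g(0)=0$, normed by the best Lipschitz constant; $\delta_M(x)\in\mathrm{Lip}_0(M)^*$ is evaluation at $x$; $\mathcal F(M)=\overline{\mathrm{span}}\{\delta_M(x):x\in M\}\subset\mathrm{Lip}_0(M)^*$. For a Lipschitz $f:M\to N$ with $f(0)=0$, $\widehat f:\mathcal F(M)\to\mathcal F(N)$ is the unique bounded linear operator with $\widehat f\circ\delta_M=\delta_N\circ f$. A closed bounded subset $C$ of a Banach space $X$ is an RNP set if for every probability space $(\Omega,\Sigma,\mathbb P)$ and every vector measure $m:\Sigma\to X$ such that $\{m(B)/\mathbb P(B):B\in\Sigma,\ \mathbb P(B)>0\}\subset C$, there is a Bochner-integrable $h:\Omega\to X$ with $m(B)=\int_B h\,d\mathbb P$ for every $B\in\Sigma$.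 A bounded operator $T:X\to Y$ is strong Radon-Nikodým if $\overline{T(B_X)}$ is an RNP set, where $B_X$ is the closed unit ball. $T$ fixes a copy of $L_1=L_1([0,1])$ if there is a subspace $Z\subset X$ isomorphic to $L_1$ such that $T|_Z$ is an isomorphic embedding.
   Formalization: In the definition of an RNP set, the vector measure m is also required to vanish on P-null sets (the standard convention); without this no set with two points is an RNP set and (1) ⇒ (2) fails, e.g. for the identity of a two-point space. *)

theory Defs
  imports "HOL-Probability.Probability"
begin

section \<open>Hausdorff measure and rectifiability\<close>

text \<open>
  The sets \<open>U i\<close> are required to be bounded because \<open>diameter\<close> is unspecified on unbounded sets;
  unbounded sets have infinite diameter and cannot occur in a cover of mesh at most \<open>\<delta>\<close>.
\<close>

definition hausdorff1_content :: "real \<Rightarrow> 'a::metric_space set \<Rightarrow> ennreal" where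
  "hausdorff1_content \<delta> S =
     (INF U \<in> {U :: nat \<Rightarrow> 'a set. S \<subseteq> (\<Union>i. U i) \<and> (\<forall>i. bounded (U i) \<and> diameter (U i) \<le> \<delta>)}.
        \<Sum>i. ennreal (diameter (U i)))"

definition hausdorff1 :: "'a::metric_space set \<Rightarrow> ennreal" where
  "hausdorff1 S = (SUP \<delta> \<in> {0<..}. hausdorff1_content \<delta> S)"

definition countably_1_rectifiable :: "'a::metric_space set \<Rightarrow> bool" where
  "countably_1_rectifiable S \<longleftrightarrow>
     (\<exists>(A :: nat \<Rightarrow> real set) (\<gamma> :: nat \<Rightarrow> real \<Rightarrow> 'a).
        (\<forall>i. (\<exists>L. L-lipschitz_on (A i) (\<gamma> i)) \<and> \<gamma> i ` A i \<subseteq> S) \<and>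
        hausdorff1 (S - (\<Union>i. \<gamma> i ` A i)) = 0)"


section \<open>Lipschitz functions vanishing at the base point\<close>

text \<open>
  A pointed metric space is a type of sort \<open>{metric_space, zero}\<close>: its distinguished point is \<open>0\<close>,
  and no compatibility between \<open>0\<close> and the metric is assumed.
\<close>

typedef (overloaded) 'a lip0 =
  "{g :: 'a::{metric_space,zero} \<Rightarrow> real. g 0 = 0 \<and> (\<exists>L. L-lipschitz_on UNIV g)}"
  morphisms lip0_apply Abs_lip0
  by (rule exI[of _ "\<lambda>_. 0"]) (auto intro: lipschitz_on_constant)

setup_lifting type_definition_lip0

lemma lip0_eqI: "(\<And>x. lip0_apply g x = lip0_apply h x) \<Longrightarrow> g = h"
  by (metis lip0_apply_inject ext)

lemma lip0_apply_0 [simp]: "lip0_apply g 0 = 0"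
  using lip0_apply[of g] by auto

lemma lip0_lipschitz: "\<exists>L. L-lipschitz_on UNIV (lip0_apply g)"
  using lip0_apply[of g] by auto

instantiation lip0 :: ("{metric_space,zero}") real_vector
begin

lift_definition zero_lip0 :: "'a lip0" is "\<lambda>_. 0"
  by (auto intro: lipschitz_on_constant)

lift_definition plus_lip0 :: "'a lip0 \<Rightarrow> 'a lip0 \<Rightarrow> 'a lip0" is "\<lambda>g h x. g x + h x"
  by (auto intro: lipschitz_on_add)

lift_definition uminus_lip0 :: "'a lip0 \<Rightarrow> 'a lip0" is "\<lambda>g x. - g x"
  by auto

lift_definition minus_lip0 :: "'a lip0 \<Rightarrow> 'a lip0 \<Rightarrow> 'a lip0" is "\<lambda>g h x. g x - h x"
  by (auto intro: lipschitz_on_diff)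

lift_definition scaleR_lip0 :: "real \<Rightarrow> 'a lip0 \<Rightarrow> 'a lip0" is "\<lambda>c g x. c * g x"
  by (auto intro: lipschitz_on_cmult_real)

instance
  by standard (transfer; force simp: algebra_simps)+

end

lemma lip0_apply_simps [simp]:
  "lip0_apply 0 x = 0"
  "lip0_apply (g + h) x = lip0_apply g x + lip0_apply h x"
  "lip0_apply (g - h) x = lip0_apply g x - lip0_apply h x"
  "lip0_apply (- g) x = - lip0_apply g x"
  "lip0_apply (c *\<^sub>R g) x = c * lip0_apply g x"
  by (transfer; simp)+

definition lip_const :: "'a::{metric_space,zero} lip0 \<Rightarrow> real" where
  "lip_const g = Inf {L. L-lipschitz_on UNIV (lip0_apply g)}"

lemma lip_const_set: 
  "{L. L-lipschitz_on UNIV (lip0_apply g)} \<noteq> {}" 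
  "bdd_below {L. L-lipschitz_on UNIV (lip0_apply g)}"
  using lip0_lipschitz[of g] by (auto intro!: bdd_belowI[of _ 0] dest: lipschitz_on_nonneg)

lemma lip_const_le: "L-lipschitz_on UNIV (lip0_apply g) \<Longrightarrow> lip_const g \<le> L"
  unfolding lip_const_def by (rule cInf_lower) (use lip_const_set[of g] in auto)

lemma lip_const_lipschitz: "(lip_const g)-lipschitz_on UNIV (lip0_apply g)"
proof (rule lipschitz_onI)
  show "0 \<le> lip_const g"
    unfolding lip_const_def 
    by (rule cInf_greatest) (use lip_const_set[of g] in \<open>auto dest: lipschitz_on_nonneg\<close>)
  fix x y :: 'a
  show "dist (lip0_apply g x) (lip0_apply g y) \<le> lip_const g * dist x y"
  proof (cases "x = y")
    case False
    then have pos: "dist x y > 0" by simp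
    have "dist (lip0_apply g x) (lip0_apply g y) / dist x y \<le> lip_const g"
      unfolding lip_const_def
    proof (rule cInf_greatest)
      fix L assume "L \<in> {L. L-lipschitz_on UNIV (lip0_apply g)}"
      then show "dist (lip0_apply g x) (lip0_apply g y) / dist x y \<le> L"
        using pos by (auto simp: divide_le_eq dest: lipschitz_onD)
    qed (use lip_const_set[of g] in auto)
    then show ?thesis using pos by (simp add: divide_le_eq)
  qed simp
qed

instantiation lip0 :: ("{metric_space,zero}") real_normed_vector
begin

definition norm_lip0 :: "'a lip0 \<Rightarrow> real" where "norm_lip0 = lip_const"
definition dist_lip0 :: "'a lip0 \<Rightarrow> 'a lip0 \<Rightarrow> real" where "dist_lip0 g h = norm (g - h)"
definition sgn_lip0 :: "'a lip0 \<Rightarrow> 'a lip0" where "sgn_lip0 g = g /\<^sub>R norm g"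
definition uniformity_lip0 :: "('a lip0 \<times> 'a lip0) filter" where
  "uniformity_lip0 = (INF e\<in>{0<..}. principal {(x, y). dist x y < e})"
definition open_lip0 :: "'a lip0 set \<Rightarrow> bool" where
  "open_lip0 U \<longleftrightarrow> (\<forall>x\<in>U. eventually (\<lambda>(x', y). x' = x \<longrightarrow> y \<in> U) uniformity)"

instance
proof
  fix g h :: "'a lip0" and c :: real
  show "dist g h = norm (g - h)" by (rule dist_lip0_def)
  show "sgn g = g /\<^sub>R norm g" by (rule sgn_lip0_def)
  show "uniformity = (INF e\<in>{0<..}. principal {(x::'a lip0, y). dist x y < e})"
    by (rule uniformity_lip0_def)
  show "open U \<longleftrightarrow> (\<forall>x\<in>U. \<forall>\<^sub>F (x', y) in uniformity. x' = x \<longrightarrow> y \<in> U)" for U :: "'a lip0 set"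
    by (rule open_lip0_def)
  show "norm g = 0 \<longleftrightarrow> g = 0"
  proof
    assume "norm g = 0"
    then have "0-lipschitz_on UNIV (lip0_apply g)"
      using lip_const_lipschitz[of g] by (simp add: norm_lip0_def)
    then have "dist (lip0_apply g x) (lip0_apply g 0) \<le> 0" for x
      by (auto dest: lipschitz_onD[of _ _ _ x 0])
    then show "g = 0" by (intro lip0_eqI) auto
  next
    assume "g = 0"
    then have "0-lipschitz_on UNIV (lip0_apply g)"
      by (auto intro!: lipschitz_onI)
    then show "norm g = 0"
      using lip_const_le[of 0 g] lipschitz_on_nonneg[OF lip_const_lipschitz[of g]]
      by (simp add: norm_lip0_def)
  qed
  show "norm (g + h) \<le> norm g + norm h"
    unfolding norm_lip0_def
    by (rule lip_const_le)
       (use lipschitz_on_add[OF lip_const_lipschitz lip_const_lipschitz, of g h] in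
         \<open>simp add: lipschitz_on_def\<close>)
  have le: "norm (c *\<^sub>R g) \<le> \<bar>c\<bar> * norm g" for c and g :: "'a lip0"
    unfolding norm_lip0_def
    by (rule lip_const_le)
       (use lipschitz_on_cmult_real[OF lip_const_lipschitz, of c g] in
         \<open>simp add: lipschitz_on_def\<close>)
  show "norm (c *\<^sub>R g) = \<bar>c\<bar> * norm g"
  proof (cases "c = 0")
    case True
    then show ?thesis
      using le[of 0 g] lipschitz_on_nonneg[OF lip_const_lipschitz[of "0::'a lip0"]]
      by (simp add: norm_lip0_def)
  next
    case False
    have "norm g = norm (inverse c *\<^sub>R (c *\<^sub>R g))" using False by simp
    also have "\<dots> \<le> \<bar>inverse c\<bar> * norm (c *\<^sub>R g)" by (rule le)
    finally have "\<bar>c\<bar> * norm g \<le> norm (c *\<^sub>R g)"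
      using False by (simp add: field_simps)
    then show ?thesis using le[of c g] by simp
  qed
qed

end

lemma lip0_dist_le: "\<bar>lip0_apply g x - lip0_apply g y\<bar> \<le> norm g * dist x y"
  using lipschitz_onD[OF lip_const_lipschitz[of g], of x y]
  by (simp add: norm_lip0_def dist_real_def)

lemma lip0_norm_le:
  "0 \<le> L \<Longrightarrow> (\<And>x y. \<bar>lip0_apply g x - lip0_apply g y\<bar> \<le> L * dist x y) \<Longrightarrow> norm g \<le> L"
  unfolding norm_lip0_def by (intro lip_const_le lipschitz_onI) (auto simp: dist_real_def)

instance lip0 :: ("{metric_space,zero}") banach
proof
  fix X :: "nat \<Rightarrow> 'a lip0"
  assume X: "Cauchy X"
  have pt: "Cauchy (\<lambda>n. lip0_apply (X n) x)" for x
  proof (rule metric_CauchyI)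
    fix e :: real assume e: "e > 0"
    have "e / (dist x 0 + 1) > 0" using e by (simp add: add_nonneg_pos)
    then obtain N where N: "\<And>m n. m \<ge> N \<Longrightarrow> n \<ge> N \<Longrightarrow> dist (X m) (X n) < e / (dist x 0 + 1)"
      using metric_CauchyD[OF X] by blast
    show "\<exists>N. \<forall>m\<ge>N. \<forall>n\<ge>N. dist (lip0_apply (X m) x) (lip0_apply (X n) x) < e"
    proof (intro exI allI impI)
      fix m n assume "m \<ge> N" "n \<ge> N"
      from N[OF this] have *: "norm (X m - X n) * (dist x 0 + 1) < e"
        by (simp add: dist_norm pos_less_divide_eq add_nonneg_pos)
      have "dist (lip0_apply (X m) x) (lip0_apply (X n) x) \<le> norm (X m - X n) * dist x 0"
        using lip0_dist_le[of "X m - X n" x 0] by (simp add: dist_real_def)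
      also have "\<dots> \<le> norm (X m - X n) * (dist x 0 + 1)"
        by (intro mult_left_mono) auto
      finally show "dist (lip0_apply (X m) x) (lip0_apply (X n) x) < e" using * by simp
    qed
  qed
  define g where "g x = lim (\<lambda>n. lip0_apply (X n) x)" for x
  have lim: "(\<lambda>n. lip0_apply (X n) x) \<longlonglongrightarrow> g x" for x
    using pt[of x] by (simp add: g_def Cauchy_convergent_iff convergent_LIMSEQ_iff)
  have bnd: "\<bar>(lip0_apply (X m) x - lip0_apply (X m) y) - (g x - g y)\<bar> \<le> e * dist x y"
    if N: "\<And>n. n \<ge> N \<Longrightarrow> dist (X m) (X n) \<le> e" for m N e x y
  proof (rule tendsto_upperbound)
    show "(\<lambda>n. \<bar>(lip0_apply (X m) x - lip0_apply (X m) y)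
            - (lip0_apply (X n) x - lip0_apply (X n) y)\<bar>)
          \<longlonglongrightarrow> \<bar>(lip0_apply (X m) x - lip0_apply (X m) y) - (g x - g y)\<bar>"
      by (intro tendsto_intros lim)
    show "\<forall>\<^sub>F n in sequentially. \<bar>(lip0_apply (X m) x - lip0_apply (X m) y)
            - (lip0_apply (X n) x - lip0_apply (X n) y)\<bar> \<le> e * dist x y"
      using eventually_ge_at_top[of N]
    proof eventually_elim
      case (elim n)
      have "\<bar>(lip0_apply (X m) x - lip0_apply (X m) y) - (lip0_apply (X n) x - lip0_apply (X n) y)\<bar>
        = \<bar>lip0_apply (X m - X n) x - lip0_apply (X m - X n) y\<bar>" by simp
      also have "\<dots> \<le> norm (X m - X n) * dist x y" by (rule lip0_dist_le)
      also have "\<dots> \<le> e * dist x y"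
        using N[OF elim] by (intro mult_right_mono) (auto simp: dist_norm)
      finally show ?case .
    qed
  qed simp
  obtain N1 where N1: "\<And>m n. m \<ge> N1 \<Longrightarrow> n \<ge> N1 \<Longrightarrow> dist (X m) (X n) < 1"
    using metric_CauchyD[OF X, of 1] by auto
  have "(norm (X N1) + 1)-lipschitz_on UNIV g"
  proof (rule lipschitz_onI)
    fix x y
    have "\<bar>(lip0_apply (X N1) x - lip0_apply (X N1) y) - (g x - g y)\<bar> \<le> 1 * dist x y"
      by (rule bnd[of N1]) (use N1 in \<open>auto intro: less_imp_le\<close>)
    then show "dist (g x) (g y) \<le> (norm (X N1) + 1) * dist x y"
      using lip0_dist_le[of "X N1" x y] by (simp add: dist_real_def algebra_simps)
  qed auto
  moreover have "g 0 = 0" using lim[of 0] by (simp add: LIMSEQ_const_iff)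
  ultimately have g: "lip0_apply (Abs_lip0 g) = g"
    by (intro Abs_lip0_inverse) auto
  have "X \<longlonglongrightarrow> Abs_lip0 g"
  proof (rule metric_LIMSEQ_I)
    fix r :: real assume r: "r > 0"
    then obtain N where N: "\<And>m n. m \<ge> N \<Longrightarrow> n \<ge> N \<Longrightarrow> dist (X m) (X n) < r / 2"
      using metric_CauchyD[OF X, of "r / 2"] by auto
    have "dist (X m) (Abs_lip0 g) \<le> r / 2" if "m \<ge> N" for m
      unfolding dist_norm
    proof (rule lip0_norm_le)
      fix x y
      have "\<bar>(lip0_apply (X m) x - lip0_apply (X m) y) - (g x - g y)\<bar> \<le> r / 2 * dist x y"
        by (rule bnd[of N]) (use N that in \<open>auto intro: less_imp_le\<close>)
      then show "\<bar>lip0_apply (X m - Abs_lip0 g) x - lip0_apply (X m - Abs_lip0 g) y\<bar>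
          \<le> r / 2 * dist x y"
        by (simp add: g algebra_simps)
    qed (use r in simp)
    with r show "\<exists>N. \<forall>n\<ge>N. dist (X n) (Abs_lip0 g) < r"
      by (intro exI[of _ N]) fastforce
  qed
  then show "convergent X" by (rule convergentI)
qed


section \<open>Lipschitz-free spaces\<close>

lift_definition lip0_eval :: "'a::{metric_space,zero} \<Rightarrow> ('a lip0 \<Rightarrow>\<^sub>L real)"
  is "\<lambda>x g. lip0_apply g x"
proof -
  fix x :: 'a
  show "bounded_linear (\<lambda>g. lip0_apply g x)"
    by (rule bounded_linear_intro[of _ "dist x 0"])
       (use lip0_dist_le[of _ x 0] in \<open>simp_all add: mult.commute\<close>)
qed

lemma lip0_eval_apply [simp]: "blinfun_apply (lip0_eval x) g = lip0_apply g x"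
  by transfer simp

typedef (overloaded) 'a lipfree =
  "closure (span (range (lip0_eval :: 'a::{metric_space,zero} \<Rightarrow> ('a lip0 \<Rightarrow>\<^sub>L real))))"
  morphisms lipfree_functional Abs_lipfree
  by (meson closure_subset span_zero subsetD)

setup_lifting type_definition_lipfree

lemma subspace_closure:
  fixes S :: "'x::real_normed_vector set"
  assumes S: "subspace S"
  shows "subspace (closure S)"
proof (rule subspaceI)
  show "0 \<in> closure S" using subspace_0[OF S] closure_subset by blast
  fix x y :: 'x and c :: real
  assume x: "x \<in> closure S"
  then obtain X where X: "\<And>n. X n \<in> S" "X \<longlonglongrightarrow> x" unfolding closure_sequential by blast
  have "(\<lambda>n. c *\<^sub>R X n) \<longlonglongrightarrow> c *\<^sub>R x" by (intro tendsto_intros X)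
  then show "c *\<^sub>R x \<in> closure S"
    unfolding closure_sequential using subspace_scale[OF S X(1)]
    by (intro exI[of _ "\<lambda>n. c *\<^sub>R X n"]) auto
  assume "y \<in> closure S"
  then obtain Y where Y: "\<And>n. Y n \<in> S" "Y \<longlonglongrightarrow> y" unfolding closure_sequential by blast
  have "(\<lambda>n. X n + Y n) \<longlonglongrightarrow> x + y" by (intro tendsto_intros X Y)
  then show "x + y \<in> closure S"
    unfolding closure_sequential using subspace_add[OF S X(1) Y(1)]
    by (intro exI[of _ "\<lambda>n. X n + Y n"]) auto
qed

lemma subspace_lipfree:
  "subspace (closure (span (range (lip0_eval :: 'a::{metric_space,zero} \<Rightarrow> ('a lip0 \<Rightarrow>\<^sub>L real)))))"
  by (intro subspace_closure subspace_span)

instantiation lipfree :: ("{metric_space,zero}") real_vector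
begin

lift_definition zero_lipfree :: "'a lipfree" is 0
  by (rule subspace_0[OF subspace_lipfree])

lift_definition plus_lipfree :: "'a lipfree \<Rightarrow> 'a lipfree \<Rightarrow> 'a lipfree" is "(+)"
  by (rule subspace_add[OF subspace_lipfree])

lift_definition uminus_lipfree :: "'a lipfree \<Rightarrow> 'a lipfree" is uminus
  by (rule subspace_neg[OF subspace_lipfree])

lift_definition minus_lipfree :: "'a lipfree \<Rightarrow> 'a lipfree \<Rightarrow> 'a lipfree" is "(-)"
  by (rule subspace_diff[OF subspace_lipfree])

lift_definition scaleR_lipfree :: "real \<Rightarrow> 'a lipfree \<Rightarrow> 'a lipfree" is "scaleR"
  by (rule subspace_scale[OF subspace_lipfree])

instance
proof
  fix u v w :: "'a lipfree" and a b :: real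
  show "u + v + w = u + (v + w)" by transfer (simp add: algebra_simps)
  show "u + v = v + u" by transfer (simp add: algebra_simps)
  show "0 + u = u" by transfer simp
  show "- u + u = 0" by transfer simp
  show "u - v = u + - v" by transfer simp
  show "a *\<^sub>R (u + v) = a *\<^sub>R u + a *\<^sub>R v" by transfer (simp add: algebra_simps)
  show "(a + b) *\<^sub>R u = a *\<^sub>R u + b *\<^sub>R u" by transfer (simp add: algebra_simps)
  show "a *\<^sub>R b *\<^sub>R u = (a * b) *\<^sub>R u" by transfer simp
  show "1 *\<^sub>R u = u" by transfer simp
qed

end

instantiation lipfree :: ("{metric_space,zero}") real_normed_vector
begin

lift_definition norm_lipfree :: "'a lipfree \<Rightarrow> real" is norm .

definition dist_lipfree :: "'a lipfree \<Rightarrow> 'a lipfree \<Rightarrow> real" where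
  "dist_lipfree u v = norm (u - v)"
definition sgn_lipfree :: "'a lipfree \<Rightarrow> 'a lipfree" where "sgn_lipfree u = u /\<^sub>R norm u"
definition uniformity_lipfree :: "('a lipfree \<times> 'a lipfree) filter" where
  "uniformity_lipfree = (INF e\<in>{0<..}. principal {(x, y). dist x y < e})"
definition open_lipfree :: "'a lipfree set \<Rightarrow> bool" where
  "open_lipfree U \<longleftrightarrow> (\<forall>x\<in>U. eventually (\<lambda>(x', y). x' = x \<longrightarrow> y \<in> U) uniformity)"

instance
proof
  fix u v :: "'a lipfree" and a :: real
  show "dist u v = norm (u - v)" by (rule dist_lipfree_def)
  show "sgn u = u /\<^sub>R norm u" by (rule sgn_lipfree_def)
  show "uniformity = (INF e\<in>{0<..}. principal {(x::'a lipfree, y). dist x y < e})"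
    by (rule uniformity_lipfree_def)
  show "open U \<longleftrightarrow> (\<forall>x\<in>U. \<forall>\<^sub>F (x', y) in uniformity. x' = x \<longrightarrow> y \<in> U)" for U :: "'a lipfree set"
    by (rule open_lipfree_def)
  show "norm u = 0 \<longleftrightarrow> u = 0" by transfer simp
  show "norm (u + v) \<le> norm u + norm v" by transfer (rule norm_triangle_ineq)
  show "norm (a *\<^sub>R u) = \<bar>a\<bar> * norm u" by transfer simp
qed

end

lemma dist_lipfree_functional: "dist (lipfree_functional u) (lipfree_functional v) = dist u v"
  by (simp add: dist_norm minus_lipfree.rep_eq norm_lipfree.rep_eq)

instance lipfree :: ("{metric_space,zero}") banach
proof
  fix X :: "nat \<Rightarrow> 'a lipfree"
  assume "Cauchy X"
  then have "Cauchy (\<lambda>n. lipfree_functional (X n))"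
    by (simp add: Cauchy_def dist_lipfree_functional)
  then obtain l where l: "(\<lambda>n. lipfree_functional (X n)) \<longlonglongrightarrow> l"
    using Cauchy_convergent convergent_def by blast
  then have "l \<in> closure (span (range lip0_eval))"
    by (rule closed_sequentially[OF closed_closure, rotated])
       (rule lipfree_functional)
  then have "lipfree_functional (Abs_lipfree l) = l" by (rule Abs_lipfree_inverse)
  then have "X \<longlonglongrightarrow> Abs_lipfree l"
    using l by (simp add: tendsto_iff flip: dist_lipfree_functional)
  then show "convergent X" by (rule convergentI)
qed

lift_definition lipfree_delta :: "'a::{metric_space,zero} \<Rightarrow> 'a lipfree" is lip0_eval
  by (meson closure_subset span_base rangeI subsetD)

definition lipfree_map ::
  "('a::{metric_space,zero} \<Rightarrow> 'b::{metric_space,zero}) \<Rightarrow> ('a lipfree \<Rightarrow>\<^sub>L 'b lipfree)" where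
  "lipfree_map f = (THE T. \<forall>x. blinfun_apply T (lipfree_delta x) = lipfree_delta (f x))"

text \<open>
  The description defining \<open>lipfree_map f\<close> is meaningful for Lipschitz \<open>f\<close> with \<open>f 0 = 0\<close>:
  the operator exists and is unique.
\<close>

lemma linear_lipfree_functional: "linear lipfree_functional"
  by (rule linearI) (simp_all add: plus_lipfree.rep_eq scaleR_lipfree.rep_eq)

lemma closure_span_lipfree_delta: "closure (span (range lipfree_delta)) = UNIV"
proof (rule equalityI[OF subset_UNIV], rule subsetI)
  fix u :: "'a lipfree"
  have img: "span (range lip0_eval) = lipfree_functional ` span (range lipfree_delta :: 'a lipfree set)"
    by (simp add: linear_span_image[OF linear_lipfree_functional, symmetric] image_image
        lipfree_delta.rep_eq)
  show "u \<in> closure (span (range lipfree_delta))"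
    unfolding closure_approachable
  proof (intro allI impI)
    fix e :: real assume "e > 0"
    moreover have "lipfree_functional u \<in> closure (span (range lip0_eval))"
      by (rule lipfree_functional)
    ultimately obtain y where "y \<in> span (range lip0_eval)" "dist y (lipfree_functional u) < e"
      unfolding closure_approachable by blast
    then show "\<exists>y\<in>span (range lipfree_delta). dist y u < e"
      unfolding img by (auto simp: dist_lipfree_functional)
  qed
qed

lemma lipfree_map_ex1:
  fixes f :: "'a::{metric_space,zero} \<Rightarrow> 'b::{metric_space,zero}"
  assumes lip: "\<exists>L. L-lipschitz_on UNIV f" and f0: "f 0 = 0"
  shows "\<exists>!T. \<forall>x. blinfun_apply T (lipfree_delta x) = lipfree_delta (f x)"
proof (rule ex_ex1I)
  obtain L where L: "L-lipschitz_on UNIV f" using lip by blast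
  have L0: "L \<ge> 0" using L by (rule lipschitz_on_nonneg)
  define P :: "'b lip0 \<Rightarrow> 'a lip0" where "P g = Abs_lip0 (\<lambda>x. lip0_apply g (f x))" for g
  have P: "lip0_apply (P g) x = lip0_apply g (f x)" for g x
  proof -
    have "\<exists>K. K-lipschitz_on UNIV (\<lambda>x. lip0_apply g (f x))"
      using lipschitz_on_compose2[OF L lipschitz_on_subset[OF lip_const_lipschitz subset_UNIV]]
      by blast
    then show ?thesis unfolding P_def using f0 by (subst Abs_lip0_inverse) auto
  qed
  have blP: "bounded_linear P"
  proof (rule bounded_linear_intro[of _ L])
    show "P (g + h) = P g + P h" for g h by (rule lip0_eqI) (simp add: P)
    show "P (r *\<^sub>R g) = r *\<^sub>R P g" for r g by (rule lip0_eqI) (simp add: P)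
    show "norm (P g) \<le> norm g * L" for g
    proof (rule lip0_norm_le)
      fix x y
      have "\<bar>lip0_apply (P g) x - lip0_apply (P g) y\<bar> \<le> norm g * dist (f x) (f y)"
        unfolding P by (rule lip0_dist_le)
      also have "\<dots> \<le> norm g * (L * dist x y)"
        using lipschitz_onD[OF L, of x y] by (intro mult_left_mono) auto
      finally show "\<bar>lip0_apply (P g) x - lip0_apply (P g) y\<bar> \<le> norm g * L * dist x y"
        by (simp add: mult.assoc)
    qed (use L0 in simp)
  qed
  define Q :: "('a lip0 \<Rightarrow>\<^sub>L real) \<Rightarrow> ('b lip0 \<Rightarrow>\<^sub>L real)" where "Q \<phi> = \<phi> o\<^sub>L Blinfun P" for \<phi>
  have blQ: "bounded_linear Q"
    unfolding Q_def by (rule bounded_bilinear.bounded_linear_left[OF bounded_bilinear_blinfun_compose])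
  have Qe: "Q (lip0_eval x) = lip0_eval (f x)" for x
    by (rule blinfun_eqI) (simp add: Q_def P bounded_linear_Blinfun_apply[OF blP])
  have Qmem: "Q \<phi> \<in> closure (span (range lip0_eval))"
    if "\<phi> \<in> closure (span (range lip0_eval))" for \<phi>
  proof -
    have "Q ` closure (span (range lip0_eval)) \<subseteq> closure (Q ` span (range lip0_eval))"
      by (rule continuous_image_closure_subset[of UNIV])
         (auto intro: linear_continuous_on[OF blQ])
    also have "Q ` span (range lip0_eval) = span (Q ` range lip0_eval)"
      using linear_span_image[of Q] bounded_linear.linear[OF blQ] by metis
    also have "\<dots> \<subseteq> span (range lip0_eval)"
      by (intro span_mono) (auto simp: Qe)
    finally show ?thesis using that closure_mono by blast
  qed
  define T :: "'a lipfree \<Rightarrow> 'b lipfree" where "T u = Abs_lipfree (Q (lipfree_functional u))" for u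
  have T: "lipfree_functional (T u) = Q (lipfree_functional u)" for u
    unfolding T_def by (rule Abs_lipfree_inverse[OF Qmem[OF lipfree_functional]])
  have blT: "bounded_linear T"
  proof -
    obtain K where K: "\<And>\<phi>. norm (Q \<phi>) \<le> norm \<phi> * K"
      using bounded_linear.bounded[OF blQ] by blast
    interpret Q: bounded_linear Q by (rule blQ)
    show ?thesis
    proof (rule bounded_linear_intro[of _ K])
      show "T (u + v) = T u + T v" for u v
        by (simp add: T plus_lipfree.rep_eq Q.add flip: lipfree_functional_inject)
      show "T (r *\<^sub>R u) = r *\<^sub>R T u" for r u
        by (simp add: T scaleR_lipfree.rep_eq Q.scaleR flip: lipfree_functional_inject)
      show "norm (T u) \<le> norm u * K" for u
        using K[of "lipfree_functional u"] by (simp add: norm_lipfree.rep_eq T)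
    qed
  qed
  show "\<exists>T. \<forall>x. blinfun_apply T (lipfree_delta x) = lipfree_delta (f x)"
    by (rule exI[of _ "Blinfun T"])
       (simp add: bounded_linear_Blinfun_apply[OF blT] T lipfree_delta.rep_eq Qe
         flip: lipfree_functional_inject)
next
  fix S T :: "'a lipfree \<Rightarrow>\<^sub>L 'b lipfree"
  assume S: "\<forall>x. blinfun_apply S (lipfree_delta x) = lipfree_delta (f x)"
    and T: "\<forall>x. blinfun_apply T (lipfree_delta x) = lipfree_delta (f x)"
  have "span (range lipfree_delta) \<subseteq> {u. blinfun_apply (S - T) u = 0}"
    by (rule span_minimal)
       (use S T in \<open>auto simp: subspace_def blinfun.add_right blinfun.scaleR_right
          blinfun.diff_left\<close>)
  moreover have "closed {u. blinfun_apply (S - T) u = 0}"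
    by (intro closed_Collect_eq continuous_intros)
  ultimately have "closure (span (range lipfree_delta)) \<subseteq> {u. blinfun_apply (S - T) u = 0}"
    by (rule closure_minimal)
  then have "blinfun_apply (S - T) u = 0" for u
    unfolding closure_span_lipfree_delta by auto
  then show "S = T" by (intro blinfun_eqI) (simp add: blinfun.diff_left)
qed

lemma lipfree_map_delta:
  assumes "\<exists>L. L-lipschitz_on UNIV f" and "f 0 = 0"
  shows "blinfun_apply (lipfree_map f) (lipfree_delta x) = lipfree_delta (f x)"
  using theI'[OF lipfree_map_ex1[OF assms]] unfolding lipfree_map_def by blast


section \<open>RNP sets and strong Radon-Nikodym operators\<close>

text \<open>
  The Bochner integral of the library is restricted to second countable spaces. The following is
  its definition without that restriction. By the approximation condition \<open>h\<close> is almost everywhere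
  a limit of simple functions, hence strongly measurable.
\<close>

definition has_banach_integral :: "'w measure \<Rightarrow> ('w \<Rightarrow> 'x::real_normed_vector) \<Rightarrow> 'x \<Rightarrow> bool" where
  "has_banach_integral P h x \<longleftrightarrow>
     h \<in> borel_measurable P \<and>
     (\<exists>s. (\<forall>i. Bochner_Integration.simple_bochner_integrable P (s i)) \<and>
          (\<lambda>i. \<integral>\<^sup>+\<omega>. norm (h \<omega> - s i \<omega>) \<partial>P) \<longlonglongrightarrow> 0 \<and>
          (\<lambda>i. Bochner_Integration.simple_bochner_integral P (s i)) \<longlonglongrightarrow> x)"

lemma has_banach_integral_iff_has_bochner_integral:
  fixes h :: "'w \<Rightarrow> 'x::{real_normed_vector, second_countable_topology}"
  shows "has_banach_integral P h x \<longleftrightarrow> has_bochner_integral P h x"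
  unfolding has_banach_integral_def has_bochner_integral.simps by blast

definition vector_measure :: "'w measure \<Rightarrow> ('w set \<Rightarrow> 'x::real_normed_vector) \<Rightarrow> bool" where
  "vector_measure P m \<longleftrightarrow>
     (\<forall>A :: nat \<Rightarrow> 'w set. range A \<subseteq> sets P \<longrightarrow> disjoint_family A \<longrightarrow>
        (\<lambda>i. m (A i)) sums m (\<Union>i. A i))"

text \<open>
  The vector measure is required to vanish on null sets: the condition on the averages says nothing
  about them, and on any \<open>'w\<close> with two elements no set \<open>C\<close> with two points would qualify otherwise
  (put mass one at one point and let \<open>m\<close> charge the other).
  The clause for \<open>B = space P\<close> contains the integrability of \<open>h\<close>.

  A definition cannot quantify over types, so the type \<open>'w\<close> of the points of the probability
  spaces is a parameter. If \<open>'w\<close> is small, for instance finite, the condition is much too weak.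
  Taking a type of the form \<open>'v + real\<close> with \<open>'v\<close> arbitrary avoids this: it carries a copy of
  every probability space on \<open>'v\<close> as well as of Lebesgue measure on the unit interval.
\<close>

definition rnp_set :: "'w itself \<Rightarrow> 'x::banach set \<Rightarrow> bool" where
  "rnp_set _ C \<longleftrightarrow>
     closed C \<and> bounded C \<and>
     (\<forall>(P :: 'w measure) (m :: 'w set \<Rightarrow> 'x).
        prob_space P \<longrightarrow> vector_measure P m \<longrightarrow>
        (\<forall>B\<in>sets P. measure P B = 0 \<longrightarrow> m B = 0) \<longrightarrow>
        {m B /\<^sub>R measure P B | B. B \<in> sets P \<and> measure P B > 0} \<subseteq> C \<longrightarrow>
        (\<exists>h. \<forall>B\<in>sets P. has_banach_integral P (\<lambda>\<omega>. indicator B \<omega> *\<^sub>R h \<omega>) (m B)))"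

definition strong_radon_nikodym ::
  "'w itself \<Rightarrow> ('x::real_normed_vector \<Rightarrow>\<^sub>L 'y::banach) \<Rightarrow> bool" where
  "strong_radon_nikodym W T \<longleftrightarrow> rnp_set W (closure (blinfun_apply T ` cball 0 1))"


section \<open>The space \<open>L\<^sub>1\<close> and operators fixing a copy of it\<close>

abbreviation unit_leb :: "real measure" where "unit_leb \<equiv> lebesgue_on {0..1}"

definition l1_rel :: "(real \<Rightarrow> real) \<Rightarrow> (real \<Rightarrow> real) \<Rightarrow> bool" where
  "l1_rel u v \<longleftrightarrow> integrable unit_leb u \<and> integrable unit_leb v \<and> (AE t in unit_leb. u t = v t)"

quotient_type l1 = "real \<Rightarrow> real" / partial: l1_rel
proof (rule part_equivpI)
  show "\<exists>u. l1_rel u u" by (rule exI[of _ "\<lambda>_. 0"]) (simp add: l1_rel_def)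
  show "symp l1_rel" by (rule sympI) (auto simp: l1_rel_def elim: eventually_mono)
  show "transp l1_rel"
  proof (rule transpI)
    fix u v w assume "l1_rel u v" "l1_rel v w"
    then show "l1_rel u w" unfolding l1_rel_def by (auto elim: eventually_elim2)
  qed
qed

instantiation l1 :: real_vector
begin

lift_definition zero_l1 :: l1 is "\<lambda>_. 0"
  by (simp add: l1_rel_def)

lift_definition plus_l1 :: "l1 \<Rightarrow> l1 \<Rightarrow> l1" is "\<lambda>u v t. u t + v t"
  unfolding l1_rel_def by (auto elim: eventually_elim2)

lift_definition uminus_l1 :: "l1 \<Rightarrow> l1" is "\<lambda>u t. - u t"
  unfolding l1_rel_def by auto

lift_definition minus_l1 :: "l1 \<Rightarrow> l1 \<Rightarrow> l1" is "\<lambda>u v t. u t - v t"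
  unfolding l1_rel_def by (auto elim: eventually_elim2)

lift_definition scaleR_l1 :: "real \<Rightarrow> l1 \<Rightarrow> l1" is "\<lambda>c u t. c * u t"
  unfolding l1_rel_def by (auto elim: eventually_mono)

instance
proof
  fix u v w :: l1 and a b :: real
  show "u + v + w = u + (v + w)" by transfer (auto simp: l1_rel_def algebra_simps)
  show "u + v = v + u" by transfer (auto simp: l1_rel_def algebra_simps)
  show "0 + u = u" by transfer (auto simp: l1_rel_def)
  show "- u + u = 0" by transfer (auto simp: l1_rel_def)
  show "u - v = u + - v" by transfer (auto simp: l1_rel_def)
  show "a *\<^sub>R (u + v) = a *\<^sub>R u + a *\<^sub>R v" by transfer (auto simp: l1_rel_def algebra_simps)
  show "(a + b) *\<^sub>R u = a *\<^sub>R u + b *\<^sub>R u" by transfer (auto simp: l1_rel_def algebra_simps)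
  show "a *\<^sub>R b *\<^sub>R u = (a * b) *\<^sub>R u" by transfer (auto simp: l1_rel_def algebra_simps)
  show "1 *\<^sub>R u = u" by transfer (auto simp: l1_rel_def)
qed

end

instantiation l1 :: real_normed_vector
begin

lift_definition norm_l1 :: "l1 \<Rightarrow> real" is "\<lambda>u. \<integral>t. \<bar>u t\<bar> \<partial>unit_leb"
  unfolding l1_rel_def by (intro integral_cong_AE) (auto elim: eventually_mono)

definition dist_l1 :: "l1 \<Rightarrow> l1 \<Rightarrow> real" where "dist_l1 u v = norm (u - v)"
definition sgn_l1 :: "l1 \<Rightarrow> l1" where "sgn_l1 u = u /\<^sub>R norm u"
definition uniformity_l1 :: "(l1 \<times> l1) filter" where
  "uniformity_l1 = (INF e\<in>{0<..}. principal {(x, y). dist x y < e})"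
definition open_l1 :: "l1 set \<Rightarrow> bool" where
  "open_l1 U \<longleftrightarrow> (\<forall>x\<in>U. eventually (\<lambda>(x', y). x' = x \<longrightarrow> y \<in> U) uniformity)"

instance
proof
  fix u v :: l1 and a :: real
  show "dist u v = norm (u - v)" by (rule dist_l1_def)
  show "sgn u = u /\<^sub>R norm u" by (rule sgn_l1_def)
  show "uniformity = (INF e\<in>{0<..}. principal {(x::l1, y). dist x y < e})"
    by (rule uniformity_l1_def)
  show "open U \<longleftrightarrow> (\<forall>x\<in>U. \<forall>\<^sub>F (x', y) in uniformity. x' = x \<longrightarrow> y \<in> U)" for U :: "l1 set"
    by (rule open_l1_def)
  show "norm u = 0 \<longleftrightarrow> u = 0"
  proof transfer
    fix u :: "real \<Rightarrow> real" assume "l1_rel u u"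
    then have u: "integrable unit_leb u" by (simp add: l1_rel_def)
    have "(\<integral>t. \<bar>u t\<bar> \<partial>unit_leb) = 0 \<longleftrightarrow> (AE t in unit_leb. \<bar>u t\<bar> = 0)"
      using u by (intro integral_nonneg_eq_0_iff_AE) auto
    then show "(\<integral>t. \<bar>u t\<bar> \<partial>unit_leb) = 0 \<longleftrightarrow> l1_rel u (\<lambda>_. 0)"
      using u by (simp add: l1_rel_def)
  qed
  show "norm (u + v) \<le> norm u + norm v"
  proof transfer
    fix u v :: "real \<Rightarrow> real" assume "l1_rel u u" "l1_rel v v"
    then have uv: "integrable unit_leb u" "integrable unit_leb v" by (auto simp: l1_rel_def)
    have "(\<integral>t. \<bar>u t + v t\<bar> \<partial>unit_leb) \<le> (\<integral>t. \<bar>u t\<bar> + \<bar>v t\<bar> \<partial>unit_leb)"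
      using uv by (intro integral_mono) auto
    also have "\<dots> = (\<integral>t. \<bar>u t\<bar> \<partial>unit_leb) + (\<integral>t. \<bar>v t\<bar> \<partial>unit_leb)"
      using uv by (intro Bochner_Integration.integral_add) auto
    finally show "(\<integral>t. \<bar>u t + v t\<bar> \<partial>unit_leb)
      \<le> (\<integral>t. \<bar>u t\<bar> \<partial>unit_leb) + (\<integral>t. \<bar>v t\<bar> \<partial>unit_leb)" .
  qed
  show "norm (a *\<^sub>R u) = \<bar>a\<bar> * norm u" by transfer (simp add: abs_mult)
qed

end

text \<open>For linear \<open>T\<close>: \<open>T\<close> restricted to the subspace \<open>Z\<close> is a linear homeomorphism onto its image.\<close>

definition isomorphic_embedding_on ::
  "'x::real_normed_vector set \<Rightarrow> ('x \<Rightarrow> 'y::real_normed_vector) \<Rightarrow> bool" where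
  "isomorphic_embedding_on Z T \<longleftrightarrow>
     (\<exists>c>0. \<exists>C. \<forall>z\<in>Z. c * norm z \<le> norm (T z) \<and> norm (T z) \<le> C * norm z)"

definition isomorphic_to_l1 :: "'x::real_normed_vector set \<Rightarrow> bool" where
  "isomorphic_to_l1 Z \<longleftrightarrow>
     (\<exists>J :: l1 \<Rightarrow> 'x. linear J \<and> isomorphic_embedding_on UNIV J \<and> range J = Z)"

definition fixes_copy_of_l1 :: "('x::real_normed_vector \<Rightarrow>\<^sub>L 'y::real_normed_vector) \<Rightarrow> bool" where
  "fixes_copy_of_l1 T \<longleftrightarrow>
     (\<exists>Z. subspace Z \<and> isomorphic_to_l1 Z \<and> isomorphic_embedding_on Z (blinfun_apply T))"

end

theory Submission
  imports Defs
begin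

text \<open>
  If \<open>range f\<close> is \<open>\<H>\<^sup>1\<close>-null, it can be covered by finitely many open sets whose diameters have
  an arbitrarily small sum. Gluing these sets to points shows that \<open>1\<close>-Lipschitz functions are
  uniform limits of locally constant \<open>1\<close>-Lipschitz functions. A gliding hump argument makes the
  free space of \<open>range f\<close> the dual of the space of locally constant functions, and a vector measure with
  bounded averages gets a density by applying the Radon-Nikodym theorem to its pairings with
  countably many locally constant functions.

  A strong Radon-Nikodym operator cannot fix a copy of \<open>L\<^sub>1\<close>, since the vector measure
  \<open>B \<mapsto> T (J 1\<^sub>B)\<close> on the unit interval would have a density, which is almost constant on some set \<open>A\<close>;
  splitting \<open>A\<close> into halves \<open>X\<close>, \<open>Y\<close> makes \<open>T (J (1\<^sub>X - 1\<^sub>Y))\<close> too small.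

  If \<open>range f\<close> is not null, then neither is some \<open>f (\<gamma> A)\<close> with \<open>A\<close> a bounded set of reals and \<open>\<gamma>\<close>
  Lipschitz, so two points of \<open>\<sigma> = f \<circ> \<gamma>\<close> lie further apart than the gaps of \<open>closure A\<close> between
  their parameters allow. Hence \<open>t \<mapsto> d (\<sigma> p, \<sigma> t)\<close> is expanding on a compact set \<open>E\<close> of positive
  measure. Removing the jumps across the gaps of \<open>E\<close> from \<open>t \<mapsto> \<delta> (\<gamma> t)\<close> gives a Lipschitz curve whose
  increments span a copy of \<open>L\<^sub>1\<close> on which \<open>f\<close> acts isomorphically, as one sees by testing with
  piecewise affine functions of \<open>d (\<sigma> p, \<cdot>)\<close>.
\<close>

section \<open>Operators fixing a copy of \<open>L\<^sub>1\<close> are not strong Radon-Nikodym\<close>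

text \<open>In the step from a positive image to a copy of \<open>L_1\<close> no derivative is at
  hand: Lipschitz curves in a free space may be nowhere differentiable. The gapless increment over
  \<open>[s, t]\<close> replaces the integral of the derivative over
  \<open>E \<inter> [s, t]\<close>; it is built from differences and absolutely convergent sums
  alone. The set \<open>E\<close> may contain limit points of \<open>A\<close> outside
  \<open>A\<close>; they are reached in the free space, which is complete whatever the metric space
  is. In the construction of densities the obstacle is that each scalar density is determined only
  almost everywhere, so that linearity and boundedness in the test function can be secured
  simultaneously only along a countable family. This is why a countable norming set is extracted.
  The locally constant approximations keep the Lipschitz constant at most \<open>1\<close>, so that
  they compute norms in the free space exactly.\<close>

abbreviation sbi :: "'w measure \<Rightarrow> ('w \<Rightarrow> 'x::real_normed_vector) \<Rightarrow> 'x" where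
  "sbi \<equiv> Bochner_Integration.simple_bochner_integral"

abbreviation sb_integrable :: "'w measure \<Rightarrow> ('w \<Rightarrow> 'x::real_normed_vector) \<Rightarrow> bool" where
  "sb_integrable \<equiv> Bochner_Integration.simple_bochner_integrable"

text \<open>Outside second countable spaces the difference of two measurable functions need not be
  measurable. Here \<open>s\<close> takes finitely many values, so the norm splits into the scalar
  functions \<open>norm (h \<omega> - y)\<close> on the level sets of \<open>s\<close>.\<close>

lemma borel_measurable_norm_diff_simple:
  fixes h s :: "'w \<Rightarrow> 'x::real_normed_vector"
  assumes h: "h \<in> borel_measurable P" and s: "simple_function P s"
  shows "(\<lambda>\<omega>. norm (h \<omega> - s \<omega>)) \<in> borel_measurable P"
proof -
  have fin: "finite (s ` space P)" using s by (rule simple_functionD)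
  have "(\<lambda>\<omega>. \<Sum>y\<in>s ` space P. indicator (s -` {y} \<inter> space P) \<omega> * norm (h \<omega> - y)) \<in> borel_measurable P"
  proof (intro borel_measurable_sum borel_measurable_times borel_measurable_indicator)
    fix y
    show "s -` {y} \<inter> space P \<in> sets P" using s by (rule simple_functionD)
    have "(\<lambda>x. norm (x - y)) \<in> borel_measurable borel"
      by (intro borel_measurable_continuous_onI continuous_intros)
    from measurable_compose[OF h this] show "(\<lambda>\<omega>. norm (h \<omega> - y)) \<in> borel_measurable P" .
  qed
  moreover have "(\<Sum>y\<in>s ` space P. indicator (s -` {y} \<inter> space P) \<omega> * norm (h \<omega> - y))
    = norm (h \<omega> - s \<omega>)"
    if "\<omega> \<in> space P" for \<omega>
  proof -
    have "(\<Sum>y\<in>s ` space P. indicator (s -` {y} \<inter> space P) \<omega> * norm (h \<omega> - y))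
      = (\<Sum>y\<in>s ` space P. if s \<omega> = y then norm (h \<omega> - y) else 0)"
      using that by (intro sum.cong) auto
    also have "\<dots> = norm (h \<omega> - s \<omega>)" using that fin by simp
    finally show ?thesis .
  qed
  ultimately show ?thesis by (subst measurable_cong) auto
qed

text \<open>The integral \<open>x\<close> is known only as a limit of integrals of simple functions
  \<open>t i\<close>. The triangle inequality through \<open>h\<close> bounds
  \<open>sbi P (t i) - sbi P s\<close>, and the term with \<open>t i\<close> vanishes in the
  limit.\<close>

lemma has_banach_integral_norm_diff_le:
  assumes h: "has_banach_integral P h x" and s: "sb_integrable P s"
  shows "ennreal (norm (x - sbi P s)) \<le> (\<integral>\<^sup>+\<omega>. norm (h \<omega> - s \<omega>) \<partial>P)"
proof -
  from h obtain t where hm: "h \<in> borel_measurable P" and t: "\<And>i. sb_integrable P (t i)"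
    and t0: "(\<lambda>i. \<integral>\<^sup>+\<omega>. norm (h \<omega> - t i \<omega>) \<partial>P) \<longlonglongrightarrow> 0" and tx: "(\<lambda>i. sbi P (t i)) \<longlonglongrightarrow> x"
    unfolding has_banach_integral_def by blast
  have sim: "simple_function P s" "\<And>i. simple_function P (t i)"
    using s t by (auto elim: simple_bochner_integrable.cases)
  note m = borel_measurable_norm_diff_simple[OF hm]
  have le: "ennreal (norm (sbi P (t i) - sbi P s))
      \<le> (\<integral>\<^sup>+\<omega>. norm (h \<omega> - t i \<omega>) \<partial>P) + (\<integral>\<^sup>+\<omega>. norm (h \<omega> - s \<omega>) \<partial>P)" for i
  proof -
    have ts: "sb_integrable P (\<lambda>\<omega>. t i \<omega> - s \<omega>)"
      by (intro simple_bochner_integrable_compose2[where p="(-)"] t s) auto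
    have "norm (sbi P (t i) - sbi P s) = norm (sbi P (\<lambda>\<omega>. t i \<omega> - s \<omega>))"
      by (simp add: simple_bochner_integral_diff t s)
    also have "\<dots> \<le> sbi P (\<lambda>\<omega>. norm (t i \<omega> - s \<omega>))"
      by (rule simple_bochner_integral_norm_bound[OF ts])
    finally have "ennreal (norm (sbi P (t i) - sbi P s)) \<le> ennreal (sbi P (\<lambda>\<omega>. norm (t i \<omega> - s \<omega>)))"
      by (rule ennreal_leI)
    also have "\<dots> = (\<integral>\<^sup>+\<omega>. norm (t i \<omega> - s \<omega>) \<partial>P)"
      by (intro simple_bochner_integral_eq_nn_integral
          simple_bochner_integrable_compose2[where p="\<lambda>x y. norm (x - y)"] t s) auto
    also have "\<dots> \<le> (\<integral>\<^sup>+\<omega>. ennreal (norm (h \<omega> - t i \<omega>)) + ennreal (norm (h \<omega> - s \<omega>)) \<partial>P)"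
    proof (rule nn_integral_mono)
      fix \<omega>
      show "ennreal (norm (t i \<omega> - s \<omega>)) \<le> ennreal (norm (h \<omega> - t i \<omega>)) + ennreal (norm (h \<omega> - s \<omega>))"
        using norm_triangle_ineq4[of "h \<omega> - s \<omega>" "h \<omega> - t i \<omega>"]
        by (simp flip: ennreal_plus add: add.commute)
    qed
    also have "\<dots> = (\<integral>\<^sup>+\<omega>. norm (h \<omega> - t i \<omega>) \<partial>P) + (\<integral>\<^sup>+\<omega>. norm (h \<omega> - s \<omega>) \<partial>P)"
      by (intro nn_integral_add measurable_compose[OF m[OF sim(1)] measurable_ennreal]
          measurable_compose[OF m[OF sim(2)] measurable_ennreal])
    finally show ?thesis .
  qed
  have l: "(\<lambda>i. ennreal (norm (sbi P (t i) - sbi P s))) \<longlonglongrightarrow> ennreal (norm (x - sbi P s))"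
    by (intro tendsto_ennrealI tendsto_intros tx)
  have r: "(\<lambda>i. (\<integral>\<^sup>+\<omega>. norm (h \<omega> - t i \<omega>) \<partial>P) + (\<integral>\<^sup>+\<omega>. norm (h \<omega> - s \<omega>) \<partial>P))
      \<longlonglongrightarrow> 0 + (\<integral>\<^sup>+\<omega>. norm (h \<omega> - s \<omega>) \<partial>P)"
    by (intro tendsto_add t0 tendsto_const)
  show ?thesis using LIMSEQ_le[OF l r] le by auto
qed

lemma sb_integrable_indicator_scaleR:
  assumes "finite_measure P" "B \<in> sets P"
  shows "sb_integrable P (\<lambda>\<omega>. indicator B \<omega> *\<^sub>R y)"
    and "sbi P (\<lambda>\<omega>. indicator B \<omega> *\<^sub>R y) = measure P B *\<^sub>R y"
proof -
  interpret finite_measure P by fact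
  have i: "sb_integrable P (indicator B :: _ \<Rightarrow> real)"
    using assms by (intro simple_bochner_integrable.intros simple_function_indicator) auto
  show "sb_integrable P (\<lambda>\<omega>. indicator B \<omega> *\<^sub>R y)"
    using assms by (intro simple_bochner_integrable.intros simple_function_compose1[where g="\<lambda>r. r *\<^sub>R
        y"] simple_function_indicator) auto
  have "linear (\<lambda>r::real. r *\<^sub>R y)" by (simp add: linear_iff algebra_simps)
  from simple_bochner_integral_linear[OF this i]
  show "sbi P (\<lambda>\<omega>. indicator B \<omega> *\<^sub>R y) = measure P B *\<^sub>R y"
    using assms by (simp add: simple_bochner_integrable_eq_integral[OF i])
qed

text \<open>A substitute for Lebesgue points: a simple function close to \<open>h\<close> in mean
  has a level set on which \<open>h\<close> is close in mean to a single value
  \<open>c\<close>.\<close>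

lemma has_banach_integral_average_close:
  fixes h :: "'w \<Rightarrow> 'x::real_normed_vector"
  assumes P: "prob_space P" and e: "e > 0"
    and h: "\<And>B. B \<in> sets P \<Longrightarrow> has_banach_integral P (\<lambda>\<omega>. indicator B \<omega> *\<^sub>R h \<omega>) (m B)"
  shows "\<exists>A\<in>sets P. \<exists>c. measure P A > 0 \<and>
    (\<forall>B\<in>sets P. B \<subseteq> A \<longrightarrow> norm (m B - measure P B *\<^sub>R c) \<le> e * measure P A)"
proof -
  interpret prob_space P by fact
  let ?h = "\<lambda>\<omega>. indicator (space P) \<omega> *\<^sub>R h \<omega>"
  from h[OF sets.top] obtain s where hm: "?h \<in> borel_measurable P" and s: "\<And>i. sb_integrable P (s i)"
    and s0: "(\<lambda>i. \<integral>\<^sup>+\<omega>. norm (?h \<omega> - s i \<omega>) \<partial>P) \<longlonglongrightarrow> 0"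
    unfolding has_banach_integral_def by blast
  have "\<forall>\<^sub>F i in sequentially. (\<integral>\<^sup>+\<omega>. norm (?h \<omega> - s i \<omega>) \<partial>P) < ennreal e"
    using s0 e by (intro order_tendstoD(2)) auto
  then obtain i where i: "(\<integral>\<^sup>+\<omega>. norm (?h \<omega> - s i \<omega>) \<partial>P) < ennreal e"
    by (auto simp: eventually_sequentially)
  define S where "S = s i"
  have S: "simple_function P S" using s[of i]
    by (auto simp: S_def elim: simple_bochner_integrable.cases)
  define k where "k \<omega> = norm (?h \<omega> - S \<omega>)" for \<omega>
  have [measurable]: "k \<in> borel_measurable P"
    unfolding k_def by (rule borel_measurable_norm_diff_simple[OF hm S])
  define D where "D y = S -` {y} \<inter> space P" for y
  have D[measurable]: "D y \<in> sets P" for y unfolding D_def using S by (rule simple_functionD)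
  have fin: "finite (S ` space P)" using S by (rule simple_functionD)
  \<comment> \<open>Otherwise the error on every level set would be at least \<open>e\<close> times
    its measure; summing over the level sets contradicts \<open>i\<close>.\<close>
  have "\<exists>y. measure P (D y) > 0 \<and> (\<integral>\<^sup>+\<omega>. indicator (D y) \<omega> * ennreal (k \<omega>) \<partial>P)
    \<le> ennreal (e * measure P (D y))"
  proof (rule ccontr)
    assume neg: "\<not> ?thesis"
    have le: "ennreal (e * measure P (D y)) \<le> (\<integral>\<^sup>+\<omega>. indicator (D y) \<omega> * ennreal (k \<omega>) \<partial>P)" for y
    proof (cases "measure P (D y) > 0")
      case True
      with neg show ?thesis by (metis less_imp_le not_le)
    next
      case False
      then have "measure P (D y) = 0" by (simp add: not_less measure_le_0_iff)
      then show ?thesis by simp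
    qed
    have one: "(\<Sum>y\<in>S ` space P. indicator (D y) \<omega> * ennreal (k \<omega>)) = ennreal (k \<omega>)" if "\<omega> \<in> space P"
      for \<omega>
    proof -
      have "(\<Sum>y\<in>S ` space P. indicator (D y) \<omega> * ennreal (k \<omega>)) = (\<Sum>y\<in>S ` space P. if S \<omega>
        = y then ennreal (k \<omega>) else 0)"
        using that by (intro sum.cong) (auto simp: D_def)
      also have "\<dots> = ennreal (k \<omega>)" using that fin by simp
      finally show ?thesis .
    qed
    have "1 = prob (\<Union>y\<in>S ` space P. D y)"
      by (simp add: prob_space[symmetric]) (auto simp: D_def intro!: arg_cong[where f=prob])
    also have "\<dots> = (\<Sum>y\<in>S ` space P. measure P (D y))"
      using fin by (intro finite_measure_finite_Union) (auto simp: disjoint_family_on_def D_def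
          intro!: simple_functionD[OF S])
    finally have "ennreal e = ennreal (\<Sum>y\<in>S ` space P. e * measure P (D y))"
      by (simp flip: sum_distrib_left)
    also have "\<dots> = (\<Sum>y\<in>S ` space P. ennreal (e * measure P (D y)))"
      using e by (intro sum_ennreal[symmetric]) auto
    also have "\<dots> \<le> (\<Sum>y\<in>S ` space P. \<integral>\<^sup>+\<omega>. indicator (D y) \<omega> * ennreal (k \<omega>) \<partial>P)"
      by (intro sum_mono le)
    also have "\<dots> = (\<integral>\<^sup>+\<omega>. (\<Sum>y\<in>S ` space P. indicator (D y) \<omega> * ennreal (k \<omega>)) \<partial>P)"
      by (intro nn_integral_sum[symmetric]) measurable
    also have "\<dots> = (\<integral>\<^sup>+\<omega>. ennreal (k \<omega>) \<partial>P)"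
      by (intro nn_integral_cong one)
    also have "\<dots> < ennreal e" using i by (simp add: k_def S_def)
    finally show False by simp
  qed
  then obtain y where y: "measure P (D y) > 0"
    "(\<integral>\<^sup>+\<omega>. indicator (D y) \<omega> * ennreal (k \<omega>) \<partial>P) \<le> ennreal (e * measure P (D y))" by blast
  have "norm (m B - measure P B *\<^sub>R y) \<le> e * measure P (D y)" if B: "B \<in> sets P" "B \<subseteq> D y" for B
  proof -
    have f: "finite_measure P" by unfold_locales
    have "ennreal (norm (m B - measure P B *\<^sub>R y))
      \<le> (\<integral>\<^sup>+\<omega>. norm (indicator B \<omega> *\<^sub>R h \<omega> - indicator B \<omega> *\<^sub>R y) \<partial>P)"
      using has_banach_integral_norm_diff_le[OF h[OF B(1)] sb_integrable_indicator_scaleR(1)[OF f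
          B(1)], of y]
      by (simp add: sb_integrable_indicator_scaleR(2)[OF f B(1)])
    also have "\<dots> \<le> (\<integral>\<^sup>+\<omega>. indicator (D y) \<omega> * ennreal (k \<omega>) \<partial>P)"
      using B by (intro nn_integral_mono) (auto simp: k_def D_def split: split_indicator)
    also note y(2)
    finally show ?thesis using e by simp
  qed
  with y(1) D show ?thesis by blast
qed

text \<open>The measure of \<open>A \<inter> {..t}\<close> is \<open>1\<close>-Lipschitz in
  \<open>t\<close>, so the intermediate value theorem finds half of the total.\<close>

lemma lebesgue_halving:
  assumes A: "A \<in> sets lebesgue" "A \<subseteq> {0..1::real}"
  shows "\<exists>t. measure lebesgue (A \<inter> {..t}) = measure lebesgue (A - {..t})"
proof -
  have fmA: "A \<in> fmeasurable lebesgue"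
    using A bounded_subset[OF bounded_closed_interval] by (intro bounded_set_imp_lmeasurable)
  have fm[simp]: "A \<inter> {..t} \<in> fmeasurable lebesgue" for t
    using fmA by (intro fmeasurable_Int_fmeasurable) auto
  define \<phi> where "\<phi> t = measure lebesgue (A \<inter> {..t})" for t
  have inc: "\<phi> t - \<phi> s \<le> t - s \<and> \<phi> s \<le> \<phi> t" if "s \<le> t" for s t
  proof -
    have "\<phi> t - \<phi> s = measure lebesgue (A \<inter> {..t} - A \<inter> {..s})"
      unfolding \<phi>_def using that
          by (intro measurable_measure_Diff[symmetric]) (auto simp: fmeasurableD)
    also have "\<dots> \<le> measure lebesgue {s..t}"
      using A by (intro measure_mono_fmeasurable) (auto intro!: sets.Diff)
    finally have "\<phi> t - \<phi> s \<le> t - s" using that by simp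
    moreover have "\<phi> s \<le> \<phi> t"
      unfolding \<phi>_def using that by (intro measure_mono_fmeasurable) (auto simp: fmeasurableD)
    ultimately show ?thesis by simp
  qed
  have "1-lipschitz_on UNIV \<phi>"
  proof (rule lipschitz_onI)
    fix s t show "dist (\<phi> s) (\<phi> t) \<le> 1 * dist s t"
      using inc[of s t] inc[of t s] by (cases "s \<le> t") (auto simp: dist_real_def)
  qed simp
  then have cont: "continuous_on {-1..1} \<phi>"
    by (intro lipschitz_on_continuous_on) (rule lipschitz_on_subset, auto)
  have "A \<inter> {..-1} = {}" "A \<inter> {..1} = A" using A by auto
  then have "\<phi> (-1) = 0" "\<phi> 1 = measure lebesgue A" by (simp_all add: \<phi>_def)
  then obtain t where t: "\<phi> t = measure lebesgue A / 2"
    using IVT'[of \<phi> "-1" "measure lebesgue A / 2" 1] cont by auto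
  have "measure lebesgue (A - A \<inter> {..t}) = measure lebesgue A - \<phi> t"
    unfolding \<phi>_def using A fmA by (intro measurable_measure_Diff) (auto simp: fmeasurableD)
  moreover have "A - A \<inter> {..t} = A - {..t}" by auto
  ultimately show ?thesis using t by (intro exI[of _ t]) (simp add: \<phi>_def)
qed

section \<open>Indicator functions as elements of \<open>l1\<close>\<close>

definition l1_ind :: "real set \<Rightarrow> l1" where
  "l1_ind B = abs_l1 (indicator B)"

lemma finite_measure_unit_leb: "finite_measure unit_leb"
  by (rule finite_measure_lebesgue_on) auto

lemma l1_rel_refl [simp]: "l1_rel u u \<longleftrightarrow> integrable unit_leb u"
  by (auto simp: l1_rel_def)

lemma integrable_unit_leb_indicator:
  "B \<in> sets unit_leb \<Longrightarrow> integrable unit_leb (indicator B :: real \<Rightarrow> real)"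
  using finite_measure.emeasure_finite[OF finite_measure_unit_leb, of B]
  by (intro integrable_real_indicator) (auto simp: top.not_eq_extremum)

lemma unit_leb_Int [simp]: "B \<in> sets unit_leb \<Longrightarrow> B \<inter> {0..1} = B"
  using sets.sets_into_space[of B unit_leb] by auto

lemma norm_l1_ind: "B \<in> sets unit_leb \<Longrightarrow> norm (l1_ind B) = measure unit_leb B"
  unfolding l1_ind_def by (subst norm_l1.abs_eq) (auto simp: integrable_unit_leb_indicator)

lemma l1_ind_diff:
  assumes "A \<in> sets unit_leb" "B \<in> sets unit_leb" "B \<subseteq> A"
  shows "l1_ind A - l1_ind B = l1_ind (A - B)"
proof -
  have "(\<lambda>t. indicator A t - indicator B t :: real) = indicator (A - B)"
    using assms(3) by (auto simp: fun_eq_iff split: split_indicator)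
  then show ?thesis
    unfolding l1_ind_def using assms
        by (subst minus_l1.abs_eq) (auto simp: integrable_unit_leb_indicator)
qed

lemma norm_l1_ind_diff:
  assumes "A \<in> sets unit_leb" "B \<in> sets unit_leb" "A \<inter> B = {}"
  shows "norm (l1_ind A - l1_ind B) = measure unit_leb A + measure unit_leb B"
proof -
  have "(\<lambda>t. \<bar>indicator A t - indicator B t\<bar> :: real) = (\<lambda>t. indicator A t + indicator B t)"
    using assms(3) by (auto simp: fun_eq_iff split: split_indicator)
  then show ?thesis
    unfolding l1_ind_def using assms
    by (subst minus_l1.abs_eq; (subst norm_l1.abs_eq)?) (auto simp: integrable_unit_leb_indicator)
qed

text \<open>Partial sums are indicators of finite unions, so the norm of the error is the measure of
  what remains of the whole union; it tends to \<open>0\<close> by countable additivity.\<close>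

lemma l1_ind_sums:
  fixes B :: "nat \<Rightarrow> real set"
  assumes B: "range B \<subseteq> sets unit_leb" and d: "disjoint_family B"
  shows "(\<lambda>i. l1_ind (B i)) sums l1_ind (\<Union>i. B i)"
proof -
  interpret finite_measure unit_leb by (rule finite_measure_unit_leb)
  have m[measurable]: "B i \<in> sets unit_leb" for i using B by auto
  have U: "(\<Union>i. B i) \<in> sets unit_leb" "(\<Union>i<n. B i) \<in> sets unit_leb" for n by measurable
  have part: "(\<Sum>i<n. l1_ind (B i)) = l1_ind (\<Union>i<n. B i)" for n
  proof (induction n)
    case 0
    have "norm (l1_ind {}) = 0" by (subst norm_l1_ind) auto
    then show ?case by simp
  next
    case (Suc n)
    have "l1_ind (\<Union>i<Suc n. B i) - l1_ind (\<Union>i<n. B i) = l1_ind ((\<Union>i<Suc n. B i) - (\<Union>i<n. B i))"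
      by (intro l1_ind_diff U UN_mono) auto
    also have "(\<Union>i<Suc n. B i) - (\<Union>i<n. B i) = B n"
      using d by (auto simp: lessThan_Suc) (auto simp: disjoint_family_on_def dest: less_imp_neq)
    finally show ?case using Suc by (simp add: algebra_simps)
  qed
  have s: "(\<lambda>i. measure unit_leb (B i)) sums measure unit_leb (\<Union>i. B i)"
    using B d by (rule finite_measure_UNION)
  have part': "(\<Sum>i<n. measure unit_leb (B i)) = measure unit_leb (\<Union>i<n. B i)" for n
    using d by (intro finite_measure_finite_Union[symmetric]) (auto simp: disjoint_family_on_def)
  have "norm ((\<Sum>i<n. l1_ind (B i)) - l1_ind (\<Union>i. B i)) = measure unit_leb (\<Union>i. B i) - (\<Sum>i<n. measure
    unit_leb (B i))" for n
  proof -
    have "norm ((\<Sum>i<n. l1_ind (B i)) - l1_ind (\<Union>i. B i)) = norm (l1_ind ((\<Union>i. B i) - (\<Union>i<n. B i)))"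
      unfolding part by (subst norm_minus_commute, subst l1_ind_diff) (auto intro: U)
    also have "\<dots> = measure unit_leb (\<Union>i. B i) - measure unit_leb (\<Union>i<n. B i)"
      by (subst norm_l1_ind) (auto intro!: U finite_measure_Diff)
    finally show ?thesis by (simp add: part')
  qed
  moreover have "(\<lambda>n. measure unit_leb (\<Union>i. B i) - (\<Sum>i<n. measure unit_leb (B i))) \<longlonglongrightarrow> measure unit_leb
    (\<Union>i. B i) - measure unit_leb (\<Union>i. B i)"
    using s unfolding sums_def by (intro tendsto_intros)
  ultimately have "(\<lambda>n. norm ((\<Sum>i<n. l1_ind (B i)) - l1_ind (\<Union>i. B i))) \<longlonglongrightarrow> 0" by simp
  then show ?thesis unfolding sums_def by (rule LIM_zero_cancel[OF tendsto_norm_zero_cancel])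
qed

lemma strong_radon_nikodym_not_fixes_l1:
  fixes T :: "'x::real_normed_vector \<Rightarrow>\<^sub>L 'y::banach"
  assumes srn: "strong_radon_nikodym TYPE('w + real) T"
  shows "\<not> fixes_copy_of_l1 T"
proof
  assume "fixes_copy_of_l1 T"
  then obtain Z where Z: "isomorphic_to_l1 Z" and TZ: "isomorphic_embedding_on Z (blinfun_apply T)"
    unfolding fixes_copy_of_l1_def by blast
  from Z obtain J :: "l1 \<Rightarrow> 'x" where J: "linear J" "isomorphic_embedding_on UNIV J" "range J = Z"
    unfolding isomorphic_to_l1_def by blast
  from TZ obtain c1 where c1: "c1 > 0" "\<And>z. z \<in> Z \<Longrightarrow> c1 * norm z \<le> norm (T z)"
    unfolding isomorphic_embedding_on_def by blast
  from J(2) obtain c2 C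
    where c2: "c2 > 0" "\<And>q. c2 * norm q \<le> norm (J q)" "\<And>q. norm (J q) \<le> C * norm q"
    unfolding isomorphic_embedding_on_def by blast
  \<comment> \<open>A positive bound for \<open>J\<close>. Dividing by it in \<open>S\<close> brings
    the averages of \<open>m\<close> into the image of the unit ball under \<open>T\<close>.\<close>
  define K where "K = max C 1"
  have K: "K > 0" "norm (J q) \<le> K * norm q" for q
    using c2(3)[of q] mult_right_mono[of C K "norm q"] by (auto simp: K_def)
  define S where "S q = T (J q) /\<^sub>R K" for q
  have blJ: "bounded_linear J"
    using J(1) K(2) by (intro bounded_linear.intro bounded_linear_axioms.intro) (auto intro: exI[of _
        K] simp: mult.commute)
  have blS: "bounded_linear S"
    unfolding S_def
    by (intro bounded_linear_compose[OF bounded_linear_scaleR_right] bounded_linear_compose[OF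
        blinfun.bounded_linear_right blJ])
  interpret S: bounded_linear S by (rule blS)
  define c where "c = c1 * c2 / K"
  have c: "c > 0" using c1 c2 K by (simp add: c_def)
  have low: "c * norm q \<le> norm (S q)" for q
  proof -
    have "c1 * (c2 * norm q) \<le> c1 * norm (J q)" using c1(1) c2(2) by (intro mult_left_mono) auto
    also have "\<dots> \<le> norm (T (J q))" using J(3) by (intro c1(2)) auto
    finally show ?thesis using K(1) by (simp add: S_def c_def field_simps)
  qed
  \<comment> \<open>Lebesgue measure transported to the summand \<open>real\<close>, the reason for
    a sample type of the form \<open>'w + real\<close>.\<close>
  define P :: "('w + real) measure" where "P = embed_measure unit_leb Inr"
  have inj: "inj (Inr :: real \<Rightarrow> 'w + real)" by simp
  have setsP: "sets P = {Inr ` B |B. B \<in> sets unit_leb}" unfolding P_def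
    by (rule sets_embed_measure[OF inj])
  have vim: "Inr -` X \<in> sets unit_leb" if "X \<in> sets P" for X using that
    by (auto simp: setsP inj_vimage_image_eq)
  have img: "X = Inr ` (Inr -` X)" if "X \<in> sets P" for X using that by (auto simp: setsP)
  have em: "emeasure P (Inr ` B) = emeasure unit_leb B" if "B \<in> sets unit_leb" for B
    unfolding P_def by (rule emeasure_embed_measure_image[OF inj that])
  have me: "measure P X = measure unit_leb (Inr -` X)" if "X \<in> sets P" for X
    using img[OF that] em[OF vim[OF that]] by (simp add: measure_def)
  have P: "prob_space P"
  proof (rule prob_spaceI)
    have "space P = Inr ` space unit_leb" by (simp add: P_def space_embed_measure)
    then show "emeasure P (space P) = 1"
      by (subst \<open>space P = _\<close>, subst em) (auto simp: emeasure_restrict_space)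
  qed
  define m where "m X = S (l1_ind (Inr -` X))" for X :: "('w + real) set"
  have mle: "norm (m X) * K \<le> norm T * (K * measure P X)" if "X \<in> sets P" for X :: "('w + real) set"
  proof -
    have "norm (T (J (l1_ind (Inr -` X)))) \<le> norm T * norm (J (l1_ind (Inr -` X)))"
      by (rule norm_blinfun)
    also have "\<dots> \<le> norm T * (K * measure P X)"
      using K(2)[of "l1_ind (Inr -` X)"] that
          by (intro mult_left_mono) (simp_all add: norm_l1_ind vim me)
    finally show ?thesis using K(1) by (simp add: m_def S_def field_simps)
  qed
  have "vector_measure P m"
    unfolding vector_measure_def
  proof (intro allI impI)
    fix A :: "nat \<Rightarrow> ('w + real) set" assume A: "range A \<subseteq> sets P" "disjoint_family A"
    have "(\<lambda>i. l1_ind (Inr -` A i)) sums l1_ind (\<Union>i. Inr -` A i)"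
    proof (rule l1_ind_sums)
      show "range (\<lambda>i. Inr -` A i) \<subseteq> sets unit_leb" using A(1) vim by auto
      show "disjoint_family (\<lambda>i. Inr -` A i)" using A(2) by (auto simp: disjoint_family_on_def)
    qed
    from S.sums[OF this] show "(\<lambda>i. m (A i)) sums m (\<Union>i. A i)" by (simp add: m_def vimage_UN)
  qed
  moreover have "\<forall>B\<in>sets P. measure P B = 0 \<longrightarrow> m B = 0"
    using mle K(1) by (fastforce simp: mult_le_0_iff)
  moreover have "{m B /\<^sub>R measure P B |B. B \<in> sets P \<and> measure P B > 0} \<subseteq> closure (T ` cball 0 1)"
  proof safe
    fix B assume B: "B \<in> sets P" "measure P B > 0"
    define z where "z = J (l1_ind (Inr -` B)) /\<^sub>R (K * measure P B)"
    have "norm z \<le> 1"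
      using K(2)[of "l1_ind (Inr -` B)"] B K(1) by (simp add: z_def norm_l1_ind vim me field_simps)
    moreover have "m B /\<^sub>R measure P B = T z"
      by (simp add: m_def S_def z_def blinfun.scaleR_right)
    ultimately show "m B /\<^sub>R measure P B \<in> closure (T ` cball 0 1)"
      using closure_subset by fastforce
  qed
  ultimately obtain h
    where h: "\<And>B. B \<in> sets P \<Longrightarrow> has_banach_integral P (\<lambda>\<omega>. indicator B \<omega> *\<^sub>R h \<omega>) (m B)"
    using srn P unfolding strong_radon_nikodym_def rnp_set_def by meson
  \<comment> \<open>With \<open>c / 4\<close> the two halves of \<open>A\<close> contribute at most
    \<open>c / 2 * measure P A\<close> in total, against the lower bound
    \<open>c * measure P A\<close>.\<close>
  obtain A y where A: "A \<in> sets P" "measure P A > 0"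
    and Ay: "\<And>B. B \<in> sets P \<Longrightarrow> B \<subseteq> A \<Longrightarrow> norm (m B - measure P B *\<^sub>R y) \<le> c / 4 * measure P A"
    using has_banach_integral_average_close[OF P _ h, of "c / 4"] c by auto
  define A' :: "real set" where "A' = Inr -` A"
  have A': "A' \<in> sets lebesgue" "A' \<subseteq> {0..1}" "A' \<in> sets unit_leb"
    using vim[OF A(1)] by (auto simp: A'_def sets_restrict_space_iff)
  obtain t where t: "measure lebesgue (A' \<inter> {..t}) = measure lebesgue (A' - {..t})"
    using lebesgue_halving[OF A'(1,2)] by blast
  define X Y where "X = A' \<inter> {..t}" and "Y = A' - {..t}"
  have XY: "X \<in> sets unit_leb" "Y \<in> sets unit_leb" "X \<inter> Y = {}" "X \<union> Y = A'"
    using A' by (auto simp: X_def Y_def sets_restrict_space_iff)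
  \<comment> \<open>Equal masses make the two multiples of \<open>y\<close> cancel in the final
    estimate.\<close>
  have eq: "measure unit_leb X = measure unit_leb Y"
    using t A'(2) by (subst (1 2) measure_restrict_space) (auto simp: X_def Y_def)
  have sum: "measure unit_leb X + measure unit_leb Y = measure P A"
    using finite_measure.finite_measure_Union[OF finite_measure_unit_leb XY(1,2,3)] XY(4) me[OF A(1)]
    by (simp add: A'_def)
  have in_P: "Inr ` X \<in> sets P" "Inr ` Y \<in> sets P" "Inr ` X \<subseteq> A" "Inr ` Y \<subseteq> A"
    using XY by (auto simp: setsP X_def Y_def A'_def)
  have mX: "m (Inr ` X) = S (l1_ind X)" "m (Inr ` Y) = S (l1_ind Y)"
    "measure P (Inr ` X) = measure unit_leb X" "measure P (Inr ` Y) = measure unit_leb Y"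
    using in_P by (auto simp: m_def me inj_vimage_image_eq)
  have "c * measure P A \<le> norm (S (l1_ind X - l1_ind Y))"
    using low[of "l1_ind X - l1_ind Y"] by (simp add: norm_l1_ind_diff XY sum)
  also have "\<dots> = norm ((m (Inr ` X) - measure P (Inr ` X) *\<^sub>R y) - (m (Inr ` Y) - measure P (Inr ` Y)
    *\<^sub>R y))"
    by (simp add: S.diff mX eq)
  also have "\<dots> \<le> c / 4 * measure P A + c / 4 * measure P A"
    by (intro order_trans[OF norm_triangle_ineq4] add_mono Ay in_P)
  finally show False using c A(2) by simp
qed


section \<open>Null sets and Lipschitz maps on the line\<close>

lemma hausdorff1_eq_0D:
  fixes S :: "'a::metric_space set"
  assumes S: "hausdorff1 S = 0" and e: "e > 0"
  shows "\<exists>(U :: nat \<Rightarrow> 'a set) r. S \<subseteq> (\<Union>i. U i) \<and> (\<forall>i. 0 \<le> r i) \<and>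
    (\<forall>i. \<forall>x\<in>U i. \<forall>y\<in>U i. dist x y \<le> r i) \<and> (\<Sum>i. ennreal (r i)) \<le> ennreal e"
proof -
  have "hausdorff1_content 1 S \<le> hausdorff1 S"
    unfolding hausdorff1_def by (rule SUP_upper) simp
  then have "hausdorff1_content 1 S < ennreal e" using S e by simp
  then obtain U where U: "S \<subseteq> (\<Union>i. U i)" "\<And>i. bounded (U i)" "(\<Sum>i. ennreal (diameter (U i))) < ennreal
    e"
    unfolding hausdorff1_content_def INF_less_iff by auto
  show ?thesis
    by (rule exI[of _ U], rule exI[of _ "\<lambda>i. diameter (U i)"])
      (use U in \<open>auto intro: diameter_ge_0 diameter_bounded_bound less_imp_le\<close>)
qed

text \<open>Each bound \<open>r i\<close> is at most the sum of the series, so a cover with small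
  sum is automatically fine. The mesh parameter of the Hausdorff measure thus drops out.\<close>

lemma hausdorff1_eq_0I:
  fixes S :: "'a::metric_space set"
  assumes "\<And>e. e > 0 \<Longrightarrow> \<exists>(U :: nat \<Rightarrow> 'a set) r. S \<subseteq> (\<Union>i. U i) \<and> (\<forall>i. 0 \<le> r i) \<and>
    (\<forall>i. \<forall>x\<in>U i. \<forall>y\<in>U i. dist x y \<le> r i) \<and> (\<Sum>i. ennreal (r i)) \<le> ennreal e"
  shows "hausdorff1 S = 0"
proof -
  have "hausdorff1_content \<delta> S \<le> ennreal e" if \<delta>: "\<delta> > 0" and e: "e > 0" for \<delta> e
  proof -
    have "min e \<delta> > 0" using \<delta> e by simp
    from assms[OF this] obtain U :: "nat \<Rightarrow> 'a set" and r :: "nat \<Rightarrow> real"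
      where Ur: "S \<subseteq> (\<Union>i. U i)" "\<And>i. 0 \<le> r i"
      "\<And>i x y. x \<in> U i \<Longrightarrow> y \<in> U i \<Longrightarrow> dist x y \<le> r i" "(\<Sum>i. ennreal (r i)) \<le> ennreal (min e \<delta>)"
      by blast
    have b: "bounded (U i)" for i
      unfolding bounded_def using Ur(3) by (cases "U i = {}") blast+
    have d: "diameter (U i) \<le> r i" for i
      using Ur(2)[of i] Ur(3)[of _ i] by (auto simp: diameter_def intro!: cSUP_least)
    have "ennreal (r i) \<le> ennreal \<delta>" for i
    proof -
      have "ennreal (r i) \<le> (\<Sum>i. ennreal (r i))"
        using sum_le_suminf[OF summableI, of "{i}" "\<lambda>i. ennreal (r i)"] by simp
      also note Ur(4)
      also have "ennreal (min e \<delta>) \<le> ennreal \<delta>" by (intro ennreal_leI) simp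
      finally show ?thesis .
    qed
    then have r\<delta>: "r i \<le> \<delta>" for i using \<delta> by (auto simp: ennreal_le_iff)
    have "hausdorff1_content \<delta> S \<le> (\<Sum>i. ennreal (diameter (U i)))"
      unfolding hausdorff1_content_def
      by (rule INF_lower) (use Ur(1) b d r\<delta> order_trans in blast)
    also have "\<dots> \<le> (\<Sum>i. ennreal (r i))"
      by (intro suminf_le ennreal_leI d) auto
    also note Ur(4)
    also have "ennreal (min e \<delta>) \<le> ennreal e" by (intro ennreal_leI) simp
    finally show ?thesis .
  qed
  note content_le = this
  have "hausdorff1_content \<delta> S \<le> 0" if "\<delta> > 0" for \<delta>
  proof (rule ennreal_le_epsilon)
    fix e :: real assume "0 < e"
    from content_le[OF that this] show "hausdorff1_content \<delta> S \<le> 0 + ennreal e" by (simp only: add_0)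
  qed
  then have "hausdorff1 S \<le> 0" unfolding hausdorff1_def
    by (intro SUP_least) (simp only: greaterThan_iff)
  then show ?thesis by (simp only: le_zero_eq)
qed

lemma hausdorff1_eq_0_subset:
  fixes S T :: "'a::metric_space set"
  assumes "hausdorff1 T = 0" "S \<subseteq> T"
  shows "hausdorff1 S = 0"
proof (rule hausdorff1_eq_0I)
  fix e :: real assume "e > 0"
  from hausdorff1_eq_0D[OF assms(1) this] show "\<exists>(U :: nat \<Rightarrow> 'a set) r. S \<subseteq> (\<Union>i. U i) \<and> (\<forall>i. 0 \<le> r i)
    \<and>
    (\<forall>i. \<forall>x\<in>U i. \<forall>y\<in>U i. dist x y \<le> r i) \<and> (\<Sum>i. ennreal (r i)) \<le> ennreal e"
    using assms(2) by (elim exE conjE, intro exI conjI) (assumption | rule order_trans)+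
qed

lemma hausdorff1_eq_0_UN:
  fixes S :: "nat \<Rightarrow> 'a::metric_space set"
  assumes S: "\<And>n. hausdorff1 (S n) = 0"
  shows "hausdorff1 (\<Union>n. S n) = 0"
proof (rule hausdorff1_eq_0I)
  fix e :: real assume e: "e > 0"
  have "\<exists>U r. S n \<subseteq> (\<Union>i. U i) \<and> (\<forall>i. 0 \<le> r i) \<and> (\<forall>i. \<forall>x\<in>U i. \<forall>y\<in>U i. dist x y \<le> r i) \<and>
    (\<Sum>i. ennreal (r i)) \<le> ennreal (e * (1/2) ^ Suc n)" for n
    using e by (intro hausdorff1_eq_0D[OF S[of n]]) simp
  then obtain U r where U: "\<And>n. S n \<subseteq> (\<Union>i. U n i)" "\<And>n i. 0 \<le> (r n i :: real)"
    "\<And>n i x y. x \<in> U n i \<Longrightarrow> y \<in> U n i \<Longrightarrow> dist x y \<le> r n i"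
    "\<And>n. (\<Sum>i. ennreal (r n i)) \<le> ennreal (e * (1/2) ^ Suc n)"
    by metis
  let ?V = "\<lambda>k. case prod_decode k of (n, i) \<Rightarrow> U n i"
      and ?t = "\<lambda>k. case prod_decode k of (n, i) \<Rightarrow> r n i"
  have "(\<Sum>k. ennreal (?t k)) = (\<Sum>k. (case prod_decode k of (n, i) \<Rightarrow> ennreal (r n i)))"
    by (intro suminf_cong) (simp split: prod.split)
  also have "\<dots> = (\<Sum>n. \<Sum>i. ennreal (r n i))"
    by (rule suminf_ennreal_2dimen) simp
  also have "\<dots> \<le> (\<Sum>n. ennreal (e * (1/2) ^ Suc n))"
    by (intro suminf_le U(4)) auto
  also have "\<dots> = ennreal (e * 1)"
    using e by (intro suminf_ennreal_eq sums_mult power_half_series) auto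
  finally have sum: "(\<Sum>k. ennreal (?t k)) \<le> ennreal e" by simp
  have "x \<in> (\<Union>k. ?V k)" if "x \<in> S n" for x n
  proof -
    from that U(1) obtain i where "x \<in> U n i" by blast
    then have "x \<in> ?V (prod_encode (n, i))" by simp
    then show ?thesis by (rule UN_I[OF UNIV_I])
  qed
  then have "(\<Union>n. S n) \<subseteq> (\<Union>k. ?V k)" by (intro UN_least subsetI)
  with U(2,3) sum show "\<exists>V t. (\<Union>n. S n) \<subseteq> (\<Union>i. V i) \<and> (\<forall>i. 0 \<le> t i) \<and>
    (\<forall>i. \<forall>x\<in>V i. \<forall>y\<in>V i. dist x y \<le> t i) \<and> (\<Sum>i. ennreal (t i)) \<le> ennreal e"
    by (intro exI[of _ ?V] exI[of _ ?t] conjI) (simp_all split: prod.split)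
qed

lemma hausdorff1_eq_0_lipschitz_image:
  fixes f :: "'a::metric_space \<Rightarrow> 'b::metric_space"
  assumes S: "hausdorff1 S = 0" and f: "L-lipschitz_on S f"
  shows "hausdorff1 (f ` S) = 0"
proof (rule hausdorff1_eq_0I)
  fix e :: real assume e: "e > 0"
  have L: "L \<ge> 0" using f by (rule lipschitz_on_nonneg)
  \<comment> \<open>Dividing by \<open>L + 1\<close> covers the case \<open>L = 0\<close>.\<close>
  have "e / (L + 1) > 0" using e L by simp
  from hausdorff1_eq_0D[OF S this] obtain U and r :: "nat \<Rightarrow> real"
    where U: "S \<subseteq> (\<Union>i. U i)" "\<And>i. 0 \<le> r i"
    "\<And>i x y. x \<in> U i \<Longrightarrow> y \<in> U i \<Longrightarrow> dist x y \<le> r i" "(\<Sum>i. ennreal (r i)) \<le> ennreal (e / (L + 1))"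
    by blast
  have "(\<Sum>i. ennreal (L * r i)) \<le> (\<Sum>i. ennreal (L + 1) * ennreal (r i))"
  proof (rule suminf_le)
    fix i
    have "ennreal (L * r i) \<le> ennreal ((L + 1) * r i)" using U(2)
      by (intro ennreal_leI mult_right_mono) auto
    also have "\<dots> = ennreal (L + 1) * ennreal (r i)" using L U(2) by (intro ennreal_mult) auto
    finally show "ennreal (L * r i) \<le> ennreal (L + 1) * ennreal (r i)" .
  qed auto
  also have "\<dots> = ennreal (L + 1) * (\<Sum>i. ennreal (r i))" by (rule ennreal_suminf_cmult)
  also have "\<dots> \<le> ennreal (L + 1) * ennreal (e / (L + 1))" by (intro mult_left_mono U) auto
  also have "\<dots> = ennreal e" using L e by (subst ennreal_mult[symmetric]) auto
  finally have "(\<Sum>i. ennreal (L * r i)) \<le> ennreal e" .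
  moreover have "dist (f x) (f y) \<le> L * r i" if "x \<in> U i \<inter> S" "y \<in> U i \<inter> S" for x y i
    using lipschitz_onD[OF f, of x y] mult_left_mono[OF U(3)[of x i y] L] that by auto
  ultimately show "\<exists>V t. f ` S \<subseteq> (\<Union>i. V i) \<and> (\<forall>i. 0 \<le> t i) \<and>
    (\<forall>i. \<forall>x\<in>V i. \<forall>y\<in>V i. dist x y \<le> t i) \<and> (\<Sum>i. ennreal (t i)) \<le> ennreal e"
  proof (intro exI[of _ "\<lambda>i. f ` (U i \<inter> S)"] exI[of _ "\<lambda>i. L * r i"] conjI allI)
    show "f ` S \<subseteq> (\<Union>i. f ` (U i \<inter> S))" using U(1) by blast
    show "0 \<le> L * r i" for i using U(2) L by simp
  qed auto
qed

section \<open>Covering compact sets of reals by intervals\<close>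

lemma emeasure_lebesgue_ennreal_measure:
  assumes "S \<in> lmeasurable"
  shows "ennreal (measure lebesgue S) = emeasure lebesgue S"
  by (rule emeasure_eq_measure2[OF assms, symmetric])

text \<open>An outer approximation of \<open>S\<close> by nonoverlapping intervals. Their interiors
  are disjoint, so both series are measures of disjoint unions: one inside the approximating set,
  the other inside its part outside \<open>S\<close>.\<close>

lemma compact_interval_cover:
  fixes S :: "real set"
  assumes S: "compact S" and e: "e > 0"
  obtains c d :: "nat \<Rightarrow> real"
  where "\<And>n. c n \<le> d n" "S \<subseteq> (\<Union>n. {c n..d n})"
    "(\<Sum>n. ennreal (d n - c n)) \<le> ennreal (measure lebesgue S + e)"
    "(\<Sum>n. ennreal (measure lebesgue ({c n..d n} - S))) \<le> ennreal e"
proof -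
  have Sm: "S \<in> lmeasurable" using S by (rule lmeasurable_compact)
  obtain a where "S \<subseteq> cbox (-a) a" using bounded_subset_cbox_symmetric[OF compact_imp_bounded[OF S]] .
  then obtain \<D> where D: "countable \<D>" "\<And>K. K \<in> \<D> \<Longrightarrow> K \<subseteq> cbox (-a) a \<and> K \<noteq> {} \<and> (\<exists>c d. K = cbox c d)"
      "pairwise (\<lambda>A B. interior A \<inter> interior B = {}) \<D>"
      "S \<subseteq> \<Union>\<D>" "\<Union>\<D> \<in> lmeasurable" "measure lebesgue (\<Union>\<D>) \<le> measure lebesgue S + e"
    by (rule measurable_outer_intervals_bounded[OF Sm _ e]) (rule that)
  define W where "W n = (if n \<in> to_nat_on \<D> ` \<D> then from_nat_into \<D> n else {0})" for n
  have WD: "W n \<in> \<D> \<or> W n = {0}" for n using D(1) by (auto simp: W_def)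
  have "\<exists>c d. c \<le> d \<and> W n = {c..d}" for n
    using WD[of n]
  proof
    assume "W n \<in> \<D>"
    with D(2)[of "W n"] obtain c d where "W n = {c..d}" "W n \<noteq> {}" by (auto simp: cbox_interval)
    then show ?thesis by (intro exI[of _ c] exI[of _ d]) auto
  next
    assume "W n = {0}"
    then show ?thesis by (intro exI[of _ 0]) auto
  qed
  then obtain c d where cd: "\<And>n. c n \<le> d n" "\<And>n. W n = {c n..d n}" by metis
  have intW: "interior (W n) = {c n<..<d n}" for n by (simp add: cd(2))
  have disj: "disjoint_family (\<lambda>n. {c n<..<d n})"
    unfolding disjoint_family_on_def intW[symmetric]
  proof (intro ballI impI)
    fix m n :: nat assume mn: "m \<noteq> n"
    show "interior (W m) \<inter> interior (W n) = {}"
    proof (cases "m \<in> to_nat_on \<D> ` \<D> \<and> n \<in> to_nat_on \<D> ` \<D>")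
      case True
      then obtain A B where AB: "A \<in> \<D>" "B \<in> \<D>" "m = to_nat_on \<D> A" "n = to_nat_on \<D> B" by blast
      then have "W m = A" "W n = B" "A \<noteq> B" using D(1) mn by (auto simp: W_def)
      then show ?thesis using D(3) AB by (auto simp: pairwise_def)
    qed (auto simp: W_def)
  qed
  have cov: "\<Union>\<D> \<subseteq> (\<Union>n. W n)"
  proof
    fix x assume "x \<in> \<Union>\<D>"
    then obtain A where A: "A \<in> \<D>" "x \<in> A" by blast
    then have "W (to_nat_on \<D> A) = A" using D(1) by (auto simp: W_def)
    with A show "x \<in> (\<Union>n. W n)" by blast
  qed
  have sub: "{c n<..<d n} \<subseteq> \<Union>\<D>" for n
    using WD[of n] by (auto simp: intW[symmetric] dest: interior_subset[THEN subsetD])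
  have S': "S \<in> sets lebesgue" "\<Union>\<D> \<in> sets lebesgue" using Sm D(5) by (auto simp: fmeasurableD)
  show ?thesis
  proof (rule that[of c d])
    show "c n \<le> d n" for n by (rule cd)
    show "S \<subseteq> (\<Union>n. {c n..d n})" using D(4) cov by (auto simp: cd(2))
    have "(\<Sum>n. ennreal (d n - c n)) = (\<Sum>n. emeasure lebesgue {c n<..<d n})"
      using cd(1) by simp
    also have "\<dots> = emeasure lebesgue (\<Union>n. {c n<..<d n})"
      using disj by (intro suminf_emeasure) auto
    also have "\<dots> \<le> emeasure lebesgue (\<Union>\<D>)"
      using sub S' by (intro emeasure_mono) auto
    also have "\<dots> \<le> ennreal (measure lebesgue S + e)"
      using D(6) by (simp add: emeasure_lebesgue_ennreal_measure[OF D(5), symmetric] ennreal_leI)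
    finally show "(\<Sum>n. ennreal (d n - c n)) \<le> ennreal (measure lebesgue S + e)" .
    have "ennreal (measure lebesgue ({c n..d n} - S)) = emeasure lebesgue ({c n<..<d n} - S)" for n
    proof -
      have "{c n..d n} - S \<in> lmeasurable" using S' by (intro fmeasurable_Diff) auto
      then have "ennreal (measure lebesgue ({c n..d n} - S)) = emeasure lebesgue ({c n..d n} - S)"
        by (rule emeasure_lebesgue_ennreal_measure)
      also have "\<dots> = emeasure lebesgue ({c n<..<d n} - S)"
      proof (rule emeasure_eq_AE)
        have "AE x in lebesgue. x \<noteq> c n \<and> x \<noteq> d n"
          by (intro AE_conjI AE_completion AE_lborel_singleton)
        then show "AE x in lebesgue. (x \<in> {c n..d n} - S) = (x \<in> {c n<..<d n} - S)"
          by eventually_elim auto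
      qed (use S' in auto)
      finally show ?thesis .
    qed
    then have "(\<Sum>n. ennreal (measure lebesgue ({c n..d n} - S)))
      = (\<Sum>n. emeasure lebesgue ({c n<..<d n} - S))"
      by simp
    also have "\<dots> = emeasure lebesgue (\<Union>n. {c n<..<d n} - S)"
    proof (rule suminf_emeasure)
      show "disjoint_family (\<lambda>n. {c n<..<d n} - S)" using disj unfolding disjoint_family_on_def
        by blast
    qed (use S' in auto)
    also have "\<dots> \<le> emeasure lebesgue (\<Union>\<D> - S)"
      using sub S' by (intro emeasure_mono) auto
    also have "\<dots> = ennreal (measure lebesgue (\<Union>\<D> - S))"
      using D(5) S' by (intro emeasure_lebesgue_ennreal_measure[symmetric] fmeasurable_Diff)
    also have "measure lebesgue (\<Union>\<D> - S) = measure lebesgue (\<Union>\<D>) - measure lebesgue S"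
      using D(4,5) S' by (intro measurable_measure_Diff)
    also have "ennreal \<dots> \<le> ennreal e" using D(6) by (intro ennreal_leI) simp
    finally show "(\<Sum>n. ennreal (measure lebesgue ({c n..d n} - S))) \<le> ennreal e" .
  qed
qed

text \<open>Cover \<open>closure A\<close> by intervals whose parts outside it have small total
  measure; the image of \<open>A\<close> in each interval has diameter at most \<open>C\<close>
  times that part. The lemma serves in contraposition: a positive image contains two points farther
  apart than the gaps allow.\<close>

lemma hausdorff1_image_eq_0_if_dist_le_gaps:
  fixes \<sigma> :: "real \<Rightarrow> 'a::metric_space"
  assumes A: "bounded A" and C: "C \<ge> 0"
    and le: "\<And>p q. p \<in> A \<Longrightarrow> q \<in> A \<Longrightarrow> p < q \<Longrightarrow> dist (\<sigma> p) (\<sigma> q) \<le> C * measure lebesgue ({p..q} - closure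
        A)"
  shows "hausdorff1 (\<sigma> ` A) = 0"
proof (rule hausdorff1_eq_0I)
  fix e :: real assume e: "e > 0"
  have cA: "compact (closure A)" using A by simp
  have e': "e / (C + 1) > 0" using e C by simp
  obtain c d :: "nat \<Rightarrow> real" where cd: "closure A \<subseteq> (\<Union>n. {c n..d n})"
    "(\<Sum>n. ennreal (measure lebesgue ({c n..d n} - closure A))) \<le> ennreal (e / (C + 1))"
    by (rule compact_interval_cover[OF cA e']) (rule that)
  have le': "dist (\<sigma> p) (\<sigma> q) \<le> C * measure lebesgue ({c n..d n} - closure A)"
    if "p \<in> A \<inter> {c n..d n}" "q \<in> A \<inter> {c n..d n}" "p < q" for p q n
  proof -
    have "dist (\<sigma> p) (\<sigma> q) \<le> C * measure lebesgue ({p..q} - closure A)" using that by (intro le) auto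
    also have "\<dots> \<le> C * measure lebesgue ({c n..d n} - closure A)"
      using that C by (intro mult_left_mono measure_mono_fmeasurable fmeasurable_Diff sets.Diff) auto
    finally show ?thesis .
  qed
  have "dist (\<sigma> p) (\<sigma> q) \<le> C * measure lebesgue ({c n..d n} - closure A)"
    if "p \<in> A \<inter> {c n..d n}" "q \<in> A \<inter> {c n..d n}" for p q n
    using le'[of p n q] le'[of q n p] that C
        by (cases p q rule: linorder_cases) (auto simp: dist_commute)
  note le'' = this
  show "\<exists>U r. \<sigma> ` A \<subseteq> (\<Union>i. U i) \<and> (\<forall>i. 0 \<le> r i) \<and>
    (\<forall>i. \<forall>x\<in>U i. \<forall>y\<in>U i. dist x y \<le> r i) \<and> (\<Sum>i. ennreal (r i)) \<le> ennreal e"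
  proof (intro exI[of _ "\<lambda>n. \<sigma> ` (A \<inter> {c n..d n})"]
      exI[of _ "\<lambda>n. C * measure lebesgue ({c n..d n} - closure A)"] conjI allI ballI)
    show "\<sigma> ` A \<subseteq> (\<Union>n. \<sigma> ` (A \<inter> {c n..d n}))" using cd(1) closure_subset[of A] by blast
    have "(\<Sum>n. ennreal (C * measure lebesgue ({c n..d n} - closure A)))
      = ennreal C * (\<Sum>n. ennreal (measure lebesgue ({c n..d n} - closure A)))"
      using C by (subst ennreal_suminf_cmult[symmetric]) (simp add: ennreal_mult)
    also have "\<dots> \<le> ennreal C * ennreal (e / (C + 1))" by (intro mult_left_mono cd(2)) simp
    also have "\<dots> = ennreal (C * (e / (C + 1)))" using C e by (intro ennreal_mult[symmetric]) auto
    also have "\<dots> \<le> ennreal e" using C e by (intro ennreal_leI) (simp add: field_simps)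
    finally show "(\<Sum>n. ennreal (C * measure lebesgue ({c n..d n} - closure A))) \<le> ennreal e" .
  qed (use le'' C in auto)
qed

section \<open>Lipschitz extensions and expanding subsets\<close>

lemma mcshane_extension:
  fixes u :: "'a::metric_space \<Rightarrow> real"
  assumes u: "L-lipschitz_on A u"
  shows "\<exists>U. L-lipschitz_on UNIV U \<and> (\<forall>x\<in>A. U x = u x)"
proof (cases "A = {}")
  case True
  then show ?thesis using lipschitz_on_nonneg[OF u]
    by (intro exI[of _ "\<lambda>_. 0"]) (auto intro: lipschitz_onI)
next
  case False
  have L: "L \<ge> 0" using u by (rule lipschitz_on_nonneg)
  have u': "\<bar>u x - u y\<bar> \<le> L * dist x y" if "x \<in> A" "y \<in> A" for x y
    using lipschitz_onD[OF u that] by (simp add: dist_real_def)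
  define U where "U x = (INF a\<in>A. u a + L * dist x a)" for x
  have bdd: "bdd_below ((\<lambda>a. u a + L * dist x a) ` A)" for x
  proof -
    obtain a0 where a0: "a0 \<in> A" using False by blast
    have "u a0 - L * dist x a0 \<le> u a + L * dist x a" if "a \<in> A" for a
      using u'[OF a0 that] mult_left_mono[OF dist_triangle[of a0 a x] L]
      by (simp add: dist_commute algebra_simps)
    then show ?thesis by (intro bdd_belowI2)
  qed
  have le: "U x \<le> U y + L * dist x y" for x y
  proof -
    have "U x - L * dist x y \<le> U y"
      unfolding U_def[of y]
    proof (rule cINF_greatest[OF False])
      fix a assume a: "a \<in> A"
      have "U x \<le> u a + L * dist x a" unfolding U_def by (rule cINF_lower[OF bdd a])
      also have "\<dots> \<le> u a + L * (dist x y + dist y a)" using L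
        by (intro add_left_mono mult_left_mono dist_triangle)
      finally show "U x - L * dist x y \<le> u a + L * dist y a" by (simp add: algebra_simps)
    qed
    then show ?thesis by simp
  qed
  have "L-lipschitz_on UNIV U"
  proof (rule lipschitz_onI[OF _ L])
    fix x y show "dist (U x) (U y) \<le> L * dist x y"
      using le[of x y] le[of y x] by (simp add: dist_real_def dist_commute abs_le_iff)
  qed
  moreover have "U x = u x" if x: "x \<in> A" for x
  proof (rule antisym)
    show "U x \<le> u x" unfolding U_def using cINF_lower[OF bdd x, of x] by simp
    show "u x \<le> U x" unfolding U_def
    proof (rule cINF_greatest[OF False])
      fix a assume "a \<in> A"
      with u'[OF x this] show "u x \<le> u a + L * dist x a" by linarith
    qed
  qed
  ultimately show ?thesis by blast
qed

text \<open>The image of an interval lies between the attained extrema of \<open>f\<close>, hence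
  within a length of \<open>L\<close> times that of the interval; sum this over an almost optimal
  cover of \<open>A\<close>.\<close>

lemma measure_lipschitz_image_le:
  fixes f :: "real \<Rightarrow> real"
  assumes f: "L-lipschitz_on UNIV f" and A: "compact A"
  shows "measure lebesgue (f ` A) \<le> L * measure lebesgue A"
proof -
  have L: "L \<ge> 0" using f by (rule lipschitz_on_nonneg)
  have cont: "continuous_on X f" for X
    using lipschitz_on_continuous_on[OF f] continuous_on_subset by blast
  have fA: "f ` A \<in> lmeasurable" using A by (intro lmeasurable_compact compact_continuous_image cont)
  have le: "measure lebesgue (f ` A) \<le> L * measure lebesgue A + L * e" if e: "e > 0" for e
  proof -
    obtain c d :: "nat \<Rightarrow> real" where cd: "\<And>n. c n \<le> d n" "A \<subseteq> (\<Union>n. {c n..d n})"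
      "(\<Sum>n. ennreal (d n - c n)) \<le> ennreal (measure lebesgue A + e)"
      by (rule compact_interval_cover[OF A e]) (rule that)
    have im: "f ` {c n..d n} \<in> sets lebesgue" for n
      by (intro fmeasurableD lmeasurable_compact compact_continuous_image cont) auto
    have len: "emeasure lebesgue (f ` {c n..d n}) \<le> ennreal (L * (d n - c n))" for n
    proof -
      have ne: "{c n..d n} \<noteq> {}" using cd(1) by auto
      obtain x where x: "x \<in> {c n..d n}" "\<And>t. t \<in> {c n..d n} \<Longrightarrow> f x \<le> f t"
        using continuous_attains_inf[OF _ ne cont] by auto
      obtain y where y: "y \<in> {c n..d n}" "\<And>t. t \<in> {c n..d n} \<Longrightarrow> f t \<le> f y"
        using continuous_attains_sup[OF _ ne cont] by auto
      have "f ` {c n..d n} \<subseteq> {f x..f y}" using x y by auto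
      then have "emeasure lebesgue (f ` {c n..d n}) \<le> emeasure lebesgue {f x..f y}"
        by (intro emeasure_mono) auto
      also have "\<dots> = ennreal (f y - f x)" using x(2)[OF y(1)] by simp
      also have "f y - f x \<le> L * (d n - c n)"
      proof -
        have "f y - f x \<le> L * dist y x"
          using lipschitz_onD[OF f, of y x] by (simp add: dist_real_def)
        also have "\<dots> \<le> L * (d n - c n)"
          using x(1) y(1) L by (intro mult_left_mono) (auto simp: dist_real_def abs_if)
        finally show ?thesis .
      qed
      then have "ennreal (f y - f x) \<le> ennreal (L * (d n - c n))" by (rule ennreal_leI)
      finally show ?thesis .
    qed
    have "emeasure lebesgue (f ` A) \<le> emeasure lebesgue (\<Union>n. f ` {c n..d n})"
    proof (rule emeasure_mono)
      show "f ` A \<subseteq> (\<Union>n. f ` {c n..d n})" using cd(2) by blast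
    qed (use im in auto)
    also have "\<dots> \<le> (\<Sum>n. emeasure lebesgue (f ` {c n..d n}))"
      using im by (intro emeasure_subadditive_countably) auto
    also have "\<dots> \<le> (\<Sum>n. ennreal L * ennreal (d n - c n))"
      using len L cd(1) by (intro suminf_le) (auto simp flip: ennreal_mult)
    also have "\<dots> = ennreal L * (\<Sum>n. ennreal (d n - c n))" by (rule ennreal_suminf_cmult)
    also have "\<dots> \<le> ennreal L * ennreal (measure lebesgue A + e)" by (intro mult_left_mono cd) auto
    also have "\<dots> = ennreal (L * (measure lebesgue A + e))" using L e
      by (intro ennreal_mult[symmetric]) auto
    finally have "ennreal (measure lebesgue (f ` A)) \<le> ennreal (L * (measure lebesgue A + e))"
      by (simp only: emeasure_lebesgue_ennreal_measure[OF fA])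
    then have "measure lebesgue (f ` A) \<le> L * (measure lebesgue A + e)"
      using L e by (subst (asm) ennreal_le_iff) auto
    then show ?thesis by (simp add: algebra_simps)
  qed
  show ?thesis
  proof (rule field_le_epsilon)
    fix e :: real assume e: "e > 0"
    have "L * (e / (L + 1)) \<le> e" using L e by (simp add: field_simps)
    moreover have "measure lebesgue (f ` A) \<le> L * measure lebesgue A + L * (e / (L + 1))"
      using L e by (intro le) auto
    ultimately show "measure lebesgue (f ` A) \<le> L * measure lebesgue A + e" by linarith
  qed
qed

text \<open>A rising sun argument. \<open>A\<close> consists of the points from which
  \<open>v t = u t - c * t\<close> never falls lower up to \<open>q\<close>; on it \<open>v\<close>
  is nondecreasing, so \<open>u\<close> grows at rate at least \<open>c\<close>. All values between
  \<open>v p\<close> and \<open>v q\<close> are taken on \<open>A\<close>, which makes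
  \<open>A\<close> too large to fit into the gaps of \<open>S\<close>.\<close>

lemma lipschitz_expanding_subset:
  fixes u :: "real \<Rightarrow> real"
  assumes u: "1-lipschitz_on UNIV u" and S: "closed S" and pq: "p < q"
    and gap: "measure lebesgue ({p..q} - S) < u q - u p"
  obtains c E where "c > 0" "E \<subseteq> S" "compact E" "measure lebesgue E > 0"
    "\<And>s t. s \<in> E \<Longrightarrow> t \<in> E \<Longrightarrow> s \<le> t \<Longrightarrow> c * (t - s) \<le> u t - u s"
proof -
  define m where "m = measure lebesgue ({p..q} - S)"
  \<comment> \<open>Half of the critical rate at which \<open>(1 + c) * m\<close> reaches
    \<open>u q - u p - c * (q - p)\<close>; below that rate \<open>A\<close> has measure greater
    than \<open>m\<close>.\<close>
  define c where "c = (u q - u p - m) / (2 * (q - p + m))"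
  have m: "0 \<le> m" "m < u q - u p" using gap by (auto simp: m_def)
  have c: "c > 0" using m pq by (simp add: c_def)
  have "c * (q - p + m) = (u q - u p - m) / 2" using m pq by (simp add: c_def field_simps)
  then have cl: "c * (q - p + m) < u q - u p - m" using m by simp
  define v where "v t = u t - c * t" for t
  have v: "(1 + c)-lipschitz_on UNIV v"
  proof (rule lipschitz_onI)
    fix s t :: real
    have "\<bar>v s - v t\<bar> = \<bar>(u s - u t) - c * (s - t)\<bar>" by (simp add: v_def algebra_simps)
    also have "\<dots> \<le> \<bar>u s - u t\<bar> + \<bar>c * (s - t)\<bar>" by (rule abs_triangle_ineq4)
    also have "\<dots> \<le> \<bar>s - t\<bar> + c * \<bar>s - t\<bar>"
      using lipschitz_onD[OF u, of s t] c by (simp add: dist_real_def abs_mult)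
    finally show "dist (v s) (v t) \<le> (1 + c) * dist s t" by (simp add: dist_real_def algebra_simps)
  qed (use c in simp)
  have cont: "continuous_on X v" for X
    using lipschitz_on_continuous_on[OF v] continuous_on_subset by blast
  define A where "A = {s \<in> {p..q}. \<forall>t\<in>{s..q}. v s \<le> v t}"
  have "closed A"
  proof -
    have "x \<in> A" if X: "\<And>n. X n \<in> A" and l: "X \<longlonglongrightarrow> x" for X x
    proof -
      have "x \<in> {p..q}"
        by (rule closed_sequentially[of _ X]) (use X l in \<open>auto simp: A_def\<close>)
      moreover have "v x \<le> v t" if t: "t \<in> {x..q}" for t
      proof (cases "t = x")
        case False
        then have "x < t" using t by simp
        then have "\<forall>\<^sub>F n in sequentially. X n < t" using l by (rule order_tendstoD(2)[rotated])
        then have ev: "\<forall>\<^sub>F n in sequentially. v (X n) \<le> v t"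
          by eventually_elim (use X t in \<open>auto simp: A_def\<close>)
        have "(\<lambda>n. v (X n)) \<longlonglongrightarrow> v x"
          by (rule continuous_on_tendsto_compose[OF cont[of UNIV] l]) auto
        then show ?thesis using ev by (rule tendsto_upperbound) simp
      qed simp
      ultimately show ?thesis by (simp add: A_def)
    qed
    then show ?thesis unfolding closed_sequential_limits by blast
  qed
  then have A: "compact A"
    unfolding compact_eq_bounded_closed by (auto simp: A_def intro: bounded_subset[of "{p..q}"])
  have im: "{v p..v q} \<subseteq> v ` A"
  proof
    fix y assume y: "y \<in> {v p..v q}"
    \<comment> \<open>The last point of \<open>X\<close> is the required preimage: \<open>v\<close>
      equals \<open>y\<close> there and exceeds \<open>y\<close> afterwards.\<close>
    define X where "X = {s \<in> {p..q}. v s \<le> y}"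
    have "closed X" unfolding X_def
      by (intro continuous_on_closed_Collect_le cont continuous_intros)
    then have X: "compact X" unfolding compact_eq_bounded_closed
      by (auto simp: X_def intro: bounded_subset[of "{p..q}"])
    have "p \<in> X" using y pq by (auto simp: X_def)
    then obtain s where s: "s \<in> X" "\<And>t. t \<in> X \<Longrightarrow> t \<le> s"
      using compact_attains_sup[OF X] by blast
    obtain t where t: "s \<le> t" "t \<le> q" "v t = y"
      using IVT'[of v s y q] cont s(1) y by (auto simp: X_def)
    then have "t \<in> X" using s(1) by (auto simp: X_def)
    with s(2) t have vs: "v s = y" by force
    have "s \<in> A"
      unfolding A_def
    proof (intro CollectI conjI ballI)
      show "s \<in> {p..q}" using s(1) by (simp add: X_def)
      fix t assume t: "t \<in> {s..q}"
      show "v s \<le> v t"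
      proof (rule ccontr)
        assume n: "\<not> v s \<le> v t"
        then have "t \<in> X" using t vs s(1) by (auto simp: X_def)
        with s(2)[of t] t have "t = s" by auto
        with n show False by simp
      qed
    qed
    with vs show "y \<in> v ` A" by blast
  qed
  have "v q - v p \<le> measure lebesgue {v p..v q}" by (cases "v p \<le> v q") auto
  also have "\<dots> \<le> measure lebesgue (v ` A)"
    using A im by (intro measure_mono_fmeasurable lmeasurable_compact compact_continuous_image cont)
        auto
  also have "\<dots> \<le> (1 + c) * measure lebesgue A" by (rule measure_lipschitz_image_le[OF v A])
  finally have "u q - u p - c * (q - p) \<le> (1 + c) * measure lebesgue A"
    by (simp add: v_def algebra_simps)
  moreover have "(1 + c) * m < u q - u p - c * (q - p)" using cl by (simp add: algebra_simps)
  ultimately have mA: "m < measure lebesgue A" using c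
    by (metis add_pos_pos less_le_trans mult_less_cancel_left_pos zero_less_one)
  define E where "E = A \<inter> S"
  have E: "compact E" unfolding E_def using A S by (rule compact_Int_closed)
  have Am: "A \<in> lmeasurable" "E \<in> lmeasurable" using A E by (auto intro: lmeasurable_compact)
  have "measure lebesgue A \<le> measure lebesgue (E \<union> ({p..q} - S))"
  proof (rule measure_mono_fmeasurable)
    show "A \<subseteq> E \<union> ({p..q} - S)" by (auto simp: E_def A_def)
    show "E \<union> ({p..q} - S) \<in> lmeasurable"
      using Am S by (intro fmeasurable.Un fmeasurable_Diff) auto
  qed (use Am in \<open>simp add: fmeasurableD\<close>)
  also have "\<dots> \<le> measure lebesgue E + m"
    unfolding m_def using Am(2) S by (intro measure_Un_le sets.Diff) (auto simp: fmeasurableD)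
  finally have "measure lebesgue E > 0" using mA by simp
  moreover have "c * (t - s) \<le> u t - u s" if "s \<in> E" "t \<in> E" "s \<le> t" for s t
  proof -
    have "v s \<le> v t" using that by (auto simp: E_def A_def)
    then show ?thesis by (simp add: v_def algebra_simps)
  qed
  ultimately show ?thesis using that[OF c _ E] by (auto simp: E_def)
qed


section \<open>Curves carried by a compact set of reals\<close>

definition gaps :: "real set \<Rightarrow> real \<Rightarrow> real \<Rightarrow> (real \<times> real) set" where
  "gaps E s t = {(\<alpha>, \<beta>). \<alpha> \<in> E \<and> \<beta> \<in> E \<and> s \<le> \<alpha> \<and> \<alpha> < \<beta> \<and> \<beta> \<le> t \<and> {\<alpha><..<\<beta>} \<inter> E = {}}"

definition jump :: "(real \<Rightarrow> 'y::real_normed_vector) \<Rightarrow> real \<times> real \<Rightarrow> 'y" where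
  "jump D g = D (snd g) - D (fst g)"

lemma gaps_ordered:
  assumes "g \<in> gaps E s t" "g' \<in> gaps E s' t'" "g \<noteq> g'"
  shows "snd g \<le> fst g' \<or> snd g' \<le> fst g"
proof (rule ccontr)
  assume "\<not> ?thesis"
  then have lt: "fst g' < snd g" "fst g < snd g'" by auto
  have "fst g = fst g'"
    using assms(1,2) lt unfolding gaps_def by (cases "fst g" "fst g'" rule: linorder_cases) fastforce+
  moreover have "snd g = snd g'"
    using assms(1,2) lt unfolding gaps_def by (cases "snd g" "snd g'" rule: linorder_cases) fastforce+
  ultimately show False using assms(3) by (simp add: prod_eq_iff)
qed

text \<open>Induction on the number of gaps: one gap cuts \<open>[s, t]\<close> and the remaining
  gaps into a left and a right part, its jump drops out of the left-hand side and its length out of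
  the right.\<close>

lemma gaps_finite_bound:
  assumes D: "L-lipschitz_on E D" and F: "finite F" "F \<subseteq> gaps E s t" and st: "s \<in> E" "t \<in> E" "s \<le> t"
  shows "norm (D t - D s - sum (jump D) F) \<le> L * (t - s - (\<Sum>g\<in>F. snd g - fst g))"
  using F st
proof (induction "card F" arbitrary: F s t rule: less_induct)
  case less
  show ?case
  proof (cases "F = {}")
    case True
    then show ?thesis using lipschitz_onD[OF D less.prems(4,3)] less.prems
      by (simp add: dist_norm abs_if)
  next
    case False
    then obtain g where g: "g \<in> F" by blast
    define F1 where "F1 = {x \<in> F. snd x \<le> fst g}"
    define F2 where "F2 = {x \<in> F. snd g \<le> fst x}"
    have gg: "g \<in> gaps E s t" using g less.prems by blast
    then have gE: "fst g \<in> E" "snd g \<in> E" "s \<le> fst g" "fst g < snd g" "snd g \<le> t"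
      by (auto simp: gaps_def)
    have lt: "fst x < snd x" if "x \<in> F" for x using that less.prems by (auto simp: gaps_def)
    have "F = insert g (F1 \<union> F2)"
      using gaps_ordered[OF gg] less.prems(2) g unfolding F1_def F2_def by blast
    moreover have "g \<notin> F1 \<union> F2" "F1 \<inter> F2 = {}"
      using lt gE(4) by (auto simp: F1_def F2_def not_le) (meson less_le_trans less_trans not_less)
    moreover have fin: "finite F1" "finite F2" using less.prems by (auto simp: F1_def F2_def)
    ultimately have sums: "sum h F = h g + sum h F1 + sum h F2"
      for h :: "real \<times> real \<Rightarrow> 'z::comm_monoid_add"
      by (simp add: sum.union_disjoint add.assoc)
    have "F1 \<subseteq> F" "F2 \<subseteq> F" "g \<notin> F1" "g \<notin> F2" using lt[OF g] by (auto simp: F1_def F2_def)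
    then have "F1 \<subset> F" "F2 \<subset> F" using g by blast+
    then have c: "card F1 < card F" "card F2 < card F" using less.prems
      by (auto intro: psubset_card_mono)
    have "F1 \<subseteq> gaps E s (fst g)" "F2 \<subseteq> gaps E (snd g) t"
      using less.prems by (auto simp: F1_def F2_def gaps_def)
    then have IH: "norm (D (fst g) - D s - sum (jump D) F1) \<le> L * (fst g - s - (\<Sum>g\<in>F1. snd g - fst
      g))"
      "norm (D t - D (snd g) - sum (jump D) F2) \<le> L * (t - snd g - (\<Sum>g\<in>F2. snd g - fst g))"
      using c fin gE less.prems by (auto intro!: less.hyps)
    have "D t - D s - sum (jump D) F
      = (D (fst g) - D s - sum (jump D) F1) + (D t - D (snd g) - sum (jump D) F2)"
      by (simp add: sums jump_def)
    then have "norm (D t - D s - sum (jump D) F)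
      \<le> norm (D (fst g) - D s - sum (jump D) F1) + norm (D t - D (snd g) - sum (jump D) F2)"
      by (metis norm_triangle_ineq)
    also have "\<dots> \<le> L * (fst g - s - (\<Sum>g\<in>F1. snd g - fst g)) + L * (t - snd g - (\<Sum>g\<in>F2. snd g - fst
      g))"
      by (intro add_mono IH)
    also have "\<dots> = L * (t - s - (\<Sum>g\<in>F. snd g - fst g))"
      by (simp add: sums algebra_simps)
    finally show ?thesis .
  qed
qed

text \<open>The increment of \<open>D\<close> over \<open>[s, t]\<close> carried by \<open>E\<close> itself: the jumps of \<open>D\<close> across the
  gaps of \<open>E\<close> are removed.\<close>

definition gapless :: "real set \<Rightarrow> (real \<Rightarrow> 'y::banach) \<Rightarrow> real \<Rightarrow> real \<Rightarrow> 'y" where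
  "gapless E D s t = D t - D s - infsum (jump D) (gaps E s t)"

text \<open>For compact \<open>E\<close> and \<open>s \<le> t\<close> in \<open>E\<close> this is
  the Lebesgue measure of \<open>E \<inter> {s..t}\<close>.\<close>

abbreviation gapless_length :: "real set \<Rightarrow> real \<Rightarrow> real \<Rightarrow> real" where
  "gapless_length E \<equiv> gapless E (\<lambda>x. x)"

lemma lipschitz_on_ident: "1-lipschitz_on (E :: real set) (\<lambda>x. x)"
  by (auto intro: lipschitz_onI)

lemma gap_length_sum_le:
  assumes "finite F" "F \<subseteq> gaps E s t" "s \<in> E" "t \<in> E" "s \<le> t"
  shows "sum (jump (\<lambda>x. x)) F \<le> t - s"
proof -
  have "0 \<le> norm (t - s - sum (jump (\<lambda>x. x)) F)" by simp
  also have "\<dots> \<le> 1 * (t - s - sum (jump (\<lambda>x. x)) F)"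
    using gaps_finite_bound[OF lipschitz_on_ident assms] by (simp add: jump_def)
  finally show ?thesis by simp
qed

lemma gap_lengths_summable:
  assumes "s \<in> E" "t \<in> E" "s \<le> t"
  shows "jump (\<lambda>x. x :: real) summable_on gaps E s t"
proof (rule nonneg_bdd_above_summable_on)
  show "bdd_above (sum (jump (\<lambda>x. x)) ` {F. F \<subseteq> gaps E s t \<and> finite F})"
    using gap_length_sum_le[OF _ _ assms] by (intro bdd_aboveI2[of _ _ "t - s"]) auto
qed (auto simp: jump_def gaps_def)

lemma jumps_summable:
  fixes D :: "real \<Rightarrow> 'y::banach"
  assumes D: "L-lipschitz_on E D" and st: "s \<in> E" "t \<in> E" "s \<le> t"
  shows "jump D summable_on gaps E s t"
proof -
  have "(\<lambda>g. norm (jump D g)) summable_on gaps E s t"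
  proof (rule summable_on_comparison_test)
    show "(\<lambda>g. L * jump (\<lambda>x. x) g) summable_on gaps E s t"
      by (intro summable_on_cmult_right gap_lengths_summable st)
    fix g assume "g \<in> gaps E s t"
    then show "norm (jump D g) \<le> L * jump (\<lambda>x. x) g"
      using lipschitz_onD[OF D, of "snd g" "fst g"] by (auto simp: gaps_def jump_def dist_norm abs_if)
  qed auto
  then show ?thesis by (rule abs_summable_summable)
qed

text \<open>The bound \<open>gaps_finite_bound\<close> survives the limit over the finite sets of
  gaps. It becomes the Lipschitz estimate of the reparametrized curve.\<close>

lemma norm_gapless_le:
  fixes D :: "real \<Rightarrow> 'y::banach"
  assumes D: "L-lipschitz_on E D" and st: "s \<in> E" "t \<in> E" "s \<le> t"
  shows "norm (gapless E D s t) \<le> L * gapless_length E s t"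
proof (rule tendsto_le)
  let ?A = "finite_subsets_at_top (gaps E s t)"
  show "((\<lambda>F. norm (D t - D s - sum (jump D) F)) \<longlongrightarrow> norm (gapless E D s t)) ?A"
    unfolding gapless_def
    using has_sum_infsum[OF jumps_summable[OF D st]] unfolding has_sum_def by (intro tendsto_intros)
  show "((\<lambda>F. L * (t - s - sum (jump (\<lambda>x. x)) F)) \<longlongrightarrow> L * gapless_length E s t) ?A"
    unfolding gapless_def
    using has_sum_infsum[OF gap_lengths_summable[OF st]] unfolding has_sum_def
        by (intro tendsto_intros)
  show "\<forall>\<^sub>F F in ?A. norm (D t - D s - sum (jump D) F) \<le> L * (t - s - sum (jump (\<lambda>x. x)) F)"
    using gaps_finite_bound[OF D _ _ st]
        by (intro eventually_finite_subsets_at_top_weakI) (auto simp: jump_def)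
qed simp

lemma gapless_length_nonneg:
  assumes "s \<in> E" "t \<in> E" "s \<le> t"
  shows "0 \<le> gapless_length E s t"
  using norm_gapless_le[OF lipschitz_on_ident assms] norm_ge_zero[of "gapless_length E s t"]
      by linarith

lemma gapless_length_le:
  assumes "finite F" "F \<subseteq> gaps E s t" "s \<in> E" "t \<in> E" "s \<le> t"
  shows "gapless_length E s t \<le> t - s - sum (jump (\<lambda>x. x)) F"
proof -
  have "sum (jump (\<lambda>x. x)) F \<le> infsum (jump (\<lambda>x. x)) (gaps E s t)"
    using assms by (intro finite_sum_le_infsum gap_lengths_summable) (auto simp: jump_def gaps_def)
  then show ?thesis by (simp add: gapless_def)
qed

lemma gapless_add:
  fixes D :: "real \<Rightarrow> 'y::banach"
  assumes D: "L-lipschitz_on E D" and E: "s \<in> E" "t \<in> E" "r \<in> E" and le: "s \<le> t" "t \<le> r"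
  shows "gapless E D s t + gapless E D t r = gapless E D s r"
proof -
  have "gaps E s r = gaps E s t \<union> gaps E t r"
  proof (rule set_eqI)
    fix g
    \<comment> \<open>No gap straddles \<open>t\<close>, since \<open>t\<close> lies in
      \<open>E\<close>.\<close>
    have "g \<in> gaps E s r \<Longrightarrow> \<not> (fst g < t \<and> t < snd g)" using E(2) by (auto simp: gaps_def)
    then show "g \<in> gaps E s r \<longleftrightarrow> g \<in> gaps E s t \<union> gaps E t r"
      using le by (auto simp: gaps_def not_less)
  qed
  moreover have "gaps E s t \<inter> gaps E t r = {}" by (auto simp: gaps_def)
  ultimately have "infsum (jump D) (gaps E s r) = infsum (jump D) (gaps E s t) + infsum (jump D) (gaps
    E t r)"
    using jumps_summable[OF D E(1,2) le(1)] jumps_summable[OF D E(2,3) le(2)]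
    by (simp add: infsum_Un_disjoint)
  then show ?thesis by (simp add: gapless_def)
qed

text \<open>Finitely many gaps are disjoint open intervals inside \<open>{s..t} - E\<close>, so
  their lengths sum to at most the measure of that set. The estimate makes the total length
  \<open>l\<close> of the curve's parameter positive.\<close>

lemma measure_le_gapless_length:
  assumes E: "compact E" "s \<in> E" "t \<in> E" "E \<subseteq> {s..t}"
  shows "measure lebesgue E \<le> gapless_length E s t"
proof -
  have st: "s \<le> t" using E(2,4) by auto
  have Em: "E \<in> lmeasurable" using E(1) by (rule lmeasurable_compact)
  have "infsum (jump (\<lambda>x. x)) (gaps E s t) \<le> t - s - measure lebesgue E"
  proof (rule infsum_le_finite_sums[OF gap_lengths_summable[OF E(2,3) st]])
    fix F assume F: "finite F" "F \<subseteq> gaps E s t"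
    have "sum (jump (\<lambda>x. x)) F = (\<Sum>g\<in>F. measure lebesgue {fst g<..<snd g})"
      using F by (intro sum.cong) (auto simp: jump_def gaps_def)
    also have "\<dots> = measure lebesgue (\<Union>g\<in>F. {fst g<..<snd g})"
    proof (rule measure_finite_Union[symmetric])
      show "disjoint_family_on (\<lambda>g. {fst g<..<snd g}) F"
        unfolding disjoint_family_on_def
      proof (intro ballI impI)
        fix g g' assume "g \<in> F" "g' \<in> F" "g \<noteq> g'"
        then have "snd g \<le> fst g' \<or> snd g' \<le> fst g" using F gaps_ordered by blast
        then show "{fst g<..<snd g} \<inter> {fst g'<..<snd g'} = {}" by auto
      qed
    qed (use F in \<open>auto simp: gaps_def\<close>)
    also have "\<dots> \<le> measure lebesgue ({s..t} - E)"
    proof (rule measure_mono_fmeasurable)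
      show "(\<Union>g\<in>F. {fst g<..<snd g}) \<subseteq> {s..t} - E" using F by (fastforce simp: gaps_def)
    qed (use F Em in \<open>auto intro!: sets.finite_UN fmeasurable_Diff simp: fmeasurableD\<close>)
    also have "\<dots> = t - s - measure lebesgue E"
      using Em E(4) st by (subst measurable_measure_Diff) (auto simp: fmeasurableD)
    finally show "sum (jump (\<lambda>x. x)) F \<le> t - s - measure lebesgue E" .
  qed
  then show ?thesis by (simp add: gapless_def)
qed

text \<open>An intermediate value theorem on the possibly disconnected set \<open>E\<close>: the
  gapless length does not change across a gap, so skipping the gaps misses no value.\<close>

lemma gapless_length_onto:
  assumes E: "compact E" "a \<in> E" "b \<in> E" "E \<subseteq> {a..b}"
    and x: "0 \<le> x" "x \<le> gapless_length E a b"
  shows "\<exists>t\<in>E. gapless_length E a t = x"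
proof -
  let ?\<tau> = "gapless_length E a"
  have aE: "a \<le> t" if "t \<in> E" for t using that E(4) by auto
  have add: "?\<tau> t = ?\<tau> s + gapless_length E s t" if "s \<in> E" "t \<in> E" "s \<le> t" for s t
    using gapless_add[OF lipschitz_on_ident E(2) that(1,2) aE that(3)] that by simp
  have le: "gapless_length E s t \<le> t - s" if "s \<in> E" "t \<in> E" "s \<le> t" for s t
    using gapless_length_le[of "{}" E s t] that by simp
  define X where "X = {t \<in> E. ?\<tau> t \<le> x}"
  have "?\<tau> a = 0" using gapless_length_nonneg[OF E(2,2)] le[OF E(2,2)] by simp
  then have aX: "a \<in> X" using x E by (auto simp: X_def)
  have bdd: "bdd_above X" using E(4) by (auto simp: X_def intro!: bdd_aboveI[of _ b])
  define c where "c = Sup X"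
  have cE: "c \<in> E"
  proof -
    have "c \<in> closure X" unfolding c_def using aX bdd by (intro closure_contains_Sup) auto
    also have "closure X \<subseteq> E" using E(1)
      by (intro closure_minimal compact_imp_closed) (auto simp: X_def)
    finally show ?thesis .
  qed
  have up: "t \<le> c" if "t \<in> X" for t unfolding c_def using bdd that by (rule cSup_upper[rotated])
  have "?\<tau> c \<le> x"
  proof (rule field_le_epsilon)
    fix e :: real assume e: "e > 0"
    then obtain t where t: "t \<in> X" "c - e < t"
      using less_cSup_iff[of X "c - e"] aX bdd by (auto simp: c_def)
    have "?\<tau> c \<le> ?\<tau> t + (c - t)" using add[of t c] le[of t c] t(1) up[OF t(1)] cE
      by (auto simp: X_def)
    then show "?\<tau> c \<le> x + e" using t by (auto simp: X_def)
  qed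
  moreover have "\<not> ?\<tau> c < x"
  proof
    assume lt: "?\<tau> c < x"
    have cb: "c < b" using lt x cE E(4) by (cases "c = b") auto
    \<comment> \<open>If the points of \<open>E\<close> beyond \<open>c\<close> accumulate at
      \<open>c\<close>, the length rises too slowly to exceed \<open>x\<close> at once; otherwise
      \<open>c\<close> begins a gap, across which it does not rise. Either way \<open>X\<close>
      continues beyond \<open>c\<close>.\<close>
    define Y where "Y = E \<inter> {c<..}"
    have Y: "b \<in> Y" "bdd_below Y" using cb E by (auto simp: Y_def intro!: bdd_belowI[of _ c])
    define d where "d = Inf Y"
    have cd: "c \<le> d" unfolding d_def using Y by (intro cInf_greatest) (auto simp: Y_def)
    have no: "t \<notin> X" if "t \<in> Y" for t using up[of t] that by (auto simp: Y_def)
    show False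
    proof (cases "c = d")
      case True
      then obtain t where t: "t \<in> Y" "t < c + (x - ?\<tau> c)"
        using cInf_less_iff[of Y "c + (x - ?\<tau> c)"] Y lt by (auto simp: d_def)
      have "?\<tau> t \<le> ?\<tau> c + (t - c)" using add[of c t] le[of c t] cE t(1) by (auto simp: Y_def)
      then have "t \<in> X" using t by (auto simp: X_def Y_def)
      with no t(1) show False by blast
    next
      case False
      then have cd': "c < d" using cd by simp
      have "d \<in> closure Y" unfolding d_def using Y by (intro closure_contains_Inf) auto
      also have "closure Y \<subseteq> E" using E(1)
        by (intro closure_minimal compact_imp_closed) (auto simp: Y_def)
      finally have dE: "d \<in> E" .
      have "t \<notin> E" if "c < t" "t < d" for t
        using that cInf_lower[OF _ Y(2), of t] by (auto simp: d_def Y_def)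
      then have "(c, d) \<in> gaps E c d" using cE dE cd' by (auto simp: gaps_def)
      then have "gapless_length E c d \<le> 0"
        using gapless_length_le[of "{(c, d)}" E c d] cE dE cd' by (simp add: jump_def)
      then have "?\<tau> d \<le> ?\<tau> c" using add[OF cE dE cd] by simp
      then have "d \<in> X" using dE lt by (auto simp: X_def)
      with up cd' show False by fastforce
    qed
  qed
  ultimately show ?thesis using cE by force
qed

text \<open>Parametrizing \<open>E\<close> by its gapless length turns the gapless increments of \<open>D\<close> into the
  increments of a Lipschitz curve on an interval. Its image under \<open>T\<close> is tested with the piecewise
  affine functions of slopes \<open>\<plusminus>1\<close>.\<close>

lemma gapless_curve:
  fixes D :: "real \<Rightarrow> 'y::banach" and T :: "'y \<Rightarrow>\<^sub>L 'z::real_normed_vector"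
  assumes E: "compact E" "measure lebesgue E > 0" and D: "L-lipschitz_on E D"
    and test: "\<And>g :: real \<Rightarrow> real. 1-lipschitz_on UNIV g \<Longrightarrow>
      \<exists>\<phi>. bounded_linear \<phi> \<and> (\<forall>z. \<bar>\<phi> z\<bar> \<le> norm z) \<and> (\<forall>s\<in>E. \<forall>t\<in>E. \<phi> (blinfun_apply T (D t)) - \<phi>
          (blinfun_apply T (D s)) = g t - g s)"
  shows "\<exists>(\<psi> :: real \<Rightarrow> 'y) K c. K-lipschitz_on {0..1} \<psi> \<and> c > 0 \<and>
    (\<forall>(n::nat) (k :: nat \<Rightarrow> real). n > 0 \<longrightarrow>
      c * (\<Sum>j<n. \<bar>k j\<bar>) / real n \<le> norm (blinfun_apply T (\<Sum>j<n. k j *\<^sub>R (\<psi> (real (Suc j) / real n) - \<psi>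
          (real j / real n)))))"
proof -
  have ne: "E \<noteq> {}" using E(2) by auto
  obtain a where a: "a \<in> E" "\<And>t. t \<in> E \<Longrightarrow> a \<le> t" using compact_attains_inf[OF E(1) ne] by blast
  obtain b where b: "b \<in> E" "\<And>t. t \<in> E \<Longrightarrow> t \<le> b" using compact_attains_sup[OF E(1) ne] by blast
  have Eab: "E \<subseteq> {a..b}" using a b by auto
  define l where "l = gapless_length E a b"
  have l: "l > 0" using measure_le_gapless_length[OF E(1) a(1) b(1) Eab] E(2) by (simp add: l_def)
  have L: "L \<ge> 0" using D by (rule lipschitz_on_nonneg)
  let ?\<tau> = "gapless_length E a"
  have "\<exists>t\<in>E. ?\<tau> t = l * x" if "x \<in> {0..1}" for x
    using that l by (intro gapless_length_onto[OF E(1) a(1) b(1) Eab]) (auto simp: l_def[symmetric]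
        mult_left_le)
  \<comment> \<open>\<open>p\<close> inverts the gapless length, rescaled by \<open>l\<close> to the
    unit interval.\<close>
  then obtain p where p: "\<And>x. x \<in> {0..1} \<Longrightarrow> p x \<in> E" "\<And>x. x \<in> {0..1} \<Longrightarrow> ?\<tau> (p x) = l * x" by metis
  have add: "?\<tau> t = ?\<tau> s + gapless_length E s t" if "s \<in> E" "t \<in> E" "s \<le> t" for s t
    using gapless_add[OF lipschitz_on_ident a(1) that(1,2) a(2) that(3)] that by simp
  have pmono: "p x \<le> p y" if "x \<in> {0..1}" "y \<in> {0..1}" "x \<le> y" for x y
  proof (rule ccontr)
    assume n: "\<not> p x \<le> p y"
    then have "?\<tau> (p y) \<le> ?\<tau> (p x)"
      using add[of "p y" "p x"] gapless_length_nonneg[of "p y" E "p x"] p that by simp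
    then have "x = y" using p that l by simp
    with n show False by simp
  qed
  have len: "gapless_length E (p x) (p y) = l * (y - x)" if "x \<in> {0..1}" "y \<in> {0..1}" "x \<le> y" for x y
    using add[OF p(1) p(1) pmono, OF that(1,2) that] p(2) that by (simp add: algebra_simps)
  define \<psi> where "\<psi> x = gapless E D a (p x)" for x
  have diff: "\<psi> y - \<psi> x = gapless E D (p x) (p y)" if "x \<in> {0..1}" "y \<in> {0..1}" "x \<le> y" for x y
    using gapless_add[OF D a(1) p(1) p(1) a(2) pmono, OF that(1,2) _ that] p(1) that
    by (simp add: \<psi>_def algebra_simps flip: add_diff_eq)
  have nrm: "norm (\<psi> y - \<psi> x) \<le> L * l * (y - x)" if "x \<in> {0..1}" "y \<in> {0..1}" "x \<le> y" for x y
    using norm_gapless_le[OF D p(1) p(1) pmono, OF that(1,2) that]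
    unfolding diff[OF that] len[OF that] by (simp add: mult.assoc)
  have "(L * l)-lipschitz_on {0..1} \<psi>"
  proof (rule lipschitz_onI)
    fix x y :: real assume xy: "x \<in> {0..1}" "y \<in> {0..1}"
    show "dist (\<psi> x) (\<psi> y) \<le> L * l * dist x y"
      using nrm[of x y] nrm[of y x] xy
          by (cases "x \<le> y") (auto simp: dist_norm norm_minus_commute abs_if)
  qed (use L l in simp)
  moreover have "l * (\<Sum>j<n. \<bar>k j\<bar>) / real n \<le> norm (blinfun_apply T (\<Sum>j<n. k j *\<^sub>R (\<psi> (real (Suc j) /
    real n) - \<psi> (real j / real n))))"
    if n: "n > 0" for n :: nat and k :: "nat \<Rightarrow> real"
  proof -
    define q where "q j = p (real j / real n)" for j
    have in01: "real j / real n \<in> {0..1}" if "j \<le> n" for j using that n by (auto simp: divide_le_eq)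
    have qE: "q j \<in> E" if "j \<le> n" for j using p(1) in01[OF that] by (simp add: q_def)
    have q: "q i \<le> q j" if "i \<le> j" "j \<le> n" for i j
      using pmono[OF in01 in01, of i j] that n by (simp add: q_def divide_right_mono)
    \<comment> \<open>\<open>clamp j\<close> moves only on the cell from \<open>q j\<close> to
      \<open>q (Suc j)\<close>, with slope \<open>1\<close>. Hence \<open>g\<close> has slope
      \<open>sgn (k j)\<close> there and stays \<open>1\<close>-Lipschitz.\<close>
    define clamp where "clamp j y = max (q j) (min (q (Suc j)) y)" for j y
    define g where "g y = (\<Sum>j<n. sgn (k j) * clamp j y)" for y
    have g_le: "\<bar>g y - g x\<bar> \<le> y - x" if xy: "x \<le> y" for x y
    proof -
      have cm: "clamp j x \<le> clamp j y" for j using xy by (auto simp: clamp_def min_def max_def)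
      have "\<bar>g y - g x\<bar> = \<bar>\<Sum>j<n. sgn (k j) * (clamp j y - clamp j x)\<bar>"
        by (simp add: g_def right_diff_distrib sum_subtractf)
      also have "\<dots> \<le> (\<Sum>j<n. \<bar>sgn (k j) * (clamp j y - clamp j x)\<bar>)" by (rule sum_abs)
      also have "\<dots> \<le> (\<Sum>j<n. clamp j y - clamp j x)"
        using cm by (intro sum_mono) (auto simp: abs_mult sgn_if)
      also have "\<dots> \<le> y - x"
      proof -
        have "(\<Sum>j<i. clamp j y - clamp j x) = max (q 0) (min (q i) y) - max (q 0) (min (q i) x)"
          if "i \<le> n" for i
          using that
        proof (induction i)
          case (Suc i)
          have "q 0 \<le> q i" "q i \<le> q (Suc i)" using q Suc.prems by auto
          then show ?case using Suc by (simp add: clamp_def) (auto simp: min_def max_def)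
        qed simp
        from this[OF order_refl] show ?thesis using xy by (auto simp: min_def max_def)
      qed
      finally show ?thesis .
    qed
    have "1-lipschitz_on UNIV g"
    proof (rule lipschitz_onI)
      fix x y show "dist (g x) (g y) \<le> 1 * dist x y"
        using g_le[of x y] g_le[of y x]
            by (cases "x \<le> y") (auto simp: dist_real_def abs_minus_commute)
    qed simp
    from test[OF this] obtain \<phi> where \<phi>: "bounded_linear \<phi>" "\<And>z. \<bar>\<phi> z\<bar> \<le> norm z"
      "\<And>s t. s \<in> E \<Longrightarrow> t \<in> E \<Longrightarrow> \<phi> (blinfun_apply T (D t)) - \<phi> (blinfun_apply T (D s)) = g t - g s"
          by blast
    have bl: "bounded_linear (\<lambda>y. \<phi> (blinfun_apply T y))"
      by (rule bounded_linear_compose[OF \<phi>(1) blinfun.bounded_linear_right])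
    interpret \<phi>T: bounded_linear "\<lambda>y. \<phi> (blinfun_apply T y)" by (rule bl)
    \<comment> \<open>On the cell \<open>g\<close> is affine, so \<open>\<phi>\<close> turns each
      jump of \<open>D\<close> into \<open>sgn (k j)\<close> times the length of the gap; the sum
      over the gaps passes through the bounded functional.\<close>
    have step: "\<phi> (blinfun_apply T (\<psi> (real (Suc j) / real n) - \<psi> (real j / real n)))
      = sgn (k j) * (l / real n)" if j: "j < n" for j
    proof -
      have J: "q j \<in> E" "q (Suc j) \<in> E" "q j \<le> q (Suc j)" using j qE q by auto
      have aff: "g t - g s = sgn (k j) * (t - s)" if st: "q j \<le> s" "s \<le> t" "t \<le> q (Suc j)" for s t
      proof -
        have "clamp i t - clamp i s = (if i = j then t - s else 0)" if i: "i < n" for i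
        proof (cases i j rule: linorder_cases)
          case less
          then have "q i \<le> q (Suc i)" "q (Suc i) \<le> q j" using j by (auto intro: q)
          with st less show ?thesis by (auto simp: clamp_def min_def max_def)
        next
          case equal
          with st show ?thesis by (auto simp: clamp_def min_def max_def)
        next
          case greater
          then have "q i \<le> q (Suc i)" "q (Suc j) \<le> q i" using i by (auto intro: q)
          with st greater show ?thesis by (auto simp: clamp_def min_def max_def)
        qed
        then have "(\<Sum>i<n. sgn (k i) * (clamp i t - clamp i s)) = (\<Sum>i<n. if i
          = j then sgn (k j) * (t - s) else 0)"
          by (intro sum.cong) auto
        then show ?thesis using j by (simp add: g_def right_diff_distrib sum_subtractf)
      qed
      have "\<phi> (blinfun_apply T (infsum (jump D) (gaps E (q j) (q (Suc j)))))
        = infsum (\<lambda>x. \<phi> (blinfun_apply T (jump D x))) (gaps E (q j) (q (Suc j)))"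
        using summable_on_bounded_linear[OF bl jumps_summable[OF D J]] jumps_summable[OF D J]
        by (intro infsum_bounded_linear_strong[symmetric] bl) simp
      also have "\<dots> = infsum (\<lambda>x. sgn (k j) * jump (\<lambda>x. x) x) (gaps E (q j) (q (Suc j)))"
      proof (rule infsum_cong)
        fix x assume "x \<in> gaps E (q j) (q (Suc j))"
        then have "q j \<le> fst x" "fst x \<le> snd x" "snd x \<le> q (Suc j)" "fst x \<in> E" "snd x \<in> E"
          by (auto simp: gaps_def)
        then show "\<phi> (blinfun_apply T (jump D x)) = sgn (k j) * jump (\<lambda>x. x) x"
          using \<phi>(3)[of "fst x" "snd x"] aff[of "fst x" "snd x"] by (simp add: jump_def \<phi>T.diff)
      qed
      also have "\<dots> = sgn (k j) * infsum (jump (\<lambda>x. x)) (gaps E (q j) (q (Suc j)))"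
        by (rule infsum_cmult_right) (rule gap_lengths_summable[OF J])
      finally have "\<phi> (blinfun_apply T (gapless E D (q j) (q (Suc j))))
        = sgn (k j) * gapless_length E (q j) (q (Suc j))"
        using \<phi>(3)[OF J(1,2)] aff[of "q j" "q (Suc j)"] J(3)
            by (simp add: gapless_def \<phi>T.diff right_diff_distrib)
      also have "gapless_length E (q j) (q (Suc j)) = l / real n"
        unfolding q_def using len[OF in01 in01, of j "Suc j"] j n by (simp add: field_simps)
      finally show ?thesis
        using diff[OF in01 in01, of j "Suc j"] j n by (simp add: q_def divide_right_mono)
    qed
    have "l * (\<Sum>j<n. \<bar>k j\<bar>) / real n = (\<Sum>j<n. k j * (sgn (k j) * (l / real n)))"
      by (simp add: sum_distrib_left sum_divide_distrib) (auto intro!: sum.cong simp: abs_sgn)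
    also have "\<dots> = (\<Sum>j<n. k j *\<^sub>R \<phi> (blinfun_apply T (\<psi> (real (Suc j) / real n) - \<psi> (real j / real
      n))))"
      using step by (intro sum.cong) auto
    also have "\<dots> = \<phi> (blinfun_apply T (\<Sum>j<n. k j *\<^sub>R (\<psi> (real (Suc j) / real n) - \<psi> (real j / real
      n))))"
      by (simp only: \<phi>T.sum \<phi>T.scaleR)
    also have "\<dots> \<le> norm (blinfun_apply T (\<Sum>j<n. k j *\<^sub>R (\<psi> (real (Suc j) / real n) - \<psi> (real j / real
      n))))"
      using \<phi>(2) abs_le_D1 by blast
    finally show ?thesis .
  qed
  ultimately show ?thesis using l by blast
qed


section \<open>Copies of \<open>L\<^sub>1\<close> generated by Lipschitz curves\<close>

text \<open>The initial intervals form a pi-system generating the Borel sets. Dynkin's lemma gives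
  \<open>Q\<close> on Borel indicators, completion on Lebesgue indicators, and linearity with
  dominated convergence on all integrable functions.\<close>

lemma unit_leb_integrable_induct [consumes 1, case_names interval add scale lim]:
  assumes u: "integrable unit_leb u"
    and interval: "\<And>x. 0 \<le> x \<Longrightarrow> x \<le> 1 \<Longrightarrow> Q (indicator {..<x} :: real \<Rightarrow> real)"
    and add: "\<And>u v. integrable unit_leb u \<Longrightarrow> integrable unit_leb v \<Longrightarrow> Q u \<Longrightarrow> Q v \<Longrightarrow> Q (\<lambda>t. u t + v t)"
    and scale: "\<And>c u. integrable unit_leb u \<Longrightarrow> Q u \<Longrightarrow> Q (\<lambda>t. c * u t)"
    and lim: "\<And>u s. integrable unit_leb u \<Longrightarrow> (\<And>i. integrable unit_leb (s i)) \<Longrightarrow> (\<And>i. Q (s i)) \<Longrightarrow>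
      (\<lambda>i. \<integral>t. \<bar>u t - s i t\<bar> \<partial>unit_leb) \<longlonglongrightarrow> 0 \<Longrightarrow> Q u"
  shows "Q u"
proof -
  \<comment> \<open>A constant sequence in \<open>lim\<close> shows that \<open>Q\<close> respects
    equality almost everywhere.\<close>
  have cong: "Q v"
    if "Q u" "integrable unit_leb u" "integrable unit_leb v" "AE t in unit_leb. v t = u t" for u v
  proof (rule lim[of v "\<lambda>_. u"])
    have "(\<integral>t. \<bar>v t - u t\<bar> \<partial>unit_leb) = (\<integral>t. 0 \<partial>unit_leb)"
      using that by (intro integral_cong_AE) (auto elim: eventually_mono)
    then show "(\<lambda>i::nat. \<integral>t. \<bar>v t - u t\<bar> \<partial>unit_leb) \<longlonglongrightarrow> 0" by simp
  qed (use that in auto)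
  interpret finite_measure unit_leb by (rule finite_measure_unit_leb)
  have borel: "B \<in> sets borel \<Longrightarrow> B \<inter> {0..1} \<in> sets unit_leb" for B :: "real set"
    by (auto simp: sets_restrict_space_iff)
  have bint: "integrable unit_leb (indicator B :: real \<Rightarrow> real)" if "B \<in> sets borel" for B
  proof -
    have "integrable unit_leb (indicator (B \<inter> {0..1}) :: real \<Rightarrow> real)"
      using borel[OF that] by (rule integrable_unit_leb_indicator)
    then show ?thesis
      by (rule Bochner_Integration.integrable_cong[THEN iffD1, rotated -1]) (auto split:
          split_indicator)
  qed
  have intervals: "Q (indicator {..<x})" for x
  proof -
    \<comment> \<open>Clamping \<open>x\<close> to \<open>[0, 1]\<close> changes the indicator on
      the unit interval at most at the point \<open>1\<close>.\<close>
    have A: "Q (indicator {..<max 0 (min 1 x)})" by (rule interval) auto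
    have "AE t in lebesgue. t \<noteq> 1" by (intro AE_completion AE_lborel_singleton)
    then have B: "AE t in unit_leb. indicator {..<x} t = (indicator {..<max 0 (min 1 x)} t :: real)"
      by (subst AE_restrict_space_iff) (auto elim!: eventually_mono split: split_indicator)
    show ?thesis by (rule cong[OF A bint bint B]) simp_all
  qed
  have Q_borel: "Q (indicator B)" if B: "B \<in> sets borel" for B
  proof -
    have sets_eq: "sigma_sets UNIV (range lessThan) = sets (borel :: real measure)"
      unfolding borel_Iio by (rule sets_measure_of[symmetric]) simp
    with B have "B \<in> sigma_sets UNIV (range lessThan)" by simp
    have stable: "Int_stable (range (lessThan :: real \<Rightarrow> real set))"
    proof (unfold Int_stable_def, intro ballI)
      fix a b assume "a \<in> range (lessThan :: real \<Rightarrow> real set)" "b \<in> range (lessThan :: real \<Rightarrow> real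
          set)"
      then obtain x y where "a = {..<x}" "b = {..<y}" by blast
      then have "a \<inter> b = {..<min x y}" by auto
      then show "a \<inter> b \<in> range lessThan" by blast
    qed
    show ?thesis
      using stable subset_UNIV[of "range lessThan", folded Pow_UNIV] \<open>B \<in> sigma_sets UNIV (range
          lessThan)\<close>
    proof (induction rule: sigma_sets_induct_disjoint)
      case (basic A)
      then show ?case using intervals by auto
    next
      case empty
      have "Q (\<lambda>t. 0 * indicator {..<0} t)" by (intro scale bint intervals) auto
      then show ?case by simp
    next
      case (compl A)
      then have A: "A \<in> sets borel" using sets_eq by blast
      have "Q (indicator UNIV)"
      proof (rule cong[OF intervals[of 2] bint bint])
        show "AE t in unit_leb. indicator UNIV t = (indicator {..<2::real} t :: real)"
          by (rule AE_I2) auto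
      qed auto
      then have "Q (\<lambda>t. indicator UNIV t + (-1) * indicator A t)"
        by (intro add scale bint Bochner_Integration.integrable_mult_right compl A) auto
      also have "(\<lambda>t. indicator UNIV t + (-1) * indicator A t)
        = (indicator (UNIV - A) :: real \<Rightarrow> real)"
        by (auto simp: fun_eq_iff split: split_indicator)
      finally show ?case .
    next
      case (union A)
      then have A: "A i \<in> sets borel" for i using sets_eq by blast
      have QU: "Q (indicator (\<Union>i<n. A i))" for n
      proof (induction n)
        case 0
        have "Q (\<lambda>t. 0 * indicator {..<0} t)" by (intro scale bint intervals) auto
        then show ?case by simp
      next
        case (Suc n)
        have "Q (\<lambda>t. indicator (\<Union>i<n. A i) t + indicator (A n) t)"
          using A union Suc by (intro add bint) auto
        also have "(\<lambda>t. indicator (\<Union>i<n. A i) t + indicator (A n) t)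
          = (indicator (\<Union>i<Suc n. A i) :: real \<Rightarrow> real)"
        proof
          fix t
          have "A n \<inter> A i = {}" if "i < n" for i
            using disjoint_family_onD[OF \<open>disjoint_family A\<close>, of n i] that by simp
          then have "A n \<inter> (\<Union>i<n. A i) = {}" by blast
          then show "indicator (\<Union>i<n. A i) t + indicator (A n) t
            = (indicator (\<Union>i<Suc n. A i) t :: real)"
            by (auto simp: lessThan_Suc split: split_indicator)
        qed
        finally show ?case .
      qed
      have U: "(\<Union>i. A i) \<in> sets borel" "(\<Union>i<n. A i) \<in> sets borel" for n using A by auto
      have "(\<lambda>n. measure unit_leb ((\<Union>i<n. A i) \<inter> {0..1})) \<longlonglongrightarrow> measure unit_leb (\<Union>n. (\<Union>i<n. A i) \<inter>
        {0..1})"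
        using borel[OF U(2)]
            by (intro finite_Lim_measure_incseq) (auto intro!: incseq_SucI simp: lessThan_Suc)
      also have "(\<Union>n. (\<Union>i<n. A i) \<inter> {0..1}) = (\<Union>i. A i) \<inter> {0..1}" by (auto intro: lessI)
      finally have *: "(\<lambda>n. measure unit_leb ((\<Union>i<n. A i) \<inter> {0..1})) \<longlonglongrightarrow> measure unit_leb ((\<Union>i. A i) \<inter>
        {0..1})" .
      show ?case
      proof (rule lim[OF bint[OF U(1)] bint[OF U(2)] QU])
        have "(\<integral>t. \<bar>indicator (\<Union>i. A i) t - indicator (\<Union>i<n. A i) t\<bar> \<partial>unit_leb)
          = measure unit_leb ((\<Union>i. A i) \<inter> {0..1}) - measure unit_leb ((\<Union>i<n. A i) \<inter> {0..1})" for n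
        proof -
          have "(\<integral>t. \<bar>indicator (\<Union>i. A i) t - indicator (\<Union>i<n. A i) t :: real\<bar> \<partial>unit_leb)
            = (\<integral>t. indicator (\<Union>i. A i) t - indicator (\<Union>i<n. A i) t \<partial>unit_leb)"
            by (intro Bochner_Integration.integral_cong) (auto split: split_indicator)
          also have "\<dots> = measure unit_leb ((\<Union>i. A i) \<inter> {0..1}) - measure unit_leb ((\<Union>i<n. A i) \<inter>
            {0..1})"
            by (subst Bochner_Integration.integral_diff[OF bint[OF U(1)] bint[OF U(2)]]) simp
          finally show ?thesis .
        qed
        then show "(\<lambda>n. \<integral>t. \<bar>indicator (\<Union>i. A i) t - indicator (\<Union>i<n. A i) t :: real\<bar> \<partial>unit_leb) \<longlonglongrightarrow> 0"
          using tendsto_diff[OF tendsto_const[of "measure unit_leb ((\<Union>i. A i) \<inter> {0..1})"] *] by simp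
      qed
    qed
  qed
  have Q_set: "Q (indicator A)" if A: "A \<in> sets unit_leb" for A
  proof -
    from A have "A \<in> sets lebesgue" by (simp add: sets_restrict_space_iff)
    then obtain S N N' where SN: "A = S \<union> N" "N \<subseteq> N'" "N' \<in> null_sets lborel" "S \<in> sets lborel"
      by (rule sets_completionE)
    have "AE t in lebesgue. t \<notin> N'" using SN(3) by (intro AE_completion AE_not_in)
    then have "AE t in unit_leb. indicator A t = (indicator S t :: real)"
      using SN(1,2) by (subst AE_restrict_space_iff) (auto elim!: eventually_mono split:
          split_indicator)
    then show ?thesis
      using SN(4) A by (intro cong[OF Q_borel bint integrable_unit_leb_indicator]) auto
  qed
  from u show ?thesis
  proof (induction rule: integrable_induct)
    case (base A c)
    then show ?case
      using scale[OF integrable_unit_leb_indicator Q_set, of A c] by (simp add: mult.commute)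
  next
    case (add f g)
    then show ?case by (intro assms(3))
  next
    case (lim f s)
    show ?case
    proof (rule assms(5)[of f s])
      have "(\<lambda>i. \<integral>t. \<bar>f t - s i t\<bar> \<partial>unit_leb) \<longlonglongrightarrow> (\<integral>t. 0 \<partial>unit_leb)"
      proof (rule integral_dominated_convergence[where w="\<lambda>t. 3 * \<bar>f t\<bar>"])
        show "AE t in unit_leb. (\<lambda>i. \<bar>f t - s i t\<bar>) \<longlonglongrightarrow> 0"
        proof (rule AE_I2)
          fix t assume "t \<in> space unit_leb"
          then have "(\<lambda>i. s i t) \<longlonglongrightarrow> f t" by (rule lim)
          from tendsto_rabs[OF tendsto_diff[OF tendsto_const[of "f t"] this]]
          show "(\<lambda>i. \<bar>f t - s i t\<bar>) \<longlonglongrightarrow> 0" by simp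
        qed
        show "AE t in unit_leb. norm \<bar>f t - s i t\<bar> \<le> 3 * \<bar>f t\<bar>" for i
        proof (rule AE_I2)
          fix t assume "t \<in> space unit_leb"
          then have "norm (s i t) \<le> 2 * norm (f t)" by (rule lim)
          then show "norm \<bar>f t - s i t\<bar> \<le> 3 * \<bar>f t\<bar>" by (simp add: abs_if split: if_splits)
        qed
      qed (use lim in auto)
      then show "(\<lambda>i. \<integral>t. \<bar>f t - s i t\<bar> \<partial>unit_leb) \<longlonglongrightarrow> 0" by simp
    qed (use lim in auto)
  qed
qed

section \<open>Integrating against a Lipschitz curve\<close>

definition cell_avg :: "nat \<Rightarrow> nat \<Rightarrow> (real \<Rightarrow> real) \<Rightarrow> real" where
  "cell_avg n j u = real n * (\<integral>t. indicator {real j / real n..<real (Suc j) / real n} t * u t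
      \<partial>unit_leb)"

text \<open>Sums of Riemann-Stieltjes type for the integral of \<open>u\<close> against the curve
  \<open>\<psi>\<close>. Averages replace values because \<open>u\<close> matters only up to
  equality almost everywhere.\<close>

definition step_sum :: "(real \<Rightarrow> 'y::real_normed_vector) \<Rightarrow> nat \<Rightarrow> (real \<Rightarrow> real) \<Rightarrow> 'y" where
  "step_sum \<psi> n u = (\<Sum>j<n. cell_avg n j u *\<^sub>R (\<psi> (real (Suc j) / real n) - \<psi> (real j / real n)))"

lemma integrable_cell:
  fixes u :: "real \<Rightarrow> real"
  assumes "integrable unit_leb u"
  shows "integrable unit_leb (\<lambda>t. indicator {a..<b} t * u t)"
proof -
  have "{a..<b} \<inter> {0..1} \<in> sets unit_leb" by (auto simp: sets_restrict_space_iff)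
  from integrable_real_mult_indicator[OF this assms]
  have "integrable unit_leb (\<lambda>t. u t * indicator ({a..<b} \<inter> {0..1}) t)" .
  then show ?thesis
    by (rule Bochner_Integration.integrable_cong[THEN iffD1, rotated -1]) (auto split:
        split_indicator)
qed

lemma cell_avg_add:
  assumes "integrable unit_leb u" "integrable unit_leb v"
  shows "cell_avg n j (\<lambda>t. u t + v t) = cell_avg n j u + cell_avg n j v"
  using assms by (simp add: cell_avg_def distrib_left Bochner_Integration.integral_add
      integrable_cell)

lemma cell_avg_scale: "cell_avg n j (\<lambda>t. c * u t) = c * cell_avg n j u"
proof -
  have "(\<lambda>t. indicator {real j / real n..<real (Suc j) / real n} t * (c * u t))
    = (\<lambda>t. c * (indicator {real j / real n..<real (Suc j) / real n} t * u t))"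
    by (simp add: fun_eq_iff)
  then show ?thesis by (simp add: cell_avg_def del: of_nat_Suc)
qed

lemma step_sum_add:
  assumes "integrable unit_leb u" "integrable unit_leb v"
  shows "step_sum \<psi> n (\<lambda>t. u t + v t) = step_sum \<psi> n u + step_sum \<psi> n v"
  unfolding step_sum_def cell_avg_add[OF assms] scaleR_add_left sum.distrib ..

lemma step_sum_scale: "step_sum \<psi> n (\<lambda>t. c * u t) = c *\<^sub>R step_sum \<psi> n u"
  unfolding step_sum_def cell_avg_scale scaleR_sum_right scaleR_scaleR ..

lemma step_sum_cong_AE:
  assumes "integrable unit_leb u" "integrable unit_leb v" "AE t in unit_leb. u t = v t"
  shows "step_sum \<psi> n u = step_sum \<psi> n v"
proof -
  have "cell_avg n j u = cell_avg n j v" for j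
    unfolding cell_avg_def using assms integrable_cell[THEN borel_measurable_integrable]
    by (intro arg_cong2[where f="(*)"] refl integral_cong_AE) (auto elim: eventually_mono)
  then show ?thesis by (simp add: step_sum_def)
qed

lemma sum_cell_avg_le:
  assumes u: "integrable unit_leb u" and n: "n > 0"
  shows "(\<Sum>j<n. \<bar>cell_avg n j u\<bar>) / real n \<le> (\<integral>t. \<bar>u t\<bar> \<partial>unit_leb)"
proof -
  let ?I = "\<lambda>j. {real j / real n..<real (Suc j) / real n}"
  have "(\<Sum>j<n. \<bar>cell_avg n j u\<bar>) / real n = (\<Sum>j<n. \<bar>\<integral>t. indicator (?I j) t * u t \<partial>unit_leb\<bar>)"
    using n by (simp add: cell_avg_def abs_mult sum_divide_distrib)
  also have "\<dots> \<le> (\<Sum>j<n. \<integral>t. indicator (?I j) t * \<bar>u t\<bar> \<partial>unit_leb)"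
    by (intro sum_mono order_trans[OF integral_abs_bound]) (auto simp: abs_mult)
  also have "\<dots> = (\<integral>t. (\<Sum>j<n. indicator (?I j) t * \<bar>u t\<bar>) \<partial>unit_leb)"
    using u by (intro Bochner_Integration.integral_sum[symmetric] integrable_cell) auto
  also have "\<dots> \<le> (\<integral>t. \<bar>u t\<bar> \<partial>unit_leb)"
  proof (rule integral_mono)
    show "integrable unit_leb (\<lambda>t. \<Sum>j<n. indicator (?I j) t * \<bar>u t\<bar>)"
      using u by (intro Bochner_Integration.integrable_sum integrable_cell) auto
    fix t
    have "(\<Sum>j<n. indicator (?I j) t :: real) \<le> 1"
    proof -
      have dj: "disjoint_family_on ?I {..<n}"
        unfolding disjoint_family_on_def
      proof (intro ballI impI)
        fix i j :: nat assume "i \<noteq> j"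
        then have "Suc i \<le> j \<or> Suc j \<le> i" by linarith
        then show "?I i \<inter> ?I j = {}" using n by (auto simp: field_simps) 
      qed
      have "(\<Sum>j<n. indicator (?I j) t :: real) = indicator (\<Union>j<n. ?I j) t"
        using dj by (intro indicator_UN_disjoint[symmetric]) auto
      also have "\<dots> \<le> 1" by (simp split: split_indicator)
      finally show ?thesis .
    qed
    then show "(\<Sum>j<n. indicator (?I j) t * \<bar>u t\<bar>) \<le> \<bar>u t\<bar>"
      by (simp flip: sum_distrib_right) (simp add: mult_left_le_one_le sum_nonneg)
  qed (use u in auto)
  finally show ?thesis .
qed

text \<open>The bound is kept in terms of the cell averages rather than the norm of
  \<open>u\<close>, because the lower estimate in \<open>fixes_copy_of_l1_if_curve\<close> meets the
  same expression.\<close>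

lemma norm_step_sum_le:
  assumes \<psi>: "K-lipschitz_on {0..1} \<psi>" and n: "n > 0"
  shows "norm (step_sum \<psi> n u) \<le> K * ((\<Sum>j<n. \<bar>cell_avg n j u\<bar>) / real n)"
proof -
  have "norm (step_sum \<psi> n u) \<le> (\<Sum>j<n. \<bar>cell_avg n j u\<bar> * (K / real n))"
    unfolding step_sum_def
  proof (rule sum_norm_le)
    fix j assume "j \<in> {..<n}"
    then have j: "real j / real n \<in> {0..1}" "real (Suc j) / real n \<in> {0..1}"
      by (auto simp: divide_le_eq)
    have "norm (\<psi> (real (Suc j) / real n) - \<psi> (real j / real n))
      \<le> K * dist (real (Suc j) / real n) (real j / real n)"
      using lipschitz_onD[OF \<psi> j(2,1)] by (simp add: dist_norm)
    also have "\<dots> = K / real n" using n by (simp add: dist_real_def field_simps)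
    finally show "norm (cell_avg n j u *\<^sub>R (\<psi> (real (Suc j) / real n) - \<psi> (real j / real n)))
      \<le> \<bar>cell_avg n j u\<bar> * (K / real n)"
      unfolding norm_scaleR by (rule mult_left_mono) simp
  qed
  also have "\<dots> = K * ((\<Sum>j<n. \<bar>cell_avg n j u\<bar>) / real n)"
    by (simp add: sum_distrib_right[symmetric] sum_divide_distrib[symmetric])
  finally show ?thesis .
qed

lemma norm_step_sum_le_integral:
  assumes \<psi>: "K-lipschitz_on {0..1} \<psi>" and n: "n > 0" and u: "integrable unit_leb u"
  shows "norm (step_sum \<psi> n u) \<le> K * (\<integral>t. \<bar>u t\<bar> \<partial>unit_leb)"
  using norm_step_sum_le[OF \<psi> n, of u] mult_left_mono[OF sum_cell_avg_le[OF u n]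
      lipschitz_on_nonneg[OF \<psi>]]
  by (rule order_trans)

lemma cell_avg_indicator:
  assumes n: "n > 0" "j < n" and x: "0 \<le> x" "x \<le> 1"
  shows "cell_avg n j (indicator {..<x}) = max 0 (min 1 (real n * x - real j))"
proof -
  let ?a = "real j / real n" and ?b = "real (Suc j) / real n"
  have "(\<lambda>t. indicator {?a..<?b} t * indicator {..<x} t :: real) = indicator {?a..<min ?b x}"
    by (auto simp: fun_eq_iff split: split_indicator)
  then have avg: "cell_avg n j (indicator {..<x}) = real n * measure unit_leb ({?a..<min ?b x} \<inter> space
    unit_leb)"
    unfolding cell_avg_def by (simp del: space_restrict_space)
  have b: "?b \<le> 1" using n by (simp add: divide_le_eq)
  have "0 \<le> t" if "?a \<le> t" for t
    using that by (rule order_trans[rotated]) simp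
  with b have sp: "{?a..<min ?b x} \<inter> space unit_leb = {?a..<min ?b x}" by auto
  note avg
  also note sp
  also have "measure unit_leb {?a..<min ?b x} = measure lebesgue {?a..<min ?b x}"
  proof (rule measure_restrict_space)
    show "{?a..<min ?b x} \<subseteq> {0..1}" using sp by auto
  qed simp
  also have "\<dots> = max 0 (min ?b x - ?a)" by (cases "?a \<le> min ?b x") auto
  also have "real n * max 0 (min ?b x - ?a) = max 0 (min 1 (real n * x - real j))"
  proof -
    have "real n * max 0 (min ?b x - ?a) = max (real n * 0) (real n * (min ?b x - ?a))"
      using n by (simp add: max_mult_distrib_left)
    also have "real n * (min ?b x - ?a) = min (real n * ?b) (real n * x) - real n * ?a"
      using n by (simp add: right_diff_distrib min_mult_distrib_left)
    also have "\<dots> = min 1 (real n * x - real j)" using n by (simp add: min_def)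
    finally show ?thesis by simp
  qed
  finally show ?thesis .
qed

text \<open>The cells left of \<open>x\<close> telescope; the cell containing \<open>x\<close> and
  the replacement of a grid point by \<open>x\<close> cost at most \<open>K / n\<close>
  each.\<close>

lemma step_sum_indicator_tendsto:
  assumes \<psi>: "K-lipschitz_on {0..1} \<psi>" and x: "0 \<le> x" "x \<le> 1"
  shows "(\<lambda>n. step_sum \<psi> (Suc n) (indicator {..<x})) \<longlonglongrightarrow> \<psi> x - \<psi> 0"
proof -
  have K: "K \<ge> 0" using \<psi> by (rule lipschitz_on_nonneg)
  have le: "norm (step_sum \<psi> n (indicator {..<x}) - (\<psi> x - \<psi> 0)) \<le> 2 * K / real n" if n: "n > 0" for n
  proof -
    define i where "i = nat \<lfloor>real n * x\<rfloor>"
    have i: "real i \<le> real n * x" "real n * x < real i + 1"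
      using x by (auto simp: i_def of_nat_nat)
    have "real n * x \<le> real n" using x by (simp add: mult_left_le)
    then have i_le: "i \<le> n" using i(1) by linarith
    let ?d = "\<lambda>j. \<psi> (real (Suc j) / real n) - \<psi> (real j / real n)"
    \<comment> \<open>For \<open>x = 1\<close> the index \<open>i\<close> equals \<open>n\<close>
      and there is no partial cell.\<close>
    define r where "r = (if i < n then (real n * x - real i) *\<^sub>R ?d i else 0)"
    have avg: "cell_avg n j (indicator {..<x}) = (if j < i then 1 else if j
      = i then real n * x - real i else 0)" if "j < n" for j
      using cell_avg_indicator[OF n that x] i by (auto simp: min_def max_def)
    have "step_sum \<psi> n (indicator {..<x}) = (\<Sum>j<n. (if j < i then ?d j else 0) + (if j
      = i then (real n * x - real i) *\<^sub>R ?d i else 0))"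
      unfolding step_sum_def by (intro sum.cong) (auto simp: avg)
    also have "\<dots> = (\<Sum>j<n. if j < i then ?d j else 0) + r"
      by (simp add: sum.distrib r_def)
    also have "(\<Sum>j<n. if j < i then ?d j else 0) = (\<Sum>j<i. ?d j)"
      using i_le by (intro sum.mono_neutral_cong_right) auto
    also have "\<dots> = \<psi> (real i / real n) - \<psi> (real 0 / real n)"
      by (rule sum_lessThan_telescope)
    finally have eq: "step_sum \<psi> n (indicator {..<x}) - (\<psi> x - \<psi> 0) = (\<psi> (real i / real n) - \<psi> x) + r"
      by simp
    have in01: "real i / real n \<in> {0..1}" "x \<in> {0..1}" using i_le n x by (auto simp: divide_le_eq)
    have "norm (\<psi> (real i / real n) - \<psi> x) \<le> K * \<bar>real i / real n - x\<bar>"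
      using lipschitz_onD[OF \<psi> in01] by (simp add: dist_norm)
    also have "\<dots> \<le> K * (1 / real n)"
    proof (intro mult_left_mono K)
      have "\<bar>real i / real n - x\<bar> = \<bar>real i - real n * x\<bar> / real n" using n
        by (simp add: field_simps abs_if)
      also have "\<dots> \<le> 1 / real n" using i by (intro divide_right_mono) auto
      finally show "\<bar>real i / real n - x\<bar> \<le> 1 / real n" .
    qed
    finally have 1: "norm (\<psi> (real i / real n) - \<psi> x) \<le> K / real n" by simp
    have 2: "norm r \<le> K / real n"
    proof (cases "i < n")
      case True
      then have j: "real (Suc i) / real n \<in> {0..1}" by (auto simp: divide_le_eq)
      have "norm (?d i) \<le> K * \<bar>real (Suc i) / real n - real i / real n\<bar>"
        using lipschitz_onD[OF \<psi> j in01(1)] by (simp add: dist_norm)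
      also have "real (Suc i) / real n - real i / real n = 1 / real n" using n
        by (simp add: field_simps)
      finally have "norm (?d i) \<le> K / real n" using n by simp
      moreover have "norm r \<le> 1 * norm (?d i)"
        using True i unfolding r_def by (simp only: if_True norm_scaleR) (intro mult_right_mono, auto)
      ultimately show ?thesis by simp
    qed (use K in \<open>simp add: r_def\<close>)
    show ?thesis unfolding eq using norm_triangle_le[OF add_mono[OF 1 2]] by simp
  qed
  have "(\<lambda>n. 2 * K / real (Suc n)) \<longlonglongrightarrow> 0"
    using LIMSEQ_Suc[OF lim_const_over_n[of "2 * K"]] by simp
  then have "(\<lambda>n. step_sum \<psi> (Suc n) (indicator {..<x}) - (\<psi> x - \<psi> 0)) \<longlonglongrightarrow> 0"
    by (rule Lim_null_comparison[rotated]) (intro always_eventually allI le, simp)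
  then show ?thesis by (rule LIM_zero_cancel)
qed

lemma norm_add_diff_le: "norm (a + b - c) \<le> norm a + norm b + norm (c :: 'y::real_normed_vector)"
  using norm_triangle_ineq4[of "a + b" c] norm_triangle_ineq[of a b] by linarith

text \<open>Convergence is explicit for initial intervals, and the bound by \<open>K\<close> times
  the \<open>L_1\<close> norm, uniform in \<open>n\<close>, carries it over to limits.\<close>

lemma convergent_step_sum:
  fixes \<psi> :: "real \<Rightarrow> 'y::banach"
  assumes \<psi>: "K-lipschitz_on {0..1} \<psi>" and u: "integrable unit_leb u"
  shows "convergent (\<lambda>n. step_sum \<psi> (Suc n) u)"
  using u
proof (induction rule: unit_leb_integrable_induct)
  case (interval x)
  show ?case using step_sum_indicator_tendsto[OF \<psi> interval] by (rule convergentI)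
next
  case (add u v)
  then show ?case by (simp add: step_sum_add convergent_add)
next
  case (scale c u)
  then show ?case
    using tendsto_scaleR[OF tendsto_const[of c]] unfolding step_sum_scale convergent_def by blast
next
  case (lim u s)
  have K: "K \<ge> 0" using \<psi> by (rule lipschitz_on_nonneg)
  have "Cauchy (\<lambda>n. step_sum \<psi> (Suc n) u)"
  proof (rule CauchyI)
    fix e :: real assume e: "e > 0"
    have "e / (3 * (K + 1)) > 0" using e K by simp
    from order_tendstoD(2)[OF lim(3) this]
    obtain i where i: "(\<integral>t. \<bar>u t - s i t\<bar> \<partial>unit_leb) < e / (3 * (K + 1))"
      by (auto simp: eventually_sequentially)
    have a1: "K * (e / (3 * (K + 1))) < e / 3" using e K by (simp add: field_simps)
    have a2: "K * (\<integral>t. \<bar>u t - s i t\<bar> \<partial>unit_leb) \<le> K * (e / (3 * (K + 1)))"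
      using i K by (intro mult_left_mono) auto
    have a3: "norm (step_sum \<psi> (Suc n) u - step_sum \<psi> (Suc n) (s i))
      \<le> K * (\<integral>t. \<bar>u t - s i t\<bar> \<partial>unit_leb)" for n
    proof -
      have "step_sum \<psi> (Suc n) u = step_sum \<psi> (Suc n) (\<lambda>t. (u t - s i t) + s i t)" by simp
      also have "\<dots> = step_sum \<psi> (Suc n) (\<lambda>t. u t - s i t) + step_sum \<psi> (Suc n) (s i)"
        using lim(1,2) by (intro step_sum_add) auto
      finally show ?thesis
        using norm_step_sum_le_integral[OF \<psi>, of "Suc n" "\<lambda>t. u t - s i t"] lim(1,2) by simp
    qed
    have close: "norm (step_sum \<psi> (Suc n) u - step_sum \<psi> (Suc n) (s i)) < e / 3" for n
      using a1 a2 a3[of n] by linarith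
    obtain N where N: "\<And>m n. m \<ge> N \<Longrightarrow> n \<ge> N \<Longrightarrow> norm (step_sum \<psi> (Suc m) (s i) - step_sum \<psi> (Suc n) (s
      i)) < e / 3"
      using CauchyD[OF convergent_Cauchy[OF lim(4)[of i]], of "e / 3"] e by auto
    show "\<exists>N. \<forall>m\<ge>N. \<forall>n\<ge>N. norm (step_sum \<psi> (Suc m) u - step_sum \<psi> (Suc n) u) < e"
    proof (intro exI allI impI)
      fix m n assume mn: "N \<le> m" "N \<le> n"
      have "step_sum \<psi> (Suc m) u - step_sum \<psi> (Suc n) u =
        (step_sum \<psi> (Suc m) u - step_sum \<psi> (Suc m) (s i)) + (step_sum \<psi> (Suc m) (s i) - step_sum \<psi>
            (Suc n) (s i))
         - (step_sum \<psi> (Suc n) u - step_sum \<psi> (Suc n) (s i))" by simp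
      then show "norm (step_sum \<psi> (Suc m) u - step_sum \<psi> (Suc n) u) < e"
        using close[of m] close[of n] N[OF mn]
          norm_add_diff_le[of "step_sum \<psi> (Suc m) u - step_sum \<psi> (Suc m) (s i)" "step_sum \<psi> (Suc m) (s
              i) - step_sum \<psi> (Suc n) (s i)"
            "step_sum \<psi> (Suc n) u - step_sum \<psi> (Suc n) (s i)"] by simp
    qed
  qed
  then show ?case by (rule Cauchy_convergent)
qed

lemma atLeastLessThan_in_unit_leb: "0 \<le> x \<Longrightarrow> y \<le> 1 \<Longrightarrow> {x..<y} \<in> sets unit_leb"
  by (auto simp: sets_restrict_space_iff)

lemma l1_ind_lipschitz: "1-lipschitz_on {0..1} (\<lambda>x. l1_ind {0..<x})"
proof -
  let ?\<psi> = "\<lambda>x::real. l1_ind {0..<x}"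
  note s = atLeastLessThan_in_unit_leb
  have d: "norm (?\<psi> y - ?\<psi> x) = y - x" if "0 \<le> x" "x \<le> y" "y \<le> 1" for x y
  proof -
    have "{0..<y} - {0..<x} = {x..<y}" "{x..<y} \<in> sets unit_leb" using that
      by (auto simp: sets_restrict_space_iff)
    then have "norm (?\<psi> y - ?\<psi> x) = measure unit_leb {x..<y}"
      using that by (simp add: l1_ind_diff s norm_l1_ind)
    also have "\<dots> = measure lebesgue {x..<y}" using that by (intro measure_restrict_space) auto
    finally show ?thesis using that by simp
  qed
  show ?thesis
  proof (rule lipschitz_onI)
    fix x y :: real assume "x \<in> {0..1}" "y \<in> {0..1}"
    then show "dist (?\<psi> x) (?\<psi> y) \<le> 1 * dist x y"
      using d[of x y] d[of y x] by (cases "x \<le> y") (auto simp: dist_norm norm_minus_commute)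
  qed simp
qed

text \<open>The step sums of the curve \<open>x \<mapsto> 1\<^sub>[\<^sub>0\<^sub>,\<^sub>x\<^sub>)\<close> in \<open>L\<^sub>1\<close> are the conditional expectations of \<open>u\<close>.\<close>

lemma step_sum_l1_ind_tendsto:
  assumes u: "integrable unit_leb u"
  shows "(\<lambda>n. step_sum (\<lambda>x. l1_ind {0..<x}) (Suc n) u) \<longlonglongrightarrow> abs_l1 u"
proof -
  let ?\<psi> = "\<lambda>x::real. l1_ind {0..<x}"
  note \<psi> = l1_ind_lipschitz
  from u show ?thesis
  proof (induction rule: unit_leb_integrable_induct)
    case (interval x)
    have "?\<psi> 0 = 0" using norm_l1_ind[of "{}"] by simp
    moreover have "?\<psi> x = abs_l1 (indicator {..<x})"
    proof -
      have "integrable unit_leb (indicator {0..<x} :: real \<Rightarrow> real)"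
        using atLeastLessThan_in_unit_leb interval by (intro integrable_unit_leb_indicator) auto
      moreover from this have "integrable unit_leb (indicator {..<x} :: real \<Rightarrow> real)"
        by (rule Bochner_Integration.integrable_cong[THEN iffD1, rotated -1]) (auto split:
            split_indicator)
      moreover have "AE t in unit_leb. indicator {0..<x} t = (indicator {..<x} t :: real)"
        by (rule AE_I2) (auto split: split_indicator)
      ultimately have "l1_rel (indicator {0..<x}) (indicator {..<x})" by (simp add: l1_rel_def)
      then show ?thesis unfolding l1_ind_def using Quotient3_rel_abs[OF Quotient3_l1] by blast
    qed
    ultimately show ?case using step_sum_indicator_tendsto[OF \<psi> interval] by simp
  next
    case (add u v)
    then show ?case
      using tendsto_add[OF add(3,4)] by (simp add: step_sum_add plus_l1.abs_eq)
  next
    case (scale c u)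
    then show ?case
      using tendsto_scaleR[OF tendsto_const[of c] scale(2)]
          by (simp add: step_sum_scale scaleR_l1.abs_eq)
  next
    case (lim u s)
    show ?case
    proof (rule metric_LIMSEQ_I)
      fix e :: real assume e: "e > 0"
      then have "e / 3 > 0" by simp
      from order_tendstoD(2)[OF lim(3) this] obtain i where i: "(\<integral>t. \<bar>u t - s i t\<bar> \<partial>unit_leb) < e / 3"
        by (auto simp: eventually_sequentially)
      have us: "integrable unit_leb (\<lambda>t. u t - s i t)" using lim(1,2) by auto
      have close: "norm (step_sum ?\<psi> (Suc n) u - step_sum ?\<psi> (Suc n) (s i)) < e / 3" for n
      proof -
        have "step_sum ?\<psi> (Suc n) u = step_sum ?\<psi> (Suc n) (\<lambda>t. (u t - s i t) + s i t)" by simp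
        also have "\<dots> = step_sum ?\<psi> (Suc n) (\<lambda>t. u t - s i t) + step_sum ?\<psi> (Suc n) (s i)"
          using lim(1,2) by (intro step_sum_add) auto
        finally show ?thesis using norm_step_sum_le_integral[OF \<psi>, of "Suc n" "\<lambda>t. u t - s i t"] us i
          by simp
      qed
      have close': "norm (abs_l1 u - abs_l1 (s i)) < e / 3"
        using lim(1,2) us i by (simp add: minus_l1.abs_eq norm_l1.abs_eq)
      obtain N where N: "\<And>n. n \<ge> N \<Longrightarrow> dist (step_sum ?\<psi> (Suc n) (s i)) (abs_l1 (s i)) < e / 3"
        using metric_LIMSEQ_D[OF lim(4)[of i], of "e / 3"] e by auto
      show "\<exists>N. \<forall>n\<ge>N. dist (step_sum ?\<psi> (Suc n) u) (abs_l1 u) < e"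
      proof (intro exI allI impI)
        fix n assume n: "N \<le> n"
        have "step_sum ?\<psi> (Suc n) u - abs_l1 u =
          (step_sum ?\<psi> (Suc n) u - step_sum ?\<psi> (Suc n) (s i)) + (step_sum ?\<psi> (Suc n) (s i) - abs_l1 (s
              i)) - (abs_l1 u - abs_l1 (s i))" by simp
        then show "dist (step_sum ?\<psi> (Suc n) u) (abs_l1 u) < e"
          using close[of n] close' N[OF n]
            norm_add_diff_le[of "step_sum ?\<psi> (Suc n) u - step_sum ?\<psi> (Suc n) (s i)" "step_sum ?\<psi> (Suc
                n) (s i) - abs_l1 (s i)" "abs_l1 u - abs_l1 (s i)"]
          unfolding dist_norm by simp
      qed
    qed
  qed
qed

lemma isomorphic_embedding_onI:
  assumes "c > 0" "\<And>z. z \<in> Z \<Longrightarrow> c * norm z \<le> norm (T z)" "\<And>z. z \<in> Z \<Longrightarrow> norm (T z) \<le> C * norm z"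
  shows "isomorphic_embedding_on Z T"
  unfolding isomorphic_embedding_on_def using assms by (intro exI[of _ c] conjI exI[of _ C] ballI)

text \<open>The embedding \<open>J\<close> integrates against \<open>\<psi>\<close>. For the lower
  bound, \<open>low\<close> produces the mean of the absolute cell averages; it dominates the norm
  of the conditional expectation of the function, and these expectations converge to the function in
  \<open>L_1\<close>.\<close>

lemma fixes_copy_of_l1_if_curve:
  fixes \<psi> :: "real \<Rightarrow> 'y::banach" and T :: "'y \<Rightarrow>\<^sub>L 'z::real_normed_vector"
  assumes \<psi>: "K-lipschitz_on {0..1} \<psi>" and c: "c > 0"
    and low: "\<And>(n::nat) (k :: nat \<Rightarrow> real). n > 0 \<Longrightarrow>
      c * (\<Sum>j<n. \<bar>k j\<bar>) / real n \<le> norm (blinfun_apply T (\<Sum>j<n. k j *\<^sub>R (\<psi> (real (Suc j) / real n) - \<psi>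
          (real j / real n))))"
  shows "fixes_copy_of_l1 T"
proof -
  define J where "J q = lim (\<lambda>n. step_sum \<psi> (Suc n) (rep_l1 q))" for q
  have rep: "integrable unit_leb (rep_l1 q)" "abs_l1 (rep_l1 q) = q" for q
    using Quotient3_rep_reflp[OF Quotient3_l1, of q] Quotient3_abs_rep[OF Quotient3_l1]
        by (auto simp: l1_rel_def)
  have Jlim: "(\<lambda>n. step_sum \<psi> (Suc n) u) \<longlonglongrightarrow> J (abs_l1 u)" if u: "integrable unit_leb u" for u
  proof -
    have "l1_rel (rep_l1 (abs_l1 u)) u"
      using Quotient3_rep_abs[OF Quotient3_l1, of u] u by simp
    then have "step_sum \<psi> (Suc n) (rep_l1 (abs_l1 u)) = step_sum \<psi> (Suc n) u" for n
      by (intro step_sum_cong_AE) (auto simp: l1_rel_def)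
    then show ?thesis
      using convergent_step_sum[OF \<psi> u] by (simp add: J_def convergent_LIMSEQ_iff)
  qed
  have nrm: "norm q = (\<integral>t. \<bar>rep_l1 q t\<bar> \<partial>unit_leb)" for q
    by (subst (1) rep(2)[symmetric], subst norm_l1.abs_eq) (auto simp: rep)
  have add: "J (p + q) = J p + J q" for p q
  proof -
    have "p + q = abs_l1 (\<lambda>t. rep_l1 p t + rep_l1 q t)"
      using plus_l1.abs_eq[of "rep_l1 p" "rep_l1 q"] by (simp add: rep)
    then have "(\<lambda>n. step_sum \<psi> (Suc n) (\<lambda>t. rep_l1 p t + rep_l1 q t)) \<longlonglongrightarrow> J (p + q)"
      using Jlim[of "\<lambda>t. rep_l1 p t + rep_l1 q t"] rep by simp
    moreover have "(\<lambda>n. step_sum \<psi> (Suc n) (\<lambda>t. rep_l1 p t + rep_l1 q t)) \<longlonglongrightarrow> J p + J q"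
      using tendsto_add[OF Jlim[OF rep(1)[of p]] Jlim[OF rep(1)[of q]]]
          by (simp add: step_sum_add rep)
    ultimately show ?thesis by (rule LIMSEQ_unique)
  qed
  have scale: "J (r *\<^sub>R q) = r *\<^sub>R J q" for r q
  proof -
    have "r *\<^sub>R q = abs_l1 (\<lambda>t. r * rep_l1 q t)"
      using scaleR_l1.abs_eq[of "rep_l1 q" r] by (simp add: rep)
    then have "(\<lambda>n. step_sum \<psi> (Suc n) (\<lambda>t. r * rep_l1 q t)) \<longlonglongrightarrow> J (r *\<^sub>R q)"
      using Jlim[of "\<lambda>t. r * rep_l1 q t"] rep by simp
    moreover have "(\<lambda>n. step_sum \<psi> (Suc n) (\<lambda>t. r * rep_l1 q t)) \<longlonglongrightarrow> r *\<^sub>R J q"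
      using tendsto_scaleR[OF tendsto_const[of r] Jlim[OF rep(1)[of q]]]
          by (simp add: step_sum_scale rep)
    ultimately show ?thesis by (rule LIMSEQ_unique)
  qed
  have lin: "linear J" by (rule linearI) (auto simp: add scale)
  have Jle: "norm (J q) \<le> K * norm q" for q
  proof (rule tendsto_upperbound)
    show "(\<lambda>n. norm (step_sum \<psi> (Suc n) (rep_l1 q))) \<longlonglongrightarrow> norm (J q)"
      using tendsto_norm[OF Jlim[OF rep(1)[of q]]] by (simp add: rep)
    show "\<forall>\<^sub>F n in sequentially. norm (step_sum \<psi> (Suc n) (rep_l1 q)) \<le> K * norm q"
      using norm_step_sum_le_integral[OF \<psi> _ rep(1)] by (simp add: nrm)
  qed simp
  have TJ: "c * norm q \<le> norm (T (J q))" for q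
  proof (rule tendsto_le)
    show "(\<lambda>n. norm (T (step_sum \<psi> (Suc n) (rep_l1 q)))) \<longlonglongrightarrow> norm (T (J q))"
      using Jlim[OF rep(1)[of q]]
          by (intro tendsto_norm blinfun.tendsto tendsto_const) (simp add: rep)
    show "(\<lambda>n. c * norm (step_sum (\<lambda>x. l1_ind {0..<x}) (Suc n) (rep_l1 q))) \<longlonglongrightarrow> c * norm q"
      using step_sum_l1_ind_tendsto[OF rep(1)[of q]] by (intro tendsto_intros) (simp add: rep)
    show "\<forall>\<^sub>F n in sequentially. c * norm (step_sum (\<lambda>x. l1_ind {0..<x}) (Suc n) (rep_l1 q))
      \<le> norm (T (step_sum \<psi> (Suc n) (rep_l1 q)))"
    proof (intro always_eventually allI)
      fix n
      have "1-lipschitz_on {0..1} (\<lambda>x. l1_ind {0..<x})" by (rule l1_ind_lipschitz)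
      then have "norm (step_sum (\<lambda>x. l1_ind {0..<x}) (Suc n) (rep_l1 q))
        \<le> 1 * ((\<Sum>j<Suc n. \<bar>cell_avg (Suc n) j (rep_l1 q)\<bar>) / real (Suc n))"
        by (rule norm_step_sum_le) simp
      then have "c * norm (step_sum (\<lambda>x. l1_ind {0..<x}) (Suc n) (rep_l1 q))
        \<le> c * (\<Sum>j<Suc n. \<bar>cell_avg (Suc n) j (rep_l1 q)\<bar>) / real (Suc n)"
        using c by (metis mult_1 mult_left_mono less_imp_le times_divide_eq_right)
      also have "\<dots> \<le> norm (T (step_sum \<psi> (Suc n) (rep_l1 q)))"
        unfolding step_sum_def by (rule low) simp
      finally show "c * norm (step_sum (\<lambda>x. l1_ind {0..<x}) (Suc n) (rep_l1 q))
        \<le> norm (T (step_sum \<psi> (Suc n) (rep_l1 q)))" .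
    qed
  qed simp
  have K: "K \<ge> 0" using \<psi> by (rule lipschitz_on_nonneg)
  have "isomorphic_embedding_on UNIV J"
  proof (rule isomorphic_embedding_onI)
    \<comment> \<open>A lower bound for \<open>T (J q)\<close> gives one for \<open>J q\<close>,
      since \<open>T\<close> is bounded; the summand \<open>1\<close> keeps the denominator
      positive.\<close>
    show "c / (norm T + 1) > 0" using c by (simp add: add_nonneg_pos)
    show "norm (J q) \<le> K * norm q" for q by (rule Jle)
    fix q
    have "c * norm q \<le> norm T * norm (J q)" using TJ[of q] norm_blinfun[of T "J q"] by linarith
    also have "\<dots> \<le> (norm T + 1) * norm (J q)" by (simp add: distrib_right)
    finally show "c / (norm T + 1) * norm q \<le> norm (J q)"
      by (simp add: divide_le_eq mult.commute add_nonneg_pos)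
  qed
  then have 1: "isomorphic_to_l1 (range J)" unfolding isomorphic_to_l1_def using lin by blast
  have "isomorphic_embedding_on (range J) T"
  proof (rule isomorphic_embedding_onI)
    show "c / (K + 1) > 0" using c K by simp
    show "norm (T z) \<le> norm T * norm z" for z by (rule norm_blinfun)
    fix z assume "z \<in> range J"
    then obtain q where z: "z = J q" by blast
    have "c * norm z \<le> c * ((K + 1) * norm q)"
      using c Jle[of q] by (intro mult_left_mono) (auto simp: z distrib_right add_increasing2)
    also have "\<dots> = (K + 1) * (c * norm q)" by simp
    also have "\<dots> \<le> (K + 1) * norm (T z)" using K TJ[of q] by (intro mult_left_mono) (auto simp: z)
    finally show "c / (K + 1) * norm z \<le> norm (T z)" using K by (simp add: divide_le_eq mult.commute)
  qed
  moreover have "subspace (range J)" using linear_subspace_image[OF lin subspace_UNIV] .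
  ultimately show ?thesis unfolding fixes_copy_of_l1_def using 1 by blast
qed


section \<open>Lipschitz maps with an image of positive measure\<close>

lemma lip0_of_lipschitz:
  fixes h :: "'a::{metric_space,zero} \<Rightarrow> real"
  assumes h: "K-lipschitz_on UNIV h" and h0: "h 0 = 0"
  shows "\<exists>g. lip0_apply g = h \<and> norm g \<le> K"
proof (intro exI conjI)
  show *: "lip0_apply (Abs_lip0 h) = h" using h h0 by (intro Abs_lip0_inverse) auto
  show "norm (Abs_lip0 h) \<le> K"
    using lipschitz_onD[OF h]
        by (intro lip0_norm_le lipschitz_on_nonneg[OF h]) (simp add: * dist_real_def)
qed

lemma lipfree_delta_apply [simp]: "blinfun_apply (lipfree_functional (lipfree_delta x)) g
    = lip0_apply g x"
  by (simp add: lipfree_delta.rep_eq)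

lemma dist_lipfree_delta_le: "dist (lipfree_delta x) (lipfree_delta y) \<le> dist x y"
  unfolding dist_norm norm_lipfree.rep_eq minus_lipfree.rep_eq lipfree_delta.rep_eq
proof (rule norm_blinfun_bound)
  fix g :: "'a lip0"
  show "norm (blinfun_apply (lip0_eval x - lip0_eval y) g) \<le> dist x y * norm g"
    using lip0_dist_le[of g x y] by (simp add: blinfun.diff_left mult.commute)
qed simp

lemma lipfree_functional_le: "\<bar>blinfun_apply (lipfree_functional z) g\<bar> \<le> norm z * norm g"
  using norm_blinfun[of "lipfree_functional z" g] by (simp add: norm_lipfree.rep_eq)

lemma bounded_linear_lipfree_apply: "bounded_linear (\<lambda>z. blinfun_apply (lipfree_functional z) g)"
  by (rule bounded_linear_intro[of _ "norm g"])
    (use lipfree_functional_le in \<open>auto simp: plus_lipfree.rep_eq scaleR_lipfree.rep_eq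
        blinfun.add_left blinfun.scaleR_left\<close>)

text \<open>The new parameter is the distance from \<open>\<sigma> p\<close>, extended to
  \<open>V\<close>, which is bi-Lipschitz on \<open>E\<close>. In this parameter a test function
  \<open>g\<close> on the line is realised on the target as \<open>g (dist (\<sigma> p) y)\<close>,
  without loss in the Lipschitz constant.\<close>

lemma fixes_copy_of_l1_if_image_not_null:
  fixes f :: "'a::{metric_space,zero} \<Rightarrow> 'b::{metric_space,zero}" and \<gamma> :: "real \<Rightarrow> 'a"
  assumes A: "bounded A" and \<gamma>: "L-lipschitz_on A \<gamma>" and f: "M-lipschitz_on UNIV f" and f0: "f 0 = 0"
    and pos: "hausdorff1 (f ` \<gamma> ` A) \<noteq> 0"
  shows "fixes_copy_of_l1 (lipfree_map f)"
proof -
  define \<sigma> where "\<sigma> t = f (\<gamma> t)" for t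
  define C where "C = M * L + 1"
  have nonneg: "0 \<le> M" "0 \<le> L" using f \<gamma> by (auto intro: lipschitz_on_nonneg)
  then have C: "C > 0" by (simp add: C_def add_nonneg_pos)
  have \<sigma>: "dist (\<sigma> s) (\<sigma> t) \<le> C * dist s t" if "s \<in> A" "t \<in> A" for s t
  proof -
    have "dist (\<sigma> s) (\<sigma> t) \<le> M * dist (\<gamma> s) (\<gamma> t)" using lipschitz_onD[OF f] by (simp add: \<sigma>_def)
    also have "\<dots> \<le> M * (L * dist s t)" using lipschitz_onD[OF \<gamma> that] nonneg by (intro mult_left_mono)
    also have "\<dots> \<le> C * dist s t" by (simp add: C_def distrib_right)
    finally show ?thesis .
  qed
  have "f ` \<gamma> ` A = \<sigma> ` A" by (auto simp: \<sigma>_def)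
  then obtain p q where pq: "p \<in> A" "q \<in> A" "p < q"
    and gap: "C * measure lebesgue ({p..q} - closure A) < dist (\<sigma> p) (\<sigma> q)"
    using hausdorff1_image_eq_0_if_dist_le_gaps[OF A, of C \<sigma>] pos C by (metis less_imp_le not_less)
  have "C-lipschitz_on A (\<lambda>t. dist (\<sigma> p) (\<sigma> t))"
  proof (rule lipschitz_onI)
    fix s t assume "s \<in> A" "t \<in> A"
    then show "dist (dist (\<sigma> p) (\<sigma> s)) (dist (\<sigma> p) (\<sigma> t)) \<le> C * dist s t"
      using \<sigma>[of s t] abs_dist_diff_le[of "\<sigma> s" "\<sigma> p" "\<sigma> t"] by (simp add: dist_real_def dist_commute)
  qed (use C in simp)
  from mcshane_extension[OF this] obtain V where V: "C-lipschitz_on UNIV V"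
    "\<And>t. t \<in> A \<Longrightarrow> V t = dist (\<sigma> p) (\<sigma> t)" by blast
  have "1-lipschitz_on UNIV (\<lambda>t. V t / C)"
  proof (rule lipschitz_onI)
    fix s t
    have "dist (V s / C) (V t / C) = dist (V s) (V t) / C"
      using C by (simp add: dist_real_def flip: diff_divide_distrib)
    then show "dist (V s / C) (V t / C) \<le> 1 * dist s t"
      using lipschitz_onD[OF V(1), of s t] C by (simp add: divide_le_eq mult.commute)
  qed simp
  moreover have "measure lebesgue ({p..q} - closure A) < V q / C - V p / C"
    using gap C V(2) pq by (simp add: less_divide_eq mult.commute)
  ultimately obtain c E where E: "c > 0" "E \<subseteq> closure A" "compact E" "measure lebesgue E > 0"
    "\<And>s t. s \<in> E \<Longrightarrow> t \<in> E \<Longrightarrow> s \<le> t \<Longrightarrow> c * (t - s) \<le> V t / C - V s / C"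
    using lipschitz_expanding_subset[of "\<lambda>t. V t / C" "closure A" p q] pq(3) by (metis closed_closure)
  define k where "k = c * C"
  have k: "k > 0" using E(1) C by (simp add: k_def)
  have expand: "k * \<bar>t - s\<bar> \<le> \<bar>V t - V s\<bar>" if "s \<in> E" "t \<in> E" for s t
  proof -
    have *: "k * (t - s) \<le> V t - V s" if "s \<in> E" "t \<in> E" "s \<le> t" for s t
      using E(5)[OF that] C by (simp add: k_def field_simps)
    show ?thesis using *[of s t] *[of t s] that by (cases "s \<le> t") auto
  qed
  then have inj: "inj_on V E" using k by (force simp: inj_on_def mult_le_0_iff)
  have "(1 / k)-lipschitz_on (V ` E) (the_inv_into E V)"
  proof (rule lipschitz_onI)
    fix x y assume "x \<in> V ` E" "y \<in> V ` E"
    then obtain s t where st: "s \<in> E" "t \<in> E" "x = V s" "y = V t" by blast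
    then show "dist (the_inv_into E V x) (the_inv_into E V y) \<le> 1 / k * dist x y"
      using expand[OF st(1,2)] k
      by (simp add: the_inv_into_f_f[OF inj] dist_real_def le_divide_eq mult.commute
          abs_minus_commute)
  qed (use k in simp)
  \<comment> \<open>\<open>W\<close> extends the inverse of \<open>V\<close> on \<open>E\<close>.
    Since it is Lipschitz and maps the image of \<open>E\<close> under \<open>V\<close> onto
    \<open>E\<close>, that image has positive measure.\<close>
  from mcshane_extension[OF this] obtain W where W: "(1 / k)-lipschitz_on UNIV W"
    "\<And>t. t \<in> E \<Longrightarrow> W (V t) = t" using the_inv_into_f_f[OF inj] by auto
  have contV: "continuous_on X V" for X
    using lipschitz_on_continuous_on[OF V(1)] continuous_on_subset by blast
  have cE: "compact (V ` E)" using E(3) by (intro compact_continuous_image contV)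
  have "W ` V ` E = E" using W(2) by (auto simp: image_image)
  then have "measure lebesgue E \<le> 1 / k * measure lebesgue (V ` E)"
    using measure_lipschitz_image_le[OF W(1) cE] by simp
  with E(4) have "0 < 1 / k * measure lebesgue (V ` E)" by linarith
  then have mE: "measure lebesgue (V ` E) > 0" using k by (simp add: zero_less_divide_iff)
  \<comment> \<open>\<open>E\<close> may contain limit points of \<open>A\<close>, where nothing is
    known about \<open>\<gamma>\<close>. The curve of evaluations extends to them because the free
    space is complete.\<close>
  have "L-lipschitz_on A (\<lambda>t. lipfree_delta (\<gamma> t))"
    using lipschitz_onD[OF \<gamma>] order_trans[OF dist_lipfree_delta_le] nonneg(2)
        by (intro lipschitz_onI) blast+
  then obtain \<Delta> where \<Delta>: "L-lipschitz_on (closure A) \<Delta>" "\<And>t. t \<in> A \<Longrightarrow> \<Delta> t = lipfree_delta (\<gamma> t)"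
    using lipschitz_extend_closure by metis
  define D where "D y = \<Delta> (W y)" for y
  have D: "(L * (1 / k))-lipschitz_on (V ` E) D"
  proof (rule lipschitz_onI)
    fix x y assume "x \<in> V ` E" "y \<in> V ` E"
    then have "W x \<in> closure A" "W y \<in> closure A" using W(2) E(2) by auto
    then have "dist (D x) (D y) \<le> L * dist (W x) (W y)" unfolding D_def
      by (rule lipschitz_onD[OF \<Delta>(1)])
    also have "\<dots> \<le> L * (1 / k * dist x y)" using lipschitz_onD[OF W(1)] nonneg
      by (intro mult_left_mono) auto
    finally show "dist (D x) (D y) \<le> L * (1 / k) * dist x y" by simp
  qed (use nonneg k in simp)
  have "\<exists>\<phi>. bounded_linear \<phi> \<and> (\<forall>z. \<bar>\<phi> z\<bar> \<le> norm z) \<and>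
    (\<forall>s\<in>V ` E. \<forall>t\<in>V ` E. \<phi> (blinfun_apply (lipfree_map f) (D t)) - \<phi> (blinfun_apply (lipfree_map f) (D
        s)) = g t - g s)"
    if g: "1-lipschitz_on UNIV g" for g :: "real \<Rightarrow> real"
  proof -
    \<comment> \<open>The constant makes \<open>?h\<close> vanish at the base point; it disappears
      in differences.\<close>
    let ?h = "\<lambda>y. g (dist (\<sigma> p) y) - g (dist (\<sigma> p) 0)"
    have "1-lipschitz_on UNIV ?h"
    proof (rule lipschitz_onI)
      fix x y :: 'b
      have "dist (?h x) (?h y) = dist (g (dist (\<sigma> p) x)) (g (dist (\<sigma> p) y))"
        by (simp add: dist_real_def)
      also have "\<dots> \<le> dist (dist (\<sigma> p) x) (dist (\<sigma> p) y)" using lipschitz_onD[OF g] by simp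
      also have "\<dots> \<le> dist x y"
        using abs_dist_diff_le[of x "\<sigma> p" y] by (simp add: dist_real_def dist_commute)
      finally show "dist (?h x) (?h y) \<le> 1 * dist x y" by simp
    qed simp
    then obtain h where h: "lip0_apply h = ?h" "norm h \<le> 1" using lip0_of_lipschitz[of 1 ?h] by auto
    define \<phi> where "\<phi> z = blinfun_apply (lipfree_functional z) h" for z :: "'b lipfree"
    have bl: "bounded_linear \<phi>" unfolding \<phi>_def by (rule bounded_linear_lipfree_apply)
    have le: "\<bar>\<phi> z\<bar> \<le> norm z" for z
      using lipfree_functional_le[of z h] mult_left_mono[OF h(2) norm_ge_zero[of z]]
          by (simp add: \<phi>_def)
    \<comment> \<open>The identity is checked on \<open>A\<close>, where \<open>V\<close> is the
      distance from \<open>\<sigma> p\<close>, and reaches the closure by continuity.\<close>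
    have eq: "\<phi> (blinfun_apply (lipfree_map f) (\<Delta> t)) = g (V t) - g (dist (\<sigma> p) 0)" if "t \<in> closure A"
      for t
    proof -
      have "continuous_on (closure A) (\<lambda>t. \<phi> (blinfun_apply (lipfree_map f) (\<Delta> t)))"
        by (intro bounded_linear.continuous_on[OF bl] bounded_linear.continuous_on[OF
            blinfun.bounded_linear_right]
            lipschitz_on_continuous_on[OF \<Delta>(1)])
      moreover have "continuous_on (closure A) (\<lambda>t. g (V t))"
        by (rule continuous_on_compose2[OF lipschitz_on_continuous_on[OF g] contV]) auto
      ultimately have "continuous_on (closure A) (\<lambda>t. \<phi> (blinfun_apply (lipfree_map f) (\<Delta> t)) - g (V
        t))"
        by (intro continuous_intros)
      moreover have "\<phi> (blinfun_apply (lipfree_map f) (\<Delta> t)) - g (V t) = - g (dist (\<sigma> p) 0)"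
        if t: "t \<in> A" for t
      proof -
        have "\<exists>L. L-lipschitz_on UNIV f" using f by blast
        then show ?thesis
          using t by (simp add: \<Delta>(2) lipfree_map_delta f0 \<phi>_def h(1) V(2) \<sigma>_def)
      qed
      ultimately have "\<phi> (blinfun_apply (lipfree_map f) (\<Delta> t)) - g (V t) = - g (dist (\<sigma> p) 0)"
        using that by (rule continuous_constant_on_closure)
      then show ?thesis by simp
    qed
    have "\<phi> (blinfun_apply (lipfree_map f) (D x)) = g x - g (dist (\<sigma> p) 0)" if "x \<in> V ` E" for x
      using that eq W(2) E(2) by (auto simp: D_def)
    with bl le show ?thesis by (intro exI[of _ \<phi>]) auto
  qed
  from gapless_curve[OF cE mE D this] obtain \<psi> :: "real \<Rightarrow> 'a lipfree" and K c' where
    "K-lipschitz_on {0..1} \<psi>" "c' > 0"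
    "\<And>(n::nat) k. n > 0 \<Longrightarrow> c' * (\<Sum>j<n. \<bar>k j\<bar>) / real n \<le> norm (blinfun_apply (lipfree_map f)
      (\<Sum>j<n. k j *\<^sub>R (\<psi> (real (Suc j) / real n) - \<psi> (real j / real n))))" by blast
  then show ?thesis by (rule fixes_copy_of_l1_if_curve)
qed

lemma hausdorff1_range_eq_0_if_not_fixes_l1:
  fixes f :: "'a::{metric_space,zero} \<Rightarrow> 'b::{metric_space,zero}"
  assumes rect: "countably_1_rectifiable (UNIV :: 'a set)" and f: "M-lipschitz_on UNIV f" and f0: "f 0
      = 0"
    and nofix: "\<not> fixes_copy_of_l1 (lipfree_map f)"
  shows "hausdorff1 (range f) = 0"
proof -
  obtain A :: "nat \<Rightarrow> real set" and \<gamma> :: "nat \<Rightarrow> real \<Rightarrow> 'a"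
    where lip: "\<And>i. \<exists>L. L-lipschitz_on (A i) (\<gamma> i)" and null: "hausdorff1 (UNIV - (\<Union>i. \<gamma> i ` A i))
        = 0"
    using rect unfolding countably_1_rectifiable_def by blast
  \<comment> \<open>Bounded pieces, as required by
    \<open>fixes_copy_of_l1_if_image_not_null\<close>.\<close>
  define B where "B i n = A i \<inter> {- real n..real n}" for i n
  have AB: "A i = (\<Union>n. B i n)" for i
  proof
    show "A i \<subseteq> (\<Union>n. B i n)"
    proof
      fix x assume "x \<in> A i"
      moreover obtain n :: nat where "\<bar>x\<bar> \<le> real n" using real_arch_simple by blast
      ultimately have "x \<in> B i n" by (auto simp: B_def)
      then show "x \<in> (\<Union>n. B i n)" by blast
    qed
  qed (auto simp: B_def)
  have "hausdorff1 (f ` \<gamma> i ` B i n) = 0" for i n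
  proof (rule ccontr)
    assume pos: "hausdorff1 (f ` \<gamma> i ` B i n) \<noteq> 0"
    obtain L where "L-lipschitz_on (A i) (\<gamma> i)" using lip by blast
    then have "L-lipschitz_on (B i n) (\<gamma> i)" by (rule lipschitz_on_subset) (simp add: B_def)
    moreover have "bounded (B i n)" unfolding B_def
      by (rule bounded_subset[of "{- real n..real n}"]) auto
    ultimately show False using fixes_copy_of_l1_if_image_not_null[OF _ _ f f0 pos] nofix by blast
  qed
  then have "hausdorff1 (\<Union>n. f ` \<gamma> i ` B i n) = 0" for i by (rule hausdorff1_eq_0_UN)
  then have 1: "hausdorff1 (\<Union>i. \<Union>n. f ` \<gamma> i ` B i n) = 0" by (rule hausdorff1_eq_0_UN)
  have 2: "hausdorff1 (f ` (UNIV - (\<Union>i. \<gamma> i ` A i))) = 0"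
    by (rule hausdorff1_eq_0_lipschitz_image[OF null lipschitz_on_subset[OF f]]) simp
  define S where "S j = (if j = (0::nat) then f ` (UNIV - (\<Union>i. \<gamma> i ` A i)) else (\<Union>i. \<Union>n. f ` \<gamma> i ` B i
      n))" for j
  have "hausdorff1 (\<Union>j. S j) = 0" using 1 2 by (intro hausdorff1_eq_0_UN) (simp add: S_def)
  moreover have "range f \<subseteq> S 0 \<union> S 1"
  proof safe
    fix x assume x: "f x \<notin> S 1"
    have "x \<notin> \<gamma> i ` A i" for i
      using x unfolding S_def AB by (auto simp: image_UN)
    then show "f x \<in> S 0" by (auto simp: S_def)
  qed
  then have "range f \<subseteq> (\<Union>j. S j)" by blast
  ultimately show ?thesis by (rule hausdorff1_eq_0_subset)
qed


section \<open>Locally constant Lipschitz functions\<close>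

text \<open>Thickening the sets of a cover to open ones lets compactness select finitely
  many.\<close>

lemma null_compact_finite_open_cover:
  fixes K :: "'a::metric_space set"
  assumes K: "compact K" "hausdorff1 K = 0" and e: "e > 0"
  shows "\<exists>(I :: nat set) V a. finite I \<and> (\<forall>i. open (V i)) \<and> K \<subseteq> (\<Union>i\<in>I. V i) \<and>
    (\<forall>i. \<forall>x\<in>V i. \<forall>y\<in>V i. dist x y \<le> a i) \<and> (\<forall>i. 0 \<le> a i) \<and> (\<Sum>i\<in>I. a i) \<le> e"
proof -
  have "e / 2 > 0" using e by simp
  from hausdorff1_eq_0D[OF K(2) this] obtain U and r :: "nat \<Rightarrow> real"
    where U: "K \<subseteq> (\<Union>i. U i)" "\<And>i. 0 \<le> r i" "\<And>i x y. x \<in> U i \<Longrightarrow> y \<in> U i \<Longrightarrow> dist x y \<le> r i"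
      "(\<Sum>i. ennreal (r i)) \<le> ennreal (e / 2)" by blast
  \<comment> \<open>The radii sum to \<open>e / 4\<close> and enter each diameter twice, so the
    thickening costs at most \<open>e / 2\<close>.\<close>
  define t where "t i = e / 4 * (1/2) ^ Suc i" for i
  have t: "t i > 0" for i using e by (simp add: t_def)
  define V where "V i = (\<Union>x\<in>U i. ball x (t i))" for i
  have "U i \<subseteq> V i" for i using t[of i] by (force simp: V_def)
  then have "K \<subseteq> (\<Union>i\<in>UNIV. V i)" by (intro order_trans[OF U(1)] UN_mono) simp_all
  moreover have op: "open (V i)" for i by (auto simp: V_def)
  ultimately obtain I where I: "finite I" "K \<subseteq> (\<Union>i\<in>I. V i)"
    using compactE_image[OF K(1), of UNIV V] by auto
  have d: "dist x y \<le> r i + 2 * t i" if xy: "x \<in> V i" "y \<in> V i" for x y i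
  proof -
    obtain u v where uv: "u \<in> U i" "v \<in> U i" "dist u x < t i" "dist v y < t i"
      using xy by (auto simp: V_def)
    show ?thesis
      using dist_triangle[of x y u] dist_triangle[of u y v] U(3)[OF uv(1,2)] uv(3,4)
      by (simp add: dist_commute)
  qed
  have "ennreal (\<Sum>i\<in>I. r i) = (\<Sum>i\<in>I. ennreal (r i))" using U(2) by (intro sum_ennreal[symmetric])
  also have "\<dots> \<le> (\<Sum>i. ennreal (r i))" using I(1) by (intro sum_le_suminf) auto
  also note U(4)
  finally have 1: "(\<Sum>i\<in>I. r i) \<le> e / 2" using e by simp
  have "(\<Sum>i\<in>I. (1/2) ^ Suc i) \<le> (\<Sum>i. (1/2 :: real) ^ Suc i)"
    using I(1) by (intro sum_le_suminf) (auto intro: sums_summable[OF power_half_series])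
  also have "\<dots> = 1" using power_half_series by (rule sums_unique[symmetric])
  finally have "e / 4 * (\<Sum>i\<in>I. (1/2) ^ Suc i) \<le> e / 4 * 1" using e by (intro mult_left_mono) auto
  then have "(\<Sum>i\<in>I. t i) \<le> e / 4" by (simp only: t_def sum_distrib_left mult_1_right)
  with 1 have "(\<Sum>i\<in>I. r i + 2 * t i) \<le> e" by (simp add: sum.distrib flip: sum_distrib_left)
  moreover have "0 \<le> r i + 2 * t i" for i using U(2)[of i] t[of i] by simp
  ultimately show ?thesis using I op d
    by (intro exI[of _ I] exI[of _ V] exI[of _ "\<lambda>i. r i + 2 * t i"]) auto
qed

text \<open>Gluing each of the sets \<open>V i\<close> to a point lowers distances by at most the sum of their
  diameters, since a shortest path visits each \<open>V i\<close> at most once.\<close>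

lemma glued_pseudometric:
  fixes V :: "nat \<Rightarrow> 'a::metric_space set" and a :: "nat \<Rightarrow> real"
  assumes I: "finite I" and V: "\<And>i x y. x \<in> V i \<Longrightarrow> y \<in> V i \<Longrightarrow> dist x y \<le> a i" and a: "\<And>i. 0 \<le> a i"
  shows "\<exists>\<rho> :: 'a \<Rightarrow> 'a \<Rightarrow> real. (\<forall>x y. 0 \<le> \<rho> x y) \<and> (\<forall>x y. \<rho> x y = \<rho> y x) \<and>
    (\<forall>x y z. \<rho> x z \<le> \<rho> x y + \<rho> y z) \<and> (\<forall>x y. \<rho> x y \<le> dist x y) \<and>
    (\<forall>x y. dist x y \<le> \<rho> x y + (\<Sum>i\<in>I. a i)) \<and> (\<forall>i\<in>I. \<forall>x\<in>V i. \<forall>y\<in>V i. \<rho> x y = 0)"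
  using I
proof (induction I)
  case empty
  show ?case by (intro exI[of _ dist]) (auto simp: dist_commute dist_triangle)
next
  case (insert i I)
  then obtain \<rho> :: "'a \<Rightarrow> 'a \<Rightarrow> real" where \<rho>: "\<And>x y. 0 \<le> \<rho> x y" "\<And>x y. \<rho> x y = \<rho> y x"
    "\<And>x y z. \<rho> x z \<le> \<rho> x y + \<rho> y z" "\<And>x y. \<rho> x y \<le> dist x y"
    "\<And>x y. dist x y \<le> \<rho> x y + (\<Sum>i\<in>I. a i)" "\<And>i x y. i \<in> I \<Longrightarrow> x \<in> V i \<Longrightarrow> y \<in> V i \<Longrightarrow> \<rho> x y = 0"
    by blast
  show ?case
  proof (cases "V i = {}")
    case True
    have "dist x y \<le> \<rho> x y + (\<Sum>i\<in>insert i I. a i)" for x y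
      using \<rho>(5)[of x y] a[of i] insert by simp
    with True \<rho> show ?thesis by (intro exI[of _ \<rho>]) blast
  next
    case False
    \<comment> \<open>\<open>q\<close> is the \<open>\<rho>\<close>-distance to \<open>V i\<close>.
      Paths may now also jump for free inside \<open>V i\<close>, which gives the pseudometric
      \<open>\<rho>'\<close> below.\<close>
    define q where "q x = (INF u\<in>V i. \<rho> x u)" for x
    have bdd: "bdd_below (\<rho> x ` V i)" for x using \<rho>(1) by (intro bdd_belowI[of _ 0]) auto
    have q0: "0 \<le> q x" for x unfolding q_def using \<rho>(1) False by (intro cINF_greatest) auto
    have q_le: "q x \<le> \<rho> x u" if "u \<in> V i" for x u unfolding q_def by (rule cINF_lower[OF bdd that])
    have q_near: "\<exists>u\<in>V i. \<rho> x u < q x + e" if "e > 0" for x e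
      using cINF_less_iff[OF False bdd, of x "q x + e"] that by (auto simp: q_def)
    have q_tri: "q x \<le> \<rho> x y + q y" for x y
    proof (rule field_le_epsilon)
      fix e :: real assume "e > 0"
      then obtain u where u: "u \<in> V i" "\<rho> y u < q y + e" using q_near by blast
      show "q x \<le> \<rho> x y + q y + e" using q_le[OF u(1), of x] \<rho>(3)[of x u y] u(2) by linarith
    qed
    have \<rho>_refl: "\<rho> x x = 0" for x using \<rho>(1)[of x x] \<rho>(4)[of x x] by simp
    have q_mem: "q x = 0" if "x \<in> V i" for x using q_le[OF that, of x] q0[of x] \<rho>_refl[of x] by simp
    have low: "\<rho> x y \<le> q x + q y + a i" for x y
    proof (rule field_le_epsilon)
      fix e :: real assume "e > 0"
      then have "e / 2 > 0" by simp
      then obtain u v where uv: "u \<in> V i" "\<rho> x u < q x + e / 2" "v \<in> V i" "\<rho> y v < q y + e / 2"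
        using q_near by meson
      have "\<rho> u v \<le> a i" using \<rho>(4)[of u v] V[OF uv(1,3)] by simp
      then show "\<rho> x y \<le> q x + q y + a i + e"
        using \<rho>(3)[of x y u] \<rho>(3)[of u y v] \<rho>(2)[of v y] uv by linarith
    qed
    define \<rho>' where "\<rho>' x y = min (\<rho> x y) (q x + q y)" for x y
    have "0 \<le> \<rho>' x y" for x y using \<rho>(1) q0 by (simp add: \<rho>'_def)
    moreover have "\<rho>' x y = \<rho>' y x" for x y using \<rho>(2) by (simp add: \<rho>'_def add.commute)
    moreover have "\<rho>' x z \<le> \<rho>' x y + \<rho>' y z" for x y z
      using \<rho>(3)[of x z y] q_tri[of x y] q_tri[of z y] \<rho>(2)[of z y] q0[of y] unfolding \<rho>'_def
          by linarith
    moreover have "\<rho>' x y \<le> dist x y" for x y using \<rho>(4)[of x y] by (simp add: \<rho>'_def)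
    moreover have "dist x y \<le> \<rho>' x y + (\<Sum>i\<in>insert i I. a i)" for x y
      using \<rho>(5)[of x y] low[of x y] a[of i] insert by (simp add: \<rho>'_def min_def)
    moreover have "\<rho>' x y = 0" if "j \<in> insert i I" "x \<in> V j" "y \<in> V j" for x y j
      using that \<rho>(1)[of x y] \<rho>(6)[of j x y] q_mem[of x] q_mem[of y] q0[of x] q0[of y]
      by (cases "j = i") (auto simp: \<rho>'_def)
    ultimately show ?thesis by (intro exI[of _ \<rho>']) blast
  qed
qed

text \<open>The radius is uniform on \<open>K\<close>; the gliding hump relies on this to separate
  the scales of two functions.\<close>

definition locally_constant_on :: "'a::metric_space set \<Rightarrow> ('a \<Rightarrow> real) \<Rightarrow> bool" where
  "locally_constant_on K v \<longleftrightarrow> (\<exists>r>0. \<forall>x\<in>K. \<forall>y\<in>K. dist x y < r \<longrightarrow> v x = v y)"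

text \<open>McShane's infimum with the glued pseudometric \<open>\<rho>\<close> in place of the
  distance: the result is constant on each \<open>V i\<close> with \<open>i \<in> I\<close>, is
  \<open>1\<close>-Lipschitz because \<open>\<rho>\<close> lies below the distance, and stays close
  to \<open>g\<close> because it lies at most \<open>e\<close> below.\<close>

lemma lip0_approx_locally_constant:
  fixes g :: "'a::{metric_space,zero} lip0"
  assumes K: "compact K" "hausdorff1 K = 0" and g: "norm g \<le> 1" and e: "e > 0"
  shows "\<exists>v. norm v \<le> 1 \<and> locally_constant_on K (lip0_apply v)
      \<and> (\<forall>x. \<bar>lip0_apply v x - lip0_apply g x\<bar> \<le> e)"
proof -
  obtain I :: "nat set" and V a where V: "finite I" "\<And>i. open (V i)" "K \<subseteq> (\<Union>i\<in>I. V i)"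
    "\<And>i x y. x \<in> V i \<Longrightarrow> y \<in> V i \<Longrightarrow> dist x y \<le> a i" "\<And>i. 0 \<le> a i" "(\<Sum>i\<in>I. a i) \<le> e"
    using null_compact_finite_open_cover[OF K e] by metis
  obtain \<rho> :: "'a \<Rightarrow> 'a \<Rightarrow> real" where \<rho>: "\<And>x y. 0 \<le> \<rho> x y" "\<And>x y. \<rho> x y = \<rho> y x"
    "\<And>x y z. \<rho> x z \<le> \<rho> x y + \<rho> y z" "\<And>x y. \<rho> x y \<le> dist x y"
    "\<And>x y. dist x y \<le> \<rho> x y + (\<Sum>i\<in>I. a i)" "\<And>i x y. i \<in> I \<Longrightarrow> x \<in> V i \<Longrightarrow> y \<in> V i \<Longrightarrow> \<rho> x y = 0"
    using glued_pseudometric[of I V a] V(1,4,5) by metis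
  have g': "\<bar>lip0_apply g x - lip0_apply g y\<bar> \<le> dist x y" for x y
    using lip0_dist_le[of g x y] mult_right_mono[OF g, of "dist x y"] by simp
  define w where "w x = (INF y. lip0_apply g y + \<rho> x y)" for x
  have low: "lip0_apply g x - e \<le> lip0_apply g y + \<rho> x y" for x y
    using \<rho>(5)[of x y] V(6) g'[of x y] by linarith
  have bdd: "bdd_below (range (\<lambda>y. lip0_apply g y + \<rho> x y))" for x
    using low[of x] by (intro bdd_belowI[of _ "lip0_apply g x - e"]) auto
  have w_ge: "lip0_apply g x - e \<le> w x" for x unfolding w_def by (intro cINF_greatest low) auto
  have w_le: "w x \<le> lip0_apply g x" for x
  proof -
    have "w x \<le> lip0_apply g x + \<rho> x x" unfolding w_def by (rule cINF_lower[OF bdd]) simp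
    then show ?thesis using \<rho>(4)[of x x] by simp
  qed
  have w_tri: "w x \<le> w y + \<rho> x y" for x y
  proof -
    have "w x - \<rho> x y \<le> w y"
      unfolding w_def[of y]
    proof (rule cINF_greatest)
      fix z
      have "w x \<le> lip0_apply g z + \<rho> x z" unfolding w_def by (rule cINF_lower[OF bdd]) simp
      also have "\<dots> \<le> lip0_apply g z + (\<rho> x y + \<rho> y z)" using \<rho>(3) by simp
      finally show "w x - \<rho> x y \<le> lip0_apply g z + \<rho> y z" by simp
    qed simp
    then show ?thesis by simp
  qed
  have w_abs: "\<bar>w x - w y\<bar> \<le> \<rho> x y" for x y using w_tri[of x y] w_tri[of y x] \<rho>(2)[of x y] by simp
  have w_dist: "\<bar>w x - w y\<bar> \<le> dist x y" for x y using w_abs \<rho>(4) by (rule order_trans)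
  then have "1-lipschitz_on UNIV (\<lambda>x. w x - w 0)"
    by (intro lipschitz_onI) (auto simp: dist_real_def)
  then have ap: "lip0_apply (Abs_lip0 (\<lambda>x. w x - w 0)) = (\<lambda>x. w x - w 0)"
    by (intro Abs_lip0_inverse) auto
  define v where "v = Abs_lip0 (\<lambda>x. w x - w 0)"
  have v: "lip0_apply v x = w x - w 0" for x by (simp add: v_def ap)
  have "norm v \<le> 1"
    using w_dist by (intro lip0_norm_le) (auto simp: v)
  moreover have "locally_constant_on K (lip0_apply v)"
  proof -
    \<comment> \<open>A Lebesgue number of the cover provides the uniform radius.\<close>
    obtain r where r: "r > 0" "\<And>x. x \<in> K \<Longrightarrow> \<exists>G\<in>V ` I. ball x r \<subseteq> G"
      using Heine_Borel_lemma[OF K(1), of "V ` I"] V(2,3) by auto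
    have "lip0_apply v x = lip0_apply v y" if xy: "x \<in> K" "y \<in> K" "dist x y < r" for x y
    proof -
      obtain i where i: "i \<in> I" "ball x r \<subseteq> V i" using r(2)[OF xy(1)] by blast
      then have "x \<in> V i" "y \<in> V i" using xy r(1) by (auto simp: subset_iff)
      then show ?thesis using \<rho>(6)[OF i(1)] w_abs[of x y] by (simp add: v)
    qed
    with r(1) show ?thesis unfolding locally_constant_on_def by blast
  qed
  \<comment> \<open>Both \<open>w x\<close> minus the value of \<open>g\<close> at \<open>x\<close>
    and the same difference at \<open>0\<close> lie in \<open>[-e, 0]\<close>, so normalising at the
    base point does not double the error.\<close>
  moreover have "\<bar>lip0_apply v x - lip0_apply g x\<bar> \<le> e" for x
    using w_ge[of x] w_le[of x] w_ge[of 0] w_le[of 0] by (simp add: v abs_le_iff)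
  ultimately show ?thesis by blast
qed

text \<open>For \<open>0 \<in> K\<close> this is, by the McShane extension, the quotient norm of
  \<open>v\<close> modulo the functions vanishing on \<open>K\<close>.\<close>

definition lip_const_on :: "'a::{metric_space,zero} set \<Rightarrow> 'a lip0 \<Rightarrow> real" where
  "lip_const_on K v = Inf {c. c-lipschitz_on K (lip0_apply v)}"

lemma lip_const_on_le: "c-lipschitz_on K (lip0_apply v) \<Longrightarrow> lip_const_on K v \<le> c"
  unfolding lip_const_on_def
proof (rule cInf_lower)
  show "bdd_below {c. c-lipschitz_on K (lip0_apply v)}"
    by (rule bdd_belowI[of _ 0]) (simp add: lipschitz_on_nonneg)
qed simp

lemma lip_const_on_lipschitz: "(lip_const_on K v)-lipschitz_on K (lip0_apply v)"
proof (rule lipschitz_onI)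
  have ne: "{c. c-lipschitz_on K (lip0_apply v)} \<noteq> {}"
    using lipschitz_on_subset[OF lip_const_lipschitz subset_UNIV] by blast
  show "0 \<le> lip_const_on K v"
    unfolding lip_const_on_def using ne by (intro cInf_greatest) (auto dest: lipschitz_on_nonneg)
  fix x y assume xy: "x \<in> K" "y \<in> K"
  show "dist (lip0_apply v x) (lip0_apply v y) \<le> lip_const_on K v * dist x y"
  proof (cases "x = y")
    case False
    have "dist (lip0_apply v x) (lip0_apply v y) / dist x y \<le> lip_const_on K v"
      unfolding lip_const_on_def using ne
    proof (rule cInf_greatest)
      fix c assume "c \<in> {c. c-lipschitz_on K (lip0_apply v)}"
      then show "dist (lip0_apply v x) (lip0_apply v y) / dist x y \<le> c"
        using False xy by (auto simp: divide_le_eq dest: lipschitz_onD)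
    qed
    then show ?thesis using False by (simp add: divide_le_eq)
  qed simp
qed

lemma lip_const_on_nonneg: "0 \<le> lip_const_on K v"
  using lip_const_on_lipschitz by (rule lipschitz_on_nonneg)

lemma lip_const_on_le_norm: "lip_const_on K v \<le> norm v"
  unfolding norm_lip0_def
      by (rule lip_const_on_le[OF lipschitz_on_subset[OF lip_const_lipschitz subset_UNIV]])

lemma lip_const_on_dist_le:
  "x \<in> K \<Longrightarrow> y \<in> K \<Longrightarrow> \<bar>lip0_apply v x - lip0_apply v y\<bar> \<le> lip_const_on K v * dist x y"
  using lipschitz_onD[OF lip_const_on_lipschitz] by (simp add: dist_real_def)

lemma lip_const_on_leI:
  "0 \<le> c \<Longrightarrow> (\<And>x y. x \<in> K \<Longrightarrow> y \<in> K \<Longrightarrow> \<bar>lip0_apply v x - lip0_apply v y\<bar> \<le> c * dist x y) \<Longrightarrow> lip_const_on K v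
      \<le> c"
  by (rule lip_const_on_le) (auto intro!: lipschitz_onI simp: dist_real_def)

lemma lip_const_on_add: "lip_const_on K (v + w) \<le> lip_const_on K v + lip_const_on K w"
proof (rule lip_const_on_leI)
  fix x y assume xy: "x \<in> K" "y \<in> K"
  show "\<bar>lip0_apply (v + w) x - lip0_apply (v + w) y\<bar> \<le> (lip_const_on K v + lip_const_on K w) * dist x
    y"
    using lip_const_on_dist_le[OF xy, of v] lip_const_on_dist_le[OF xy, of w]
    by (simp add: distrib_right abs_le_iff)
qed (simp add: lip_const_on_nonneg)

lemma lip_const_on_scale_le: "lip_const_on K (c *\<^sub>R v) \<le> \<bar>c\<bar> * lip_const_on K v"
proof (rule lip_const_on_leI)
  fix x y assume xy: "x \<in> K" "y \<in> K"
  have "\<bar>lip0_apply (c *\<^sub>R v) x - lip0_apply (c *\<^sub>R v) y\<bar> = \<bar>c\<bar> * \<bar>lip0_apply v x - lip0_apply v y\<bar>"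
    by (simp add: abs_mult flip: right_diff_distrib)
  also have "\<dots> \<le> \<bar>c\<bar> * (lip_const_on K v * dist x y)"
    by (intro mult_left_mono lip_const_on_dist_le xy) simp
  finally show "\<bar>lip0_apply (c *\<^sub>R v) x - lip0_apply (c *\<^sub>R v) y\<bar> \<le> \<bar>c\<bar> * lip_const_on K v * dist x y"
    by simp
qed (simp add: lip_const_on_nonneg)

text \<open>A gliding hump: since each \<open>w\<close> in \<open>V\<close> is constant at small scales, adding a sufficiently small
  \<open>v\<close> increases the Lipschitz constant of \<open>w\<close> only slightly. If \<open>\<psi>\<close> were not small on such \<open>v\<close>, it
  would be unbounded.\<close>

lemma bounded_functional_small_on_small:
  fixes \<psi> :: "'a::{metric_space,zero} lip0 \<Rightarrow> real"
  assumes V: "subspace V" and lc: "\<And>v. v \<in> V \<Longrightarrow> locally_constant_on K (lip0_apply v)"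
    and \<psi>: "linear \<psi>" and bound: "\<And>v. v \<in> V \<Longrightarrow> \<bar>\<psi> v\<bar> \<le> R * lip_const_on K v" and e: "e > 0"
  shows "\<exists>\<eta>>0. \<forall>v\<in>V. lip_const_on K v \<le> 1 \<longrightarrow> (\<forall>x\<in>K. \<bar>lip0_apply v x\<bar> \<le> \<eta>) \<longrightarrow> \<bar>\<psi> v\<bar> \<le> e"
proof (rule ccontr)
  assume neg: "\<not> ?thesis"
  interpret \<psi>: linear \<psi> by (rule \<psi>)
  have ex: "\<exists>v\<in>V. lip_const_on K v \<le> 1 \<and> (\<forall>x\<in>K. \<bar>lip0_apply v x\<bar> \<le> \<eta>) \<and> e \<le> \<psi> v" if \<eta>: "\<eta> > 0" for \<eta>
  proof -
    from neg \<eta> obtain v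
      where v: "v \<in> V" "lip_const_on K v \<le> 1" "\<forall>x\<in>K. \<bar>lip0_apply v x\<bar> \<le> \<eta>" "\<bar>\<psi> v\<bar> > e"
      by (meson not_le)
    show ?thesis
    proof (cases "\<psi> v \<ge> 0")
      case True
      with v show ?thesis by (intro bexI[of _ v]) auto
    next
      case False
      have "lip_const_on K (- v) \<le> 1" using lip_const_on_scale_le[of K "-1" v] v(2) by simp
      with v False show ?thesis by (intro bexI[of _ "- v"]) (auto simp: subspace_neg[OF V] \<psi>.neg)
    qed
  qed
  have "\<exists>w\<in>V. lip_const_on K w \<le> 2 - (1/2)^n \<and> real n * e \<le> \<psi> w" for n
  proof (induction n)
    case 0
    have "lip_const_on K (0 :: 'a lip0) \<le> 0" by (rule lip_const_on_leI) auto
    then show ?case using subspace_0[OF V] by (intro bexI[of _ 0]) (auto simp: \<psi>.zero)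
  next
    case (Suc n)
    then obtain w where w: "w \<in> V" "lip_const_on K w \<le> 2 - (1/2)^n" "real n * e \<le> \<psi> w" by blast
    obtain r where r: "r > 0" "\<And>x y. x \<in> K \<Longrightarrow> y \<in> K \<Longrightarrow> dist x y < r \<Longrightarrow> lip0_apply w x = lip0_apply w y"
      using lc[OF w(1)] unfolding locally_constant_on_def by blast
    \<comment> \<open>Points at distance less than \<open>r\<close> see only \<open>v\<close>. For
      all others the extra variation is at most \<open>2 * \<eta> = r * (1/2)^(n+1)\<close>, which
      is absorbed by the increase of the constant from \<open>2 - (1/2)^n\<close> to
      \<open>2 - (1/2)^(n+1)\<close>.\<close>
    define \<eta> where "\<eta> = r * (1/2)^(n+2)"
    have "\<eta> > 0" using r(1) by (simp add: \<eta>_def)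
    from ex[OF this] obtain v
      where v: "v \<in> V" "lip_const_on K v \<le> 1" "\<And>x. x \<in> K \<Longrightarrow> \<bar>lip0_apply v x\<bar> \<le> \<eta>" "e \<le> \<psi> v" by blast
    have pow: "(1/2)^Suc n \<le> (1::real)" by (intro power_le_one) auto
    have "lip_const_on K (w + v) \<le> 2 - (1/2)^Suc n"
    proof (rule lip_const_on_leI)
      show "0 \<le> 2 - (1/2 :: real)^Suc n" using pow by simp
      fix x y assume xy: "x \<in> K" "y \<in> K"
      show "\<bar>lip0_apply (w + v) x - lip0_apply (w + v) y\<bar> \<le> (2 - (1/2)^Suc n) * dist x y"
      proof (cases "dist x y < r")
        case True
        then have "\<bar>lip0_apply (w + v) x - lip0_apply (w + v) y\<bar> = \<bar>lip0_apply v x - lip0_apply v y\<bar>"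
          using r(2)[OF xy] by simp
        also have "\<dots> \<le> lip_const_on K v * dist x y" by (rule lip_const_on_dist_le[OF xy])
        also have "\<dots> \<le> (2 - (1/2)^Suc n) * dist x y" using v(2) pow by (intro mult_right_mono) auto
        finally show ?thesis .
      next
        case False
        have "\<bar>lip0_apply (w + v) x - lip0_apply (w + v) y\<bar>
          \<le> \<bar>lip0_apply w x - lip0_apply w y\<bar> + \<bar>lip0_apply v x\<bar> + \<bar>lip0_apply v y\<bar>" by simp
        also have "\<dots> \<le> (2 - (1/2)^n) * dist x y + \<eta> + \<eta>"
          using order_trans[OF lip_const_on_dist_le[OF xy, of w] mult_right_mono[OF w(2)]] v(3) xy
          by (intro add_mono) auto
        also have "\<dots> = (2 - (1/2)^n) * dist x y + r * (1/2)^Suc n" by (simp add: \<eta>_def)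
        also have "\<dots> \<le> (2 - (1/2)^n) * dist x y + dist x y * (1/2)^Suc n"
          using False by (intro add_left_mono mult_right_mono) auto
        also have "\<dots> = (2 - (1/2)^Suc n) * dist x y" by (simp add: algebra_simps)
        finally show ?thesis .
      qed
    qed
    moreover have "real (Suc n) * e \<le> \<psi> (w + v)" using w(3) v(4) by (simp add: \<psi>.add distrib_right)
    ultimately show ?case using subspace_add[OF V w(1) v(1)] by blast
  qed
  note hump = this
  have R: "real n * e \<le> 2 * \<bar>R\<bar>" for n
  proof -
    obtain w where w: "w \<in> V" "lip_const_on K w \<le> 2 - (1/2)^n" "real n * e \<le> \<psi> w" using hump by blast
    have "\<psi> w \<le> R * lip_const_on K w" using bound[OF w(1)] by simp
    also have "\<dots> \<le> \<bar>R\<bar> * lip_const_on K w" by (intro mult_right_mono lip_const_on_nonneg) simp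
    also have "\<dots> \<le> \<bar>R\<bar> * 2"
    proof (intro mult_left_mono)
      have "0 \<le> (1/2 :: real)^n" by simp
      with w(2) show "lip_const_on K w \<le> 2" by linarith
    qed simp
    finally show ?thesis using w(3) by simp
  qed
  obtain n :: nat where "real n > 2 * \<bar>R\<bar> / e" using reals_Archimedean2 by blast
  then have "real n * e > 2 * \<bar>R\<bar>" using e by (simp add: divide_less_eq)
  with R[of n] show False by simp
qed


section \<open>Functionals on locally constant functions\<close>

abbreviation pairing :: "'a::{metric_space,zero} lipfree \<Rightarrow> 'a lip0 \<Rightarrow> real" where
  "pairing u \<equiv> blinfun_apply (lipfree_functional u)"

lemma pairing_diff_left: "pairing (u - w) v = pairing u v - pairing w v"
  by (simp add: minus_lipfree.rep_eq blinfun.diff_left)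

lemma pairing_add_left: "pairing (u + w) v = pairing u v + pairing w v"
  by (simp add: plus_lipfree.rep_eq blinfun.add_left)

lemma pairing_scale_left: "pairing (c *\<^sub>R u) v = c * pairing u v"
  by (simp add: scaleR_lipfree.rep_eq blinfun.scaleR_left)

lemma pairing_zero_left: "pairing 0 v = 0"
  by (simp add: zero_lipfree.rep_eq)

lemma lipfree_norm_leI:
  assumes le: "\<And>g. norm g \<le> 1 \<Longrightarrow> pairing u g \<le> c"
  shows "norm u \<le> c"
proof -
  have c: "0 \<le> c" using le[of 0] by simp
  show ?thesis
    unfolding norm_lipfree.rep_eq
  proof (rule norm_blinfun_bound[OF c])
    fix g :: "'a lip0"
    show "norm (pairing u g) \<le> c * norm g"
    proof (cases "g = 0")
      case False
      have "pairing u (g /\<^sub>R norm g) \<le> c" "pairing u (- (g /\<^sub>R norm g)) \<le> c"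
        using False by (auto intro!: le)
      then show ?thesis using False
        by (auto simp: blinfun.scaleR_right blinfun.minus_right field_simps abs_le_iff)
    qed simp
  qed
qed

text \<open>For \<open>0 \<in> K\<close> this is the isometric copy of the free space over
  \<open>K\<close> inside the free space of the whole type; it allows working with
  \<open>range f\<close> without turning it into a type.\<close>

definition lipfree_on :: "'a::{metric_space,zero} set \<Rightarrow> 'a lipfree set" where
  "lipfree_on K = closure (span (lipfree_delta ` K))"

lemma subspace_lipfree_on: "subspace (lipfree_on K)"
  unfolding lipfree_on_def by (intro subspace_closure subspace_span)

lemma closed_lipfree_on: "closed (lipfree_on K)"
  by (simp add: lipfree_on_def)

lemma span_delta_subset_lipfree_on: "F \<subseteq> K \<Longrightarrow> span (lipfree_delta ` F) \<subseteq> lipfree_on K"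
  unfolding lipfree_on_def by (rule order_trans[OF span_mono[OF image_mono] closure_subset])

lemma pairing_cong_on:
  assumes u: "u \<in> lipfree_on K" and eq: "\<And>x. x \<in> K \<Longrightarrow> lip0_apply v x = lip0_apply w x"
  shows "pairing u v = pairing u w"
proof -
  have "span (lipfree_delta ` K) \<subseteq> {u. pairing u v - pairing u w = 0}"
    by (rule span_minimal)
      (use eq in \<open>auto simp: subspace_def pairing_zero_left pairing_add_left pairing_scale_left\<close>)
  moreover have "closed {u. pairing u v - pairing u w = 0}"
    by (intro closed_Collect_eq continuous_intros linear_continuous_on bounded_linear_lipfree_apply)
  ultimately have "lipfree_on K \<subseteq> {u. pairing u v - pairing u w = 0}"
    unfolding lipfree_on_def by (rule closure_minimal)
  with u show ?thesis by auto
qed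

text \<open>On \<open>lipfree_on K\<close> only the restriction of \<open>v\<close> to
  \<open>K\<close> matters, and it has a McShane extension with no larger Lipschitz
  constant.\<close>

lemma pairing_le_on:
  assumes u: "u \<in> lipfree_on K" and K: "0 \<in> K"
  shows "\<bar>pairing u v\<bar> \<le> lip_const_on K v * norm u"
proof -
  from mcshane_extension[OF lip_const_on_lipschitz] obtain h where
    h: "(lip_const_on K v)-lipschitz_on UNIV h" "\<And>x. x \<in> K \<Longrightarrow> h x = lip0_apply v x" by blast
  obtain g where g: "lip0_apply g = h" "norm g \<le> lip_const_on K v"
    using lip0_of_lipschitz[OF h(1)] h(2)[OF K] by auto
  have "pairing u v = pairing u g" using h(2) g(1) by (intro pairing_cong_on[OF u]) simp
  then show ?thesis
    using lipfree_functional_le[of u g] mult_right_mono[OF g(2) norm_ge_zero[of u]]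
        by (simp add: mult.commute)
qed

section \<open>Countable norming sets\<close>

lemma compact_countable_dense:
  fixes K :: "'a::metric_space set"
  assumes "compact K"
  shows "\<exists>D\<subseteq>K. countable D \<and> K \<subseteq> closure D"
proof -
  have "\<forall>\<epsilon>>0. \<exists>k. finite k \<and> k \<subseteq> K \<and> K \<subseteq> (\<Union>x\<in>k. ball x \<epsilon>)"
    using assms by (intro seq_compact_imp_totally_bounded compact_imp_seq_compact)
  then have "\<exists>k. finite k \<and> k \<subseteq> K \<and> K \<subseteq> (\<Union>x\<in>k. ball x (1 / real (Suc n)))" for n by simp
  then obtain k where k: "\<And>n. finite (k n)" "\<And>n. k n \<subseteq> K" "\<And>n. K \<subseteq> (\<Union>x\<in>k n. ball x (1 / real (Suc
    n)))"
    by metis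
  have "K \<subseteq> closure (\<Union>n. k n)"
  proof
    fix x assume x: "x \<in> K"
    show "x \<in> closure (\<Union>n. k n)"
      unfolding closure_approachable
    proof (intro allI impI)
      fix e :: real assume "e > 0"
      then obtain n where n: "1 / real (Suc n) < e" using nat_approx_posE by blast
      obtain y where y: "y \<in> k n" "dist y x < 1 / real (Suc n)" using k(3)[of n] x by auto
      have "dist y x < e" using y(2) n by (rule less_trans)
      with y(1) show "\<exists>y\<in>(\<Union>n. k n). dist y x < e" by blast
    qed
  qed
  moreover have "countable (\<Union>n. k n)" using k(1)
    by (intro countable_UN) (auto intro: countable_finite)
  ultimately show ?thesis using k(2) by (intro exI[of _ "\<Union>n. k n"]) auto
qed

lemma lipfree_on_dense:
  assumes D: "K \<subseteq> closure D"
  shows "lipfree_on K \<subseteq> closure (span (lipfree_delta ` D))"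
proof -
  have "lipfree_delta ` K \<subseteq> closure (span (lipfree_delta ` D))"
  proof
    fix u assume "u \<in> lipfree_delta ` K"
    then obtain x where x: "x \<in> K" "u = lipfree_delta x" by blast
    show "u \<in> closure (span (lipfree_delta ` D))"
      unfolding closure_approachable
    proof (intro allI impI)
      fix e :: real assume "e > 0"
      moreover have "x \<in> closure D" using D x(1) by blast
      ultimately obtain y where y: "y \<in> D" "dist y x < e" unfolding closure_approachable by blast
      then have "dist (lipfree_delta y) u < e" using dist_lipfree_delta_le[of y x] x(2) by simp
      with y(1) show "\<exists>w\<in>span (lipfree_delta ` D). dist w u < e" by (auto intro: span_base)
    qed
  qed
  then have "span (lipfree_delta ` K) \<subseteq> closure (span (lipfree_delta ` D))"
    by (intro span_minimal subspace_closure subspace_span)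
  then show ?thesis unfolding lipfree_on_def by (intro closure_minimal) auto
qed

text \<open>Elements of the span are continuous for pointwise convergence: finitely many evaluations
  enter, and \<open>n\<close> bounds their indices.\<close>

lemma pairing_span_continuous:
  fixes x :: "nat \<Rightarrow> 'a::{metric_space,zero}"
  assumes "u \<in> span (lipfree_delta ` range x)"
  shows "\<exists>(n::nat) C. 0 \<le> C \<and> (\<forall>v w d. (\<forall>i\<le>n. \<bar>lip0_apply v (x i) - lip0_apply w (x i)\<bar> \<le> d) \<longrightarrow>
    \<bar>pairing u v - pairing u w\<bar> \<le> C * d)"
  using assms
proof (induction rule: span_induct_alt)
  case base
  show ?case by (intro exI[of _ 0]) (simp add: pairing_zero_left)
next
  case (step c z y)
  then obtain j where j: "z = lipfree_delta (x j)" by blast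
  from step obtain n C
    where C: "0 \<le> C" "\<And>v w d. (\<forall>i\<le>n::nat. \<bar>lip0_apply v (x i) - lip0_apply w (x i)\<bar> \<le> d) \<Longrightarrow>
    \<bar>pairing y v - pairing y w\<bar> \<le> C * d" by blast
  have "\<bar>pairing (c *\<^sub>R z + y) v - pairing (c *\<^sub>R z + y) w\<bar> \<le> (\<bar>c\<bar> + C) * d"
    if d: "\<forall>i\<le>max n j. \<bar>lip0_apply v (x i) - lip0_apply w (x i)\<bar> \<le> d" for v w d
  proof -
    have "pairing (c *\<^sub>R z + y) v - pairing (c *\<^sub>R z + y) w
      = c * (lip0_apply v (x j) - lip0_apply w (x j)) + (pairing y v - pairing y w)"
      by (simp add: pairing_add_left pairing_scale_left j algebra_simps)
    also have "\<bar>\<dots>\<bar> \<le> \<bar>c\<bar> * \<bar>lip0_apply v (x j) - lip0_apply w (x j)\<bar> + \<bar>pairing y v - pairing y w\<bar>"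
      by (metis abs_mult abs_triangle_ineq)
    also have "\<dots> \<le> \<bar>c\<bar> * d + C * d" using d by (intro add_mono mult_left_mono C(2)) auto
    finally show ?thesis by (simp add: distrib_right)
  qed
  with C(1) show ?case by (intro exI[of _ "max n j"] exI[of _ "\<bar>c\<bar> + C"]) auto
qed

text \<open>Pointwise convergence on a countable dense subset of \<open>K\<close> is second
  countable, so the locally constant functions in the unit ball have a countable dense subset for
  it. It approximates the pairings with the span, which see only finitely many points, and the span
  is dense.\<close>

lemma countable_norming_set:
  fixes K :: "'a::{metric_space,zero} set"
  assumes K: "compact K" "hausdorff1 K = 0" "0 \<in> K"
  shows "\<exists>E :: 'a lip0 set. countable E \<and> (\<forall>e\<in>E. norm e \<le> 1 \<and> locally_constant_on K (lip0_apply e)) \<and>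
    (\<forall>u\<in>lipfree_on K. \<forall>c. (\<forall>e\<in>E. pairing u e \<le> c) \<longrightarrow> norm u \<le> c)"
proof -
  obtain D where D: "D \<subseteq> K" "countable D" "K \<subseteq> closure D" using compact_countable_dense[OF K(1)]
    by blast
  have "D \<noteq> {}" using D(3) K(3) by auto
  define x where "x = from_nat_into D"
  have x: "range x = D" unfolding x_def using \<open>D \<noteq> {}\<close> D(2) by (rule range_from_nat_into)
  define S :: "'a lip0 set" where "S = {v. norm v \<le> 1 \<and> locally_constant_on K (lip0_apply v)}"
  \<comment> \<open>Functions become points of the product space
    \<open>nat \<Rightarrow> real\<close>, all of whose subsets are separable.\<close>
  define val where "val v i = lip0_apply v (x i)" for v i
  obtain T where T: "countable T" "T \<subseteq> val ` S" "val ` S \<subseteq> closure T"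
    by (rule separable[of "val ` S"])
  have "\<forall>t\<in>T. \<exists>e\<in>S. val e = t" using T(2) by blast
  then obtain rep where rep: "\<And>t. t \<in> T \<Longrightarrow> rep t \<in> S" "\<And>t. t \<in> T \<Longrightarrow> val (rep t) = t" by metis
  define E where "E = rep ` T"
  have near: "\<exists>e\<in>E. \<forall>i\<le>n. \<bar>lip0_apply e (x i) - lip0_apply v (x i)\<bar> \<le> d" if v: "v \<in> S" and d: "d > 0"
    for v d and n :: nat
  proof -
    let ?O = "{z :: nat \<Rightarrow> real. \<forall>i\<in>{..n}. z i \<in> ball (val v i) d}"
    have "open ?O" using product_topology_basis'[of "{..n}" "\<lambda>i. ball (val v i) d" "\<lambda>i. i"] by simp
    moreover have "val v \<in> ?O \<inter> closure T" using d v T(3) by auto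
    ultimately obtain t where t: "t \<in> T" "t \<in> ?O" using open_Int_closure_eq_empty[of ?O T] by blast
    have "\<bar>lip0_apply (rep t) (x i) - lip0_apply v (x i)\<bar> \<le> d" if "i \<le> n" for i
    proof -
      have "dist (val v i) (t i) < d" using t(2) that by auto
      moreover have "t i = val (rep t) i" using rep(2)[OF t(1)] by simp
      ultimately show ?thesis by (simp add: val_def dist_real_def abs_minus_commute)
    qed
    with t(1) show ?thesis unfolding E_def by blast
  qed
  have norming: "norm u \<le> c" if u: "u \<in> lipfree_on K" and c: "\<And>e. e \<in> E \<Longrightarrow> pairing u e \<le> c" for u c
  proof (rule lipfree_norm_leI)
    fix g :: "'a lip0" assume g: "norm g \<le> 1"
    show "pairing u g \<le> c"
    proof (rule field_le_epsilon)
      fix \<epsilon> :: real assume "\<epsilon> > 0"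
      \<comment> \<open>Four errors arise: from \<open>u\<close> to \<open>u'\<close> at
        \<open>g\<close>, from \<open>g\<close> to \<open>v\<close>, from \<open>v\<close> to
        \<open>e\<close>, and back from \<open>u'\<close> to \<open>u\<close> at
        \<open>e\<close>.\<close>
      define d where "d = \<epsilon> / 4"
      have d: "d > 0" using \<open>\<epsilon> > 0\<close> by (simp add: d_def)
      have "u \<in> closure (span (lipfree_delta ` range x))" using lipfree_on_dense[OF D(3)] u x by auto
      then obtain u' where u': "u' \<in> span (lipfree_delta ` range x)" "dist u' u < d"
        using d unfolding closure_approachable by blast
      obtain n C where C: "0 \<le> C" "\<And>v w d. (\<forall>i\<le>n::nat. \<bar>lip0_apply v (x i) - lip0_apply w (x i)\<bar> \<le> d)
        \<Longrightarrow>
        \<bar>pairing u' v - pairing u' w\<bar> \<le> C * d" using pairing_span_continuous[OF u'(1)] by blast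
      have dC: "d / (C + 1) > 0" using d C(1) by simp
      obtain v where v: "v \<in> S" "\<And>y. \<bar>lip0_apply v y - lip0_apply g y\<bar> \<le> d / (C + 1)"
        using lip0_approx_locally_constant[OF K(1,2) g dC] by (auto simp: S_def)
      obtain e where e: "e \<in> E" "\<And>i. i \<le> n \<Longrightarrow> \<bar>lip0_apply e (x i) - lip0_apply v (x i)\<bar> \<le> d / (C + 1)"
        using near[OF v(1) dC] by blast
      have Cd: "C * (d / (C + 1)) \<le> d" using C(1) d by (simp add: field_simps)
      have "\<bar>pairing u' v - pairing u' g\<bar> \<le> d" "\<bar>pairing u' e - pairing u' v\<bar> \<le> d"
        using C(2)[of v g "d / (C + 1)"] C(2)[of e v "d / (C + 1)"] v(2) e(2) Cd
            by (meson order_trans)+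
      moreover have "\<bar>pairing (u' - u) w\<bar> \<le> d" if "norm w \<le> 1" for w
        using lipfree_functional_le[of "u' - u" w] u'(2) that mult_left_mono[OF that norm_ge_zero[of
            "u' - u"]]
        by (simp add: dist_norm)
      from this[OF g] this[of e] have "\<bar>pairing u' g - pairing u g\<bar> \<le> d" "\<bar>pairing u' e - pairing u e\<bar>
        \<le> d"
        using e(1) rep(1) by (auto simp: pairing_diff_left E_def S_def)
      ultimately show "pairing u g \<le> c + \<epsilon>" using c[OF e(1)] unfolding d_def abs_le_iff by linarith
    qed
  qed
  have "countable E" using T(1) by (simp add: E_def)
  moreover have "\<forall>e\<in>E. norm e \<le> 1 \<and> locally_constant_on K (lip0_apply e)"
    using rep(1) by (auto simp: E_def S_def)
  ultimately show ?thesis using norming by (intro exI[of _ E] conjI) simp_all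
qed

text \<open>A one-dimensional Hahn-Banach step: \<open>a\<close> separates the values
  \<open>\<psi> v - p v\<close> from the values \<open>\<psi> w + p w\<close> on the part of
  \<open>V\<close> where \<open>l\<close> equals \<open>1\<close>.\<close>

lemma dominated_mod_functional:
  fixes \<psi> l p :: "'v::real_vector \<Rightarrow> real"
  assumes V: "subspace V" and \<psi>: "linear \<psi>" and l: "linear l"
    and p_add: "\<And>v w. p (v + w) \<le> p v + p w" and p_scale: "\<And>c v. p (c *\<^sub>R v) \<le> \<bar>c\<bar> * p v"
    and dom: "\<And>v. v \<in> V \<Longrightarrow> l v = 0 \<Longrightarrow> \<bar>\<psi> v\<bar> \<le> p v"
  shows "\<exists>a. \<forall>v\<in>V. \<bar>\<psi> v - a * l v\<bar> \<le> p v"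
proof (cases "\<forall>v\<in>V. l v = 0")
  case True
  then show ?thesis using dom by (intro exI[of _ 0]) auto
next
  case False
  interpret \<psi>: linear \<psi> by (rule \<psi>)
  interpret l: linear l by (rule l)
  from False obtain v0 where v0: "v0 \<in> V" "l v0 \<noteq> 0" by blast
  define w0 where "w0 = v0 /\<^sub>R l v0"
  have w0: "w0 \<in> V" "l w0 = 1" using v0 subspace_scale[OF V] by (auto simp: w0_def l.scaleR)
  have cross: "\<psi> v - p v \<le> \<psi> w + p w" if "v \<in> V" "l v = 1" "w \<in> V" "l w = 1" for v w
  proof -
    have "\<bar>\<psi> (v - w)\<bar> \<le> p (v - w)" using that by (intro dom subspace_diff[OF V]) (auto simp: l.diff)
    moreover have "p (v - w) \<le> p v + p w"
      using p_add[of v "(-1) *\<^sub>R w"] p_scale[of "-1" w] by simp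
    ultimately show ?thesis by (simp add: \<psi>.diff abs_le_iff)
  qed
  define A where "A = {\<psi> v - p v |v. v \<in> V \<and> l v = 1}"
  define a where "a = Sup A"
  have A: "A \<noteq> {}" "bdd_above A"
    using w0 cross by (auto simp: A_def intro!: bdd_aboveI[of _ "\<psi> w0 + p w0"])
  have unit: "\<bar>\<psi> v - a\<bar> \<le> p v" if v: "v \<in> V" "l v = 1" for v
  proof -
    have "\<psi> v - p v \<le> a" unfolding a_def using A(2) v by (intro cSup_upper) (auto simp: A_def)
    moreover have "a \<le> \<psi> v + p v" unfolding a_def using A(1) cross v
      by (intro cSup_least) (auto simp: A_def)
    ultimately show ?thesis by (simp add: abs_le_iff)
  qed
  have "\<bar>\<psi> v - a * l v\<bar> \<le> p v" if v: "v \<in> V" for v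
  proof (cases "l v = 0")
    case True
    then show ?thesis using dom[OF v] by simp
  next
    case False
    have "\<bar>\<psi> (v /\<^sub>R l v) - a\<bar> \<le> p (v /\<^sub>R l v)"
      using v False by (intro unit subspace_scale[OF V]) (auto simp: l.scaleR)
    also have "\<dots> \<le> \<bar>inverse (l v)\<bar> * p v" by (rule p_scale)
    finally have "\<bar>l v\<bar> * \<bar>\<psi> (v /\<^sub>R l v) - a\<bar> \<le> \<bar>l v\<bar> * (\<bar>inverse (l v)\<bar> * p v)"
      by (rule mult_left_mono) simp
    also have "\<bar>l v\<bar> * (\<bar>inverse (l v)\<bar> * p v) = p v" using False by simp
    also have "\<bar>l v\<bar> * \<bar>\<psi> (v /\<^sub>R l v) - a\<bar> = \<bar>l v * (\<psi> (v /\<^sub>R l v) - a)\<bar>" by (simp add: abs_mult)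
    also have "l v * (\<psi> (v /\<^sub>R l v) - a) = \<psi> v - a * l v" using False
      by (simp add: \<psi>.scaleR right_diff_distrib)
    finally show ?thesis .
  qed
  then show ?thesis by blast
qed

text \<open>Induction on \<open>F\<close> with \<open>V\<close> arbitrary: the induction hypothesis
  is applied to the kernel of the new evaluation, and \<open>dominated_mod_functional\<close>
  supplies the coefficient of that evaluation.\<close>

lemma dominated_mod_deltas:
  fixes \<psi> p :: "'a::{metric_space,zero} lip0 \<Rightarrow> real"
  assumes F: "finite F" and V: "subspace V" and \<psi>: "linear \<psi>"
    and p_add: "\<And>v w. p (v + w) \<le> p v + p w" and p_scale: "\<And>c v. p (c *\<^sub>R v) \<le> \<bar>c\<bar> * p v"
    and dom: "\<And>v. v \<in> V \<Longrightarrow> (\<forall>x\<in>F. lip0_apply v x = 0) \<Longrightarrow> \<bar>\<psi> v\<bar> \<le> p v"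
  shows "\<exists>u\<in>span (lipfree_delta ` F). \<forall>v\<in>V. \<bar>\<psi> v - pairing u v\<bar> \<le> p v"
  using F V dom
proof (induction F arbitrary: V)
  case empty
  then show ?case by (intro bexI[of _ 0]) (auto simp: pairing_zero_left span_0)
next
  case (insert x F)
  interpret \<psi>: linear \<psi> by (rule \<psi>)
  have lx: "linear (\<lambda>v. lip0_apply v x)" by (rule linearI) auto
  define V' where "V' = {v \<in> V. lip0_apply v x = 0}"
  have "subspace V'" using insert.prems(1) by (auto simp: V'_def subspace_def)
  then obtain u where u: "u \<in> span (lipfree_delta ` F)" "\<And>v. v \<in> V' \<Longrightarrow> \<bar>\<psi> v - pairing u v\<bar> \<le> p v"
    using insert.IH[of V'] insert.prems(2) by (auto simp: V'_def)
  have "linear (\<lambda>v. \<psi> v - pairing u v)"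
    by (rule linearI) (auto simp: \<psi>.add \<psi>.scaleR blinfun.add_right blinfun.scaleR_right
        right_diff_distrib)
  from dominated_mod_functional[OF insert.prems(1) this lx p_add p_scale]
  obtain a where a: "\<And>v. v \<in> V \<Longrightarrow> \<bar>\<psi> v - pairing u v - a * lip0_apply v x\<bar> \<le> p v"
    using u(2) by (auto simp: V'_def)
  have "span (lipfree_delta ` F) \<subseteq> span (lipfree_delta ` insert x F)" by (intro span_mono) auto
  then have "u + a *\<^sub>R lipfree_delta x \<in> span (lipfree_delta ` insert x F)"
    using u(1) by (intro span_add span_scale) (auto intro: span_base)
  then show ?case
    using a by (intro bexI[of _ "u + a *\<^sub>R lipfree_delta x"]) (auto simp: pairing_add_left
        pairing_scale_left diff_diff_eq)
qed

text \<open>The free space over \<open>K\<close> acts as the dual of \<open>V\<close>. The gliding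
  hump bounds \<open>\<psi>\<close> on functions vanishing on a fine net, so \<open>\<psi>\<close>
  is within \<open>\<epsilon>\<close> of a combination of evaluations; the norming set makes such
  combinations a Cauchy sequence.\<close>

lemma functional_represented:
  fixes \<psi> :: "'a::{metric_space,zero} lip0 \<Rightarrow> real"
  assumes K: "compact K" and V: "subspace V" and lc: "\<And>v. v \<in> V
      \<Longrightarrow> locally_constant_on K (lip0_apply v)"
    and E: "E \<subseteq> V" "\<And>e. e \<in> E \<Longrightarrow> norm e \<le> 1"
    and norming: "\<And>u c. u \<in> lipfree_on K \<Longrightarrow> (\<And>e. e \<in> E \<Longrightarrow> pairing u e \<le> c) \<Longrightarrow> norm u \<le> c"
    and \<psi>: "linear \<psi>" and bound: "\<And>v. v \<in> V \<Longrightarrow> \<bar>\<psi> v\<bar> \<le> R * lip_const_on K v"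
  shows "\<exists>u\<in>lipfree_on K. \<forall>v\<in>V. pairing u v = \<psi> v"
proof -
  interpret \<psi>: linear \<psi> by (rule \<psi>)
  have approx: "\<exists>u\<in>span (lipfree_delta ` K). \<forall>v\<in>V. \<bar>\<psi> v - pairing u v\<bar> \<le> \<epsilon> * lip_const_on K v"
    if \<epsilon>: "\<epsilon> > 0" for \<epsilon>
  proof -
    obtain \<eta> where \<eta>: "\<eta> > 0" "\<And>v. v \<in> V \<Longrightarrow> lip_const_on K v \<le> 1 \<Longrightarrow> (\<forall>x\<in>K. \<bar>lip0_apply v x\<bar> \<le> \<eta>) \<Longrightarrow> \<bar>\<psi> v\<bar>
      \<le> \<epsilon>"
      using bounded_functional_small_on_small[OF V lc \<psi> bound \<epsilon>] by blast
    \<comment> \<open>\<open>F\<close> is an \<open>\<eta>\<close>-net: a function vanishing on it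
      with Lipschitz constant at most \<open>1\<close> on \<open>K\<close> is bounded by
      \<open>\<eta>\<close> on \<open>K\<close>.\<close>
    from seq_compact_imp_totally_bounded[OF compact_imp_seq_compact[OF K], rule_format, OF \<eta>(1)]
    obtain F where F: "finite F" "F \<subseteq> K" "K \<subseteq> (\<Union>x\<in>F. ball x \<eta>)" by auto
    have dom: "\<bar>\<psi> v\<bar> \<le> \<epsilon> * lip_const_on K v" if v: "v \<in> V" and v0: "\<forall>x\<in>F. lip0_apply v x = 0" for v
    proof (cases "lip_const_on K v = 0")
      case True
      then show ?thesis using bound[OF v] by simp
    next
      case False
      then have pos: "lip_const_on K v > 0" using lip_const_on_nonneg[of K v] by simp
      define w where "w = v /\<^sub>R lip_const_on K v"
      have wV: "w \<in> V" unfolding w_def by (rule subspace_scale[OF V v])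
      have w1: "lip_const_on K w \<le> 1"
        using lip_const_on_scale_le[of K "inverse (lip_const_on K v)" v] pos by (simp add: w_def)
      have "\<bar>lip0_apply w x\<bar> \<le> \<eta>" if x: "x \<in> K" for x
      proof -
        obtain y where y: "y \<in> F" "dist y x < \<eta>" using F(3) x by auto
        have "\<bar>lip0_apply w x - lip0_apply w y\<bar> \<le> lip_const_on K w * dist x y"
          using x y F(2) by (intro lip_const_on_dist_le) auto
        also have "\<dots> \<le> 1 * dist x y" using w1 by (intro mult_right_mono) auto
        finally show ?thesis using y v0 by (simp add: w_def dist_commute)
      qed
      then have "\<bar>\<psi> w\<bar> \<le> \<epsilon>" using \<eta>(2)[OF wV w1] by blast
      then show ?thesis using pos by (simp add: w_def \<psi>.scaleR abs_mult field_simps)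
    qed
    have "\<exists>u\<in>span (lipfree_delta ` F). \<forall>v\<in>V. \<bar>\<psi> v - pairing u v\<bar> \<le> \<epsilon> * lip_const_on K v"
    proof (rule dominated_mod_deltas[OF F(1) V \<psi> _ _ dom])
      show "\<epsilon> * lip_const_on K (v + w) \<le> \<epsilon> * lip_const_on K v + \<epsilon> * lip_const_on K w" for v w
        using mult_left_mono[OF lip_const_on_add[of K v w], of \<epsilon>] \<epsilon> by (simp add: distrib_left)
      show "\<epsilon> * lip_const_on K (c *\<^sub>R v) \<le> \<bar>c\<bar> * (\<epsilon> * lip_const_on K v)" for c v
        using mult_left_mono[OF lip_const_on_scale_le[of K c v], of \<epsilon>] \<epsilon>
            by (simp add: mult.left_commute)
    qed
    moreover have "span (lipfree_delta ` F) \<subseteq> span (lipfree_delta ` K)" using F(2)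
      by (intro span_mono) auto
    ultimately show ?thesis by blast
  qed
  have "\<exists>u\<in>span (lipfree_delta ` K). \<forall>v\<in>V. \<bar>\<psi> v - pairing u v\<bar> \<le> 1 / real (Suc n) * lip_const_on K v"
    for n
    by (intro approx) simp
  then obtain u where u: "\<And>n. u n \<in> span (lipfree_delta ` K)"
    "\<And>n v. v \<in> V \<Longrightarrow> \<bar>\<psi> v - pairing (u n) v\<bar> \<le> 1 / real (Suc n) * lip_const_on K v" by metis
  have uK: "u n \<in> lipfree_on K" for n using u(1) span_delta_subset_lipfree_on[of K K] by blast
  have diff: "norm (u m - u n) \<le> 1 / real (Suc m) + 1 / real (Suc n)" for m n
  proof (rule norming)
    show "u m - u n \<in> lipfree_on K" by (intro subspace_diff[OF subspace_lipfree_on] uK)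
    fix e assume e: "e \<in> E"
    have le: "lip_const_on K e \<le> 1" using lip_const_on_le_norm[of K e] E(2)[OF e] by simp
    have "\<bar>\<psi> e - pairing (u n) e\<bar> \<le> 1 / real (Suc n)" for n
      using order_trans[OF u(2)[of e n] mult_left_mono[OF le, of "1 / real (Suc n)"]] e E(1) by auto
    from this[of m] this[of n] show "pairing (u m - u n) e \<le> 1 / real (Suc m) + 1 / real (Suc n)"
      by (simp add: pairing_diff_left abs_le_iff)
  qed
  have "Cauchy u"
  proof (rule metric_CauchyI)
    fix e :: real assume "e > 0"
    then obtain N where N: "1 / real (Suc N) < e / 2" using nat_approx_posE[of "e / 2"] by auto
    have small: "1 / real (Suc n) \<le> 1 / real (Suc N)" if "n \<ge> N" for n using that
      by (simp add: frac_le)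
    show "\<exists>N. \<forall>m\<ge>N. \<forall>n\<ge>N. dist (u m) (u n) < e"
    proof (intro exI allI impI)
      fix m n assume "N \<le> m" "N \<le> n"
      then show "dist (u m) (u n) < e"
        using diff[of m n] small[of m] small[of n] N by (simp add: dist_norm)
    qed
  qed
  then obtain l where l: "u \<longlonglongrightarrow> l" using Cauchy_convergent convergent_def by blast
  have "l \<in> lipfree_on K" by (rule closed_sequentially[OF closed_lipfree_on _ l]) (rule uK)
  moreover have "pairing l v = \<psi> v" if v: "v \<in> V" for v
  proof -
    have "(\<lambda>n. pairing (u n) v) \<longlonglongrightarrow> pairing l v"
      by (rule bounded_linear.tendsto[OF bounded_linear_lipfree_apply l])
    moreover have "(\<lambda>n. pairing (u n) v) \<longlonglongrightarrow> \<psi> v"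
    proof -
      have "(\<lambda>n. 1 / real (Suc n) * lip_const_on K v) \<longlonglongrightarrow> 0 * lip_const_on K v"
        using LIMSEQ_Suc[OF lim_1_over_n] by (intro tendsto_mult tendsto_const) simp
      then have "(\<lambda>n. 1 / real (Suc n) * lip_const_on K v) \<longlonglongrightarrow> 0" by simp
      then have "(\<lambda>n. pairing (u n) v - \<psi> v) \<longlonglongrightarrow> 0"
        by (rule Lim_null_comparison[rotated])
          (use u(2)[OF v] in \<open>intro always_eventually allI, simp add: abs_minus_commute\<close>)
      then show ?thesis by (rule LIM_zero_cancel)
    qed
    ultimately show ?thesis by (rule LIMSEQ_unique)
  qed
  ultimately show ?thesis by blast
qed


section \<open>Densities of vector measures and the equivalence\<close>

text \<open>Adding \<open>L\<close> times the probability makes the measure nonnegative, so that the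
  Radon-Nikodym theorem applies; the density is then shifted back by \<open>L\<close>.\<close>

lemma bounded_signed_measure_density:
  fixes \<mu> :: "'w set \<Rightarrow> real"
  assumes P: "prob_space P"
    and \<mu>: "\<And>A. range A \<subseteq> sets P \<Longrightarrow> disjoint_family A \<Longrightarrow> (\<lambda>i. \<mu> (A i)) sums \<mu> (\<Union>i::nat. A i)"
    and L: "\<And>B. B \<in> sets P \<Longrightarrow> \<bar>\<mu> B\<bar> \<le> L * measure P B"
  shows "\<exists>h. integrable P h \<and> (\<forall>B\<in>sets P. (\<integral>\<omega>. indicator B \<omega> * h \<omega> \<partial>P) = \<mu> B)"
proof -
  interpret prob_space P by fact
  have "0 \<le> L * prob (space P)" using L[OF sets.top] by (rule order_trans[rotated]) simp
  then have L0: "0 \<le> L" by (simp add: prob_space)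
  define \<nu> where "\<nu> B = \<mu> B + L * prob B" for B
  have \<nu>0: "0 \<le> \<nu> B" "\<nu> B \<le> 2 * L * prob B" if "B \<in> sets P" for B
    using L[OF that] by (auto simp: \<nu>_def abs_le_iff)
  define N where "N = measure_of (space P) (sets P) (\<lambda>B. ennreal (\<nu> B))"
  have setsN: "sets N = sets P" by (simp add: N_def)
  have eN: "emeasure N B = ennreal (\<nu> B)" if "B \<in> sets P" for B
    unfolding N_def
  proof (rule emeasure_measure_of_sigma)
    show "sigma_algebra (space P) (sets P)" by (rule sets.sigma_algebra_axioms)
    show "positive (sets P) (\<lambda>B. ennreal (\<nu> B))"
      using \<nu>0(2)[of "{}"] by (auto simp: positive_def ennreal_neg)
    show "countably_additive (sets P) (\<lambda>B. ennreal (\<nu> B))"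
    proof (rule countably_additiveI)
      fix A :: "nat \<Rightarrow> 'w set" assume A: "range A \<subseteq> sets P" "disjoint_family A"
      have "(\<lambda>i. \<mu> (A i) + L * prob (A i)) sums (\<mu> (\<Union>i. A i) + L * prob (\<Union>i. A i))"
        by (intro sums_add \<mu>[OF A] sums_mult finite_measure_UNION[OF A])
      then have "(\<lambda>i. \<nu> (A i)) sums \<nu> (\<Union>i. A i)" by (simp add: \<nu>_def)
      then show "(\<Sum>i. ennreal (\<nu> (A i))) = ennreal (\<nu> (\<Union>i. A i))"
        using A(1) by (intro suminf_ennreal_eq \<nu>0(1)) auto
    qed
  qed (rule that)
  have "absolutely_continuous P N"
    unfolding absolutely_continuous_def
  proof
    fix B assume B: "B \<in> null_sets P"
    then have "B \<in> sets P" "prob B = 0" by (auto simp: measure_def null_sets_def)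
    with \<nu>0[of B] have "\<nu> B = 0" by simp
    then show "B \<in> null_sets N" using \<open>B \<in> sets P\<close> by (auto simp: null_sets_def setsN eN)
  qed
  from Radon_Nikodym[OF this setsN] obtain f where f: "f \<in> borel_measurable P" "density P f = N"
    by blast
  have fB: "(\<integral>\<^sup>+\<omega>. f \<omega> * indicator B \<omega> \<partial>P) = ennreal (\<nu> B)" if "B \<in> sets P" for B
    using emeasure_density[OF f(1) that] f(2) eN[OF that] by simp
  have tot: "(\<integral>\<^sup>+\<omega>. f \<omega> \<partial>P) = ennreal (\<nu> (space P))"
    using fB[OF sets.top] by (simp cong: nn_integral_cong_simp)
  then have "AE \<omega> in P. f \<omega> \<noteq> \<infinity>" using f(1) by (intro nn_integral_PInf_AE) auto
  then have fe: "AE \<omega> in P. ennreal (enn2real (f \<omega>)) = f \<omega>"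
    by eventually_elim (simp add: top.not_eq_extremum)
  define g where "g \<omega> = enn2real (f \<omega>)" for \<omega>
  have g0: "0 \<le> g \<omega>" for \<omega> by (simp add: g_def)
  have gm: "g \<in> borel_measurable P" unfolding g_def using f(1) by measurable
  have g_int: "integrable P g"
  proof (rule integrableI_nonneg[OF gm])
    have "(\<integral>\<^sup>+\<omega>. ennreal (g \<omega>) \<partial>P) = (\<integral>\<^sup>+\<omega>. f \<omega> \<partial>P)"
      using fe by (intro nn_integral_cong_AE) (auto simp: g_def)
    then show "(\<integral>\<^sup>+\<omega>. ennreal (g \<omega>) \<partial>P) < \<infinity>" by (simp add: tot)
  qed (simp add: g_def)
  have g_B: "(\<integral>\<omega>. indicator B \<omega> * g \<omega> \<partial>P) = \<nu> B" if B: "B \<in> sets P" for B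
  proof -
    have "(\<integral>\<^sup>+\<omega>. ennreal (indicator B \<omega> * g \<omega>) \<partial>P) = (\<integral>\<^sup>+\<omega>. f \<omega> * indicator B \<omega> \<partial>P)"
      using fe by (intro nn_integral_cong_AE, eventually_elim) (auto simp: g_def split:
          split_indicator)
    also have "\<dots> = ennreal (\<nu> B)" by (rule fB[OF B])
    finally show ?thesis
      using borel_measurable_times[OF borel_measurable_indicator[OF B] gm] \<nu>0(1)[OF B]
      by (subst integral_eq_nn_integral) (auto simp: g0)
  qed
  have "(\<integral>\<omega>. indicator B \<omega> * (g \<omega> - L) \<partial>P) = \<mu> B" if B: "B \<in> sets P" for B
  proof -
    have "(\<integral>\<omega>. indicator B \<omega> * (g \<omega> - L) \<partial>P) = (\<integral>\<omega>. g \<omega> * indicator B \<omega> - L * indicator B \<omega> \<partial>P)"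
      by (simp add: algebra_simps)
    also have "\<dots> = (\<integral>\<omega>. g \<omega> * indicator B \<omega> \<partial>P) - (\<integral>\<omega>. L * indicator B \<omega> \<partial>P)"
      using B g_int by (intro Bochner_Integration.integral_diff integrable_real_mult_indicator
          integrable_mult_right integrable_real_indicator) (auto simp: less_top[symmetric])
    also have "(\<integral>\<omega>. g \<omega> * indicator B \<omega> \<partial>P) = \<nu> B" using g_B[OF B] by (simp add: mult.commute)
    also have "(\<integral>\<omega>. L * indicator B \<omega> \<partial>P) = L * prob B" using B by simp
    finally show ?thesis by (simp add: \<nu>_def)
  qed
  moreover have "integrable P (\<lambda>\<omega>. g \<omega> - L)" using g_int by simp
  ultimately show ?thesis by (intro exI[of _ "\<lambda>\<omega>. g \<omega> - L"]) simp
qed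

lemma AE_le_if_integrals_le:
  fixes g :: "'w \<Rightarrow> real"
  assumes P: "prob_space P" and g: "integrable P g"
    and le: "\<And>B. B \<in> sets P \<Longrightarrow> (\<integral>\<omega>. indicator B \<omega> * g \<omega> \<partial>P) \<le> c * measure P B"
  shows "AE \<omega> in P. g \<omega> \<le> c"
proof -
  interpret prob_space P by fact
  have [measurable]: "g \<in> borel_measurable P" using g by simp
  define A where "A = {\<omega> \<in> space P. c < g \<omega>}"
  have A: "A \<in> sets P" unfolding A_def by measurable
  have i1: "integrable P (\<lambda>\<omega>. g \<omega> * indicator A \<omega>)" by (rule integrable_real_mult_indicator[OF A g])
  have i2: "integrable P (\<lambda>\<omega>. c * indicator A \<omega>)"
    using A by (intro integrable_mult_right integrable_real_indicator) (auto simp: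
        less_top[symmetric])
  have "(\<integral>\<omega>. g \<omega> * indicator A \<omega> - c * indicator A \<omega> \<partial>P) = (\<integral>\<omega>. g \<omega> * indicator A \<omega> \<partial>P) - c * prob A"
    using A i1 i2 by (subst Bochner_Integration.integral_diff) auto
  also have "\<dots> \<le> 0" using le[OF A] by (simp add: mult.commute)
  finally have "(\<integral>\<omega>. g \<omega> * indicator A \<omega> - c * indicator A \<omega> \<partial>P) \<le> 0" .
  moreover have nn: "AE \<omega> in P. 0 \<le> g \<omega> * indicator A \<omega> - c * indicator A \<omega>"
    by (rule AE_I2) (auto simp: A_def split: split_indicator)
  ultimately have "(\<integral>\<omega>. g \<omega> * indicator A \<omega> - c * indicator A \<omega> \<partial>P) = 0"
    using integral_nonneg_AE[OF nn] by simp
  then have "AE \<omega> in P. g \<omega> * indicator A \<omega> - c * indicator A \<omega> = 0"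
    using integral_nonneg_eq_0_iff_AE[OF _ nn] i1 i2 by auto
  then show ?thesis
    using AE_space by eventually_elim (auto simp: A_def split: if_splits split_indicator_asm)
qed

text \<open>A separable range replaces second countability of the space: on it open sets are
  detected by countably many balls with centres in \<open>Q\<close>.\<close>

lemma borel_measurable_if_dist_measurable:
  fixes h :: "'w \<Rightarrow> 'x::real_normed_vector"
  assumes Q: "countable Q" and hQ: "\<And>\<omega>. \<omega> \<in> space P \<Longrightarrow> h \<omega> \<in> closure Q"
    and m: "\<And>c. c \<in> Q \<Longrightarrow> (\<lambda>\<omega>. dist c (h \<omega>)) \<in> borel_measurable P"
  shows "h \<in> borel_measurable P"
proof (rule borel_measurableI)
  fix S :: "'x set" assume S: "open S"
  define I where "I = {(c, n). c \<in> Q \<and> ball c (1 / real (Suc n)) \<subseteq> S}"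
  have cI: "countable I"
  proof (rule countable_subset)
    show "I \<subseteq> Q \<times> (UNIV :: nat set)" by (auto simp: I_def)
  qed (use Q in auto)
  have "h -` S \<inter> space P = (\<Union>(c, n)\<in>I. {\<omega> \<in> space P. dist c (h \<omega>) < 1 / real (Suc n)})"
  proof (intro equalityI subsetI)
    fix \<omega> assume "\<omega> \<in> h -` S \<inter> space P"
    then have \<omega>: "h \<omega> \<in> S" "\<omega> \<in> space P" by auto
    obtain r where r: "r > 0" "ball (h \<omega>) r \<subseteq> S" using S \<omega>(1) open_contains_ball by blast
    obtain n where n: "1 / real (Suc n) < r / 2" using nat_approx_posE[of "r / 2"] r(1) by auto
    have "1 / real (Suc n) > 0" by simp
    then obtain c where c: "c \<in> Q" "dist c (h \<omega>) < 1 / real (Suc n)"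
      using hQ[OF \<omega>(2)] unfolding closure_approachable by blast
    have "ball c (1 / real (Suc n)) \<subseteq> ball (h \<omega>) r"
    proof
      fix y assume "y \<in> ball c (1 / real (Suc n))"
      then have "dist c y < r / 2" using n by simp
      moreover have "dist c (h \<omega>) < r / 2" using c(2) n by simp
      moreover have "dist (h \<omega>) y \<le> dist (h \<omega>) c + dist c y" by (rule dist_triangle)
      ultimately show "y \<in> ball (h \<omega>) r" by (simp add: dist_commute)
    qed
    then have "(c, n) \<in> I" using c(1) r(2) by (auto simp: I_def)
    with c(2) \<omega>(2) show "\<omega> \<in> (\<Union>(c, n)\<in>I. {\<omega> \<in> space P. dist c (h \<omega>) < 1 / real (Suc n)})" by blast
  next
    fix \<omega> assume "\<omega> \<in> (\<Union>(c, n)\<in>I. {\<omega> \<in> space P. dist c (h \<omega>) < 1 / real (Suc n)})"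
    then obtain c n where "(c, n) \<in> I" "dist c (h \<omega>) < 1 / real (Suc n)" "\<omega> \<in> space P" by blast
    then show "\<omega> \<in> h -` S \<inter> space P" by (auto simp: I_def subset_iff)
  qed
  also have "\<dots> \<in> sets P"
  proof (intro sets.countable_UN'[OF cI] image_subsetI)
    fix x assume "x \<in> I"
    then obtain c n where x: "x = (c, n)" "c \<in> Q" by (auto simp: I_def)
    have [measurable]: "(\<lambda>\<omega>. dist c (h \<omega>)) \<in> borel_measurable P" by (rule m[OF x(2)])
    have "{\<omega> \<in> space P. dist c (h \<omega>) < 1 / real (Suc n)} \<in> sets P" by measurable
    then show "(case x of (c, n) \<Rightarrow> {\<omega> \<in> space P. dist c (h \<omega>) < 1 / real (Suc n)}) \<in> sets P"
      by (simp add: x(1))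
  qed
  finally show "h -` S \<inter> space P \<in> sets P" .
qed

text \<open>Countably many balls of radius \<open>\<epsilon> / 2\<close> around points of
  \<open>Q\<close> catch all values of \<open>h\<close>. Finitely many catch them up to a small
  probability; on the rest \<open>s = 0\<close>, and the bound \<open>R\<close> controls the
  error.\<close>

lemma simple_function_approx:
  fixes h :: "'w \<Rightarrow> 'x::real_normed_vector"
  assumes P: "prob_space P" and Q: "countable Q" "Q \<noteq> {}"
    and hQ: "\<And>\<omega>. \<omega> \<in> space P \<Longrightarrow> h \<omega> \<in> closure Q"
    and m: "\<And>c. c \<in> Q \<Longrightarrow> (\<lambda>\<omega>. dist c (h \<omega>)) \<in> borel_measurable P"
    and R: "\<And>\<omega>. \<omega> \<in> space P \<Longrightarrow> norm (h \<omega>) \<le> R" and \<epsilon>: "\<epsilon> > 0"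
  shows "\<exists>s. simple_function P s \<and> (\<forall>\<omega>. s \<omega> \<in> insert 0 Q) \<and> (\<integral>\<^sup>+\<omega>. norm (h \<omega> - s \<omega>) \<partial>P) \<le> ennreal \<epsilon>"
proof -
  interpret prob_space P by fact
  define c where "c = from_nat_into Q"
  have c: "range c = Q" unfolding c_def using Q by (intro range_from_nat_into)
  define A where "A j = {\<omega> \<in> space P. dist (c j) (h \<omega>) < \<epsilon> / 2}" for j :: nat
  have A[measurable]: "A j \<in> sets P" for j
  proof -
    have [measurable]: "(\<lambda>\<omega>. dist (c j) (h \<omega>)) \<in> borel_measurable P" using c by (intro m) auto
    show ?thesis unfolding A_def by measurable
  qed
  have "(\<Union>j. A j) = space P"
  proof safe
    fix \<omega> assume \<omega>: "\<omega> \<in> space P"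
    then obtain y where "y \<in> Q" "dist y (h \<omega>) < \<epsilon> / 2"
      using hQ[OF \<omega>] \<epsilon> unfolding closure_approachable by (meson half_gt_zero)
    with c \<omega> show "\<omega> \<in> (\<Union>j. A j)" by (auto simp: A_def)
  qed (auto simp: A_def)
  define U where "U n = (\<Union>j<n. A j)" for n
  have U[measurable]: "U n \<in> sets P" for n unfolding U_def by measurable
  have "(\<lambda>n. prob (U n)) \<longlonglongrightarrow> prob (\<Union>n. U n)"
    using U by (intro finite_Lim_measure_incseq) (auto simp: U_def incseq_Suc_iff lessThan_Suc)
  also have "(\<Union>n. U n) = space P" using \<open>(\<Union>j. A j) = space P\<close> by (auto simp: U_def)
  finally have lim: "(\<lambda>n. prob (U n)) \<longlonglongrightarrow> 1" by (simp add: prob_space)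
  define R' where "R' = \<bar>R\<bar> + 1"
  have R': "R' > 0" by (simp add: R'_def)
  have "1 - \<epsilon> / (2 * R') < 1" using \<epsilon> R' by simp
  from order_tendstoD(1)[OF lim this] obtain n where n: "1 - \<epsilon> / (2 * R') < prob (U n)"
    by (auto simp: eventually_sequentially)
  \<comment> \<open>Where several sets \<open>A j\<close> overlap, the largest index decides the
    value; outside all of them the value is \<open>0\<close>.\<close>
  define s where "s = rec_nat (\<lambda>_. 0) (\<lambda>j f \<omega>. if \<omega> \<in> A j then c j else f \<omega>)"
  have s_simps: "s 0 = (\<lambda>_. 0)" "s (Suc j) = (\<lambda>\<omega>. if \<omega> \<in> A j then c j else s j \<omega>)" for j
    unfolding s_def by simp_all
  have s_simple: "simple_function P (s j)" for j
  proof (induction j)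
    case (Suc j)
    then show ?case unfolding s_simps by (intro simple_function_If_set) auto
  qed (simp add: s_simps)
  have s_range: "s j \<omega> \<in> insert 0 Q" for j \<omega>
    using c by (induction j) (auto simp: s_simps)
  have s_in: "\<omega> \<in> U j \<Longrightarrow> norm (h \<omega> - s j \<omega>) < \<epsilon> / 2" for j \<omega>
  proof (induction j)
    case (Suc j)
    then show ?case by (auto simp: s_simps U_def lessThan_Suc A_def dist_norm norm_minus_commute)
  qed (simp add: U_def)
  have s_out: "\<omega> \<notin> U j \<Longrightarrow> s j \<omega> = 0" for j \<omega>
    by (induction j) (auto simp: s_simps U_def lessThan_Suc)
  have "(\<integral>\<^sup>+\<omega>. norm (h \<omega> - s n \<omega>) \<partial>P) \<le> (\<integral>\<^sup>+\<omega>. ennreal (\<epsilon> / 2) + ennreal R' * indicator (space P - U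
    n) \<omega> \<partial>P)"
  proof (rule nn_integral_mono)
    fix \<omega> assume \<omega>: "\<omega> \<in> space P"
    show "ennreal (norm (h \<omega> - s n \<omega>)) \<le> ennreal (\<epsilon> / 2) + ennreal R' * indicator (space P - U n) \<omega>"
    proof (cases "\<omega> \<in> U n")
      case True
      then show ?thesis using s_in[OF True] by (auto intro!: ennreal_leI)
    next
      case False
      have "ennreal (norm (h \<omega> - s n \<omega>)) \<le> ennreal R'"
        using s_out[OF False] R[OF \<omega>] by (intro ennreal_leI) (simp add: R'_def)
      also have "\<dots> \<le> ennreal (\<epsilon> / 2) + ennreal R'" by simp
      finally show ?thesis using False \<omega> by simp
    qed
  qed
  also have "\<dots> = (\<integral>\<^sup>+\<omega>. ennreal (\<epsilon> / 2) \<partial>P) + (\<integral>\<^sup>+\<omega>. ennreal R' * indicator (space P - U n) \<omega> \<partial>P)"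
    by (intro nn_integral_add) measurable
  also have "(\<integral>\<^sup>+\<omega>. ennreal R' * indicator (space P - U n) \<omega> \<partial>P)
    = ennreal R' * emeasure P (space P - U n)"
    by (intro nn_integral_cmult_indicator) measurable
  also have "emeasure P (space P - U n) = ennreal (1 - prob (U n))"
    using prob_compl[OF U[of n]] by (simp add: emeasure_eq_measure)
  also have "ennreal R' * ennreal (1 - prob (U n)) = ennreal (R' * (1 - prob (U n)))"
    using R' by (intro ennreal_mult[symmetric]) auto
  also have "R' * (1 - prob (U n)) \<le> \<epsilon> / 2" using n R' by (simp add: field_simps)
  then have "(\<integral>\<^sup>+\<omega>. ennreal (\<epsilon> / 2) \<partial>P) + ennreal (R' * (1 - prob (U n)))
    \<le> ennreal (\<epsilon> / 2) + ennreal (\<epsilon> / 2)"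
    by (intro add_mono ennreal_leI) (simp_all add: emeasure_space_1)
  also have "\<dots> = ennreal \<epsilon>" using \<epsilon> by (simp flip: ennreal_plus)
  finally show ?thesis using s_simple s_range by (intro exI[of _ "s n"]) auto
qed

text \<open>The error is made small in norm and under \<open>\<psi>\<close> at once, because
  \<open>\<psi>\<close> is not assumed continuous: in the application to
  \<open>\<Psi> \<omega>\<close> its boundedness is what has to be derived.\<close>

lemma rational_span_dense:
  fixes B :: "'v::real_normed_vector set" and \<psi> :: "'v \<Rightarrow> real"
  assumes \<psi>: "linear \<psi>" and v: "v \<in> span B" and e: "e > 0"
  shows "\<exists>xs\<in>lists (UNIV \<times> B). \<bar>\<psi> (v - (\<Sum>(q, b)\<leftarrow>xs. real_of_rat q *\<^sub>R b))\<bar> < e \<and>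
    norm (v - (\<Sum>(q, b)\<leftarrow>xs. real_of_rat q *\<^sub>R b)) < e"
  using v e
proof (induction arbitrary: e rule: span_induct_alt)
  case base
  then show ?case by (intro bexI[of _ "[]"]) (auto simp: linear_0[OF \<psi>])
next
  case (step c b y)
  interpret \<psi>: linear \<psi> by (rule \<psi>)
  let ?S = "\<lambda>xs. (\<Sum>(q, b)\<leftarrow>xs. real_of_rat q *\<^sub>R b)"
  obtain xs where xs: "xs \<in> lists (UNIV \<times> B)" "\<bar>\<psi> (y - ?S xs)\<bar> < e / 2" "norm (y - ?S xs) < e / 2"
    using step.IH[of "e / 2"] step.prems by auto
  define D where "D = \<bar>\<psi> b\<bar> + norm b + 1"
  have D: "D > 0" "\<bar>\<psi> b\<bar> \<le> D" "norm b \<le> D" by (auto simp: D_def add_nonneg_pos)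
  have "c < c + e / (2 * D)" using step.prems D by simp
  then obtain q where q: "c < real_of_rat q" "real_of_rat q < c + e / (2 * D)" using of_rat_dense
    by blast
  have cq: "\<bar>c - real_of_rat q\<bar> * D \<le> e / 2"
  proof -
    have "\<bar>c - real_of_rat q\<bar> * D \<le> e / (2 * D) * D" using q D by (intro mult_right_mono) auto
    then show ?thesis using D by simp
  qed
  have eq: "c *\<^sub>R b + y - ?S ((q, b) # xs) = (c - real_of_rat q) *\<^sub>R b + (y - ?S xs)"
    by (simp add: scaleR_left_diff_distrib)
  have "\<bar>\<psi> (c *\<^sub>R b + y - ?S ((q, b) # xs))\<bar> \<le> \<bar>c - real_of_rat q\<bar> * \<bar>\<psi> b\<bar> + \<bar>\<psi> (y - ?S xs)\<bar>"
    unfolding eq by (simp only: \<psi>.add \<psi>.scaleR real_scaleR_def abs_mult[symmetric] abs_triangle_ineq)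
  also have "\<dots> < e"
    using mult_left_mono[OF D(2), of "\<bar>c - real_of_rat q\<bar>"] cq xs(2) by simp
  finally have 1: "\<bar>\<psi> (c *\<^sub>R b + y - ?S ((q, b) # xs))\<bar> < e" .
  have "norm (c *\<^sub>R b + y - ?S ((q, b) # xs)) \<le> \<bar>c - real_of_rat q\<bar> * norm b + norm (y - ?S xs)"
    unfolding eq by (rule order_trans[OF norm_triangle_ineq]) simp
  also have "\<dots> < e"
    using mult_left_mono[OF D(3), of "\<bar>c - real_of_rat q\<bar>"] cq xs(3) by simp
  finally have 2: "norm (c *\<^sub>R b + y - ?S ((q, b) # xs)) < e" .
  have "(q, b) # xs \<in> lists (UNIV \<times> B)" using xs(1) step.hyps by auto
  with 1 2 show ?case by blast
qed

lemma locally_constant_on_span: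
  fixes E :: "'a::{metric_space,zero} lip0 set"
  assumes "v \<in> span E" and "\<And>e. e \<in> E \<Longrightarrow> locally_constant_on K (lip0_apply e)"
  shows "locally_constant_on K (lip0_apply v)"
  using assms(1)
proof (induction rule: span_induct_alt)
  case base
  show ?case unfolding locally_constant_on_def by (intro exI[of _ 1]) simp
next
  case (step c e w)
  obtain r where r: "r > 0" "\<forall>x\<in>K. \<forall>y\<in>K. dist x y < r \<longrightarrow> lip0_apply e x = lip0_apply e y"
    using assms(2)[OF step(1)] unfolding locally_constant_on_def by blast
  obtain r' where r': "r' > 0" "\<forall>x\<in>K. \<forall>y\<in>K. dist x y < r' \<longrightarrow> lip0_apply w x = lip0_apply w y"
    using step(2) unfolding locally_constant_on_def by blast
  show ?case
    unfolding locally_constant_on_def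
  proof (intro exI[of _ "min r r'"] conjI ballI impI)
    fix x y assume "x \<in> K" "y \<in> K" "dist x y < min r r'"
    then have "lip0_apply e x = lip0_apply e y" "lip0_apply w x = lip0_apply w y" using r(2) r'(2)
      by simp_all
    then show "lip0_apply (c *\<^sub>R e + w) x = lip0_apply (c *\<^sub>R e + w) y" by simp
  qed (use r(1) r'(1) in simp)
qed

text \<open>The scalar densities of the pairings are assembled, for almost every
  \<open>\<omega>\<close>, into a bounded functional on \<open>V\<close>, which
  \<open>functional_represented\<close> turns into a point of the free space.\<close>

lemma bounded_vector_measure_has_density:
  fixes m :: "'w set \<Rightarrow> 'a::{metric_space,zero} lipfree"
  assumes K: "compact K" "hausdorff1 K = 0" "0 \<in> K" and P: "prob_space P" and vm: "vector_measure P m"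
    and mem: "\<And>B. B \<in> sets P \<Longrightarrow> m B \<in> lipfree_on K"
    and R: "\<And>B. B \<in> sets P \<Longrightarrow> norm (m B) \<le> R * measure P B"
  shows "\<exists>h. \<forall>B\<in>sets P. has_banach_integral P (\<lambda>\<omega>. indicator B \<omega> *\<^sub>R h \<omega>) (m B)"
proof -
  interpret prob_space P by fact
  have "0 \<le> R * prob (space P)" using R[OF sets.top] norm_ge_zero order_trans by blast
  then have R0: "0 \<le> R" by (simp add: prob_space)
  obtain E :: "'a lip0 set" where E: "countable E" "\<And>e. e \<in> E \<Longrightarrow> norm e \<le> 1"
    "\<And>e. e \<in> E \<Longrightarrow> locally_constant_on K (lip0_apply e)"
    and norming: "\<And>u c. u \<in> lipfree_on K \<Longrightarrow> (\<And>e. e \<in> E \<Longrightarrow> pairing u e \<le> c) \<Longrightarrow> norm u \<le> c"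
    using countable_norming_set[OF K] by metis
  define V where "V = span E"
  have V: "subspace V" "E \<subseteq> V" by (auto simp: V_def span_superset)
  have lc: "locally_constant_on K (lip0_apply v)" if "v \<in> V" for v
    using that E(3) unfolding V_def by (rule locally_constant_on_span)
  \<comment> \<open>Scalar densities respect linear relations only almost everywhere. They are
    therefore prescribed on a basis of \<open>V\<close> and extended linearly at every
    \<open>\<omega>\<close>.\<close>
  obtain B where B: "B \<subseteq> E" "independent B" "E \<subseteq> span B"
    by (rule real_vector.maximal_independent_subset[of E])
  have VB: "V = span B" unfolding V_def using B
    by (simp add: span_eq span_superset order_trans[OF B(1) span_superset])
  have "\<exists>h. integrable P h \<and> (\<forall>A\<in>sets P. (\<integral>\<omega>. indicator A \<omega> * h \<omega> \<partial>P) = pairing (m A) v)" for v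
  proof (rule bounded_signed_measure_density[OF P])
    show "(\<lambda>i. pairing (m (A i)) v) sums pairing (m (\<Union>i. A i)) v"
      if "range A \<subseteq> sets P" "disjoint_family A" for A :: "nat \<Rightarrow> 'w set"
      using vm that unfolding vector_measure_def
          by (intro bounded_linear.sums[OF bounded_linear_lipfree_apply]) blast
    show "\<bar>pairing (m A) v\<bar> \<le> R * norm v * measure P A" if "A \<in> sets P" for A
      using lipfree_functional_le[of "m A" v] mult_right_mono[OF R[OF that] norm_ge_zero[of v]]
          by (simp add: mult_ac)
  qed
  then obtain d where d: "\<And>v. integrable P (d v)"
    "\<And>v A. A \<in> sets P \<Longrightarrow> (\<integral>\<omega>. indicator A \<omega> * d v \<omega> \<partial>P) = pairing (m A) v" by metis
  have "\<exists>g. linear g \<and> (\<forall>b\<in>B. g b = d b \<omega>)" for \<omega>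
    using real_vector.linear_independent_extend[OF B(2), of "\<lambda>b. d b \<omega>"] by blast
  then obtain \<Psi> where \<Psi>: "\<And>\<omega>. linear (\<Psi> \<omega> :: 'a lip0 \<Rightarrow> real)" "\<And>\<omega> b. b \<in> B \<Longrightarrow> \<Psi> \<omega> b = d b \<omega>" by metis
  have dens: "integrable P (\<lambda>\<omega>. \<Psi> \<omega> v) \<and> (\<forall>A\<in>sets P. (\<integral>\<omega>. indicator A \<omega> * \<Psi> \<omega> v \<partial>P)
    = pairing (m A) v)"
    if v: "v \<in> V" for v
    using v unfolding VB
  proof (induction rule: span_induct_alt)
    case base
    then show ?case by (simp add: linear_0[OF \<Psi>(1)])
  next
    case (step c b y)
    have eq: "\<Psi> \<omega> (c *\<^sub>R b + y) = c * d b \<omega> + \<Psi> \<omega> y" for \<omega>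
      using \<Psi>(2)[OF step(1)] by (simp add: linear_add[OF \<Psi>(1)] linear_scale[OF \<Psi>(1)])
    have int: "integrable P (\<lambda>\<omega>. c * d b \<omega> + \<Psi> \<omega> y)" using d(1) step(2) by auto
    have "(\<integral>\<omega>. indicator A \<omega> * (c * d b \<omega> + \<Psi> \<omega> y) \<partial>P) = pairing (m A) (c *\<^sub>R b + y)"
      if A: "A \<in> sets P" for A
    proof -
      have i1: "integrable P (\<lambda>\<omega>. indicator A \<omega> * d b \<omega>)"
        using integrable_real_mult_indicator[OF A d(1)] by (simp add: mult.commute)
      have i2: "integrable P (\<lambda>\<omega>. indicator A \<omega> * \<Psi> \<omega> y)"
        using integrable_real_mult_indicator[OF A conjunct1[OF step(2)]] by (simp add: mult.commute)
      have "(\<integral>\<omega>. indicator A \<omega> * (c * d b \<omega> + \<Psi> \<omega> y) \<partial>P)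
        = (\<integral>\<omega>. c * (indicator A \<omega> * d b \<omega>) + indicator A \<omega> * \<Psi> \<omega> y \<partial>P)"
        by (simp add: algebra_simps)
      also have "\<dots> = c * (\<integral>\<omega>. indicator A \<omega> * d b \<omega> \<partial>P) + (\<integral>\<omega>. indicator A \<omega> * \<Psi> \<omega> y \<partial>P)"
        using i1 i2 by (subst Bochner_Integration.integral_add) auto
      also have "\<dots> = pairing (m A) (c *\<^sub>R b + y)"
        using d(2)[OF A] step(2) A by (simp add: blinfun.add_right blinfun.scaleR_right)
      finally show ?thesis .
    qed
    with int show ?case unfolding eq by blast
  qed
  have AE_le: "AE \<omega> in P. \<bar>\<Psi> \<omega> v\<bar> \<le> R * lip_const_on K v" if v: "v \<in> V" for v
  proof -
    have b: "\<bar>pairing (m A) v\<bar> \<le> R * lip_const_on K v * measure P A" if "A \<in> sets P" for A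
      using pairing_le_on[OF mem[OF that] K(3), of v] mult_left_mono[OF R[OF that]
          lip_const_on_nonneg[of K v]]
      by (simp add: mult_ac)
    have "AE \<omega> in P. \<Psi> \<omega> v \<le> R * lip_const_on K v"
      by (rule AE_le_if_integrals_le[OF P]) (use dens[OF v] b in \<open>auto simp: abs_le_iff\<close>)
    moreover have "AE \<omega> in P. - \<Psi> \<omega> v \<le> R * lip_const_on K v"
      by (rule AE_le_if_integrals_le[OF P]) (use dens[OF v] b in \<open>auto simp: abs_le_iff\<close>)
    ultimately show ?thesis by eventually_elim (simp add: abs_le_iff)
  qed
  let ?S = "\<lambda>xs :: (rat \<times> 'a lip0) list. (\<Sum>(q, b)\<leftarrow>xs. real_of_rat q *\<^sub>R b)"
  have S_V: "?S xs \<in> V" if "xs \<in> lists (UNIV \<times> B)" for xs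
    using that
  proof (induction xs)
    case (Cons x xs)
    then have "snd x \<in> V" using B(1) V(2) by auto
    then show ?case using Cons
      by (auto simp: case_prod_beta intro!: subspace_add[OF V(1)] subspace_scale[OF V(1)])
  qed (simp add: subspace_0[OF V(1)])
  have cB: "countable B" using B(1) E(1) by (rule countable_subset)
  \<comment> \<open>The basis lies in the countable set \<open>E\<close>, so there are countably
    many rational combinations and a single null set serves them all.\<close>
  have "AE \<omega> in P. \<forall>xs\<in>lists (UNIV \<times> B). \<bar>\<Psi> \<omega> (?S xs)\<bar> \<le> R * lip_const_on K (?S xs)"
    using cB by (subst AE_ball_countable) (auto intro!: countable_lists AE_le S_V)
  then obtain N where N: "N \<in> null_sets P"
    "{\<omega> \<in> space P. \<not> (\<forall>xs\<in>lists (UNIV \<times> B). \<bar>\<Psi> \<omega> (?S xs)\<bar> \<le> R * lip_const_on K (?S xs))} \<subseteq> N"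
    by (auto elim!: AE_E simp: null_sets_def)
  \<comment> \<open>Passing from rational combinations to all of \<open>V\<close> needs an error
    small in norm and also under \<open>\<Psi> \<omega>\<close>, which is not yet known to be
    bounded.\<close>
  have good: "\<bar>\<Psi> \<omega> v\<bar> \<le> R * lip_const_on K v" if \<omega>: "\<omega> \<in> space P - N" and v: "v \<in> V" for \<omega> v
  proof (rule field_le_epsilon)
    fix e :: real assume e: "e > 0"
    define e' where "e' = e / (R + 1)"
    have e': "e' > 0" using e R0 by (simp add: e'_def)
    from rational_span_dense[OF \<Psi>(1) v[unfolded VB] e', of \<omega>] obtain xs where
      xs: "xs \<in> lists (UNIV \<times> B)" "\<bar>\<Psi> \<omega> (v - ?S xs)\<bar> < e'" "norm (v - ?S xs) < e'" by blast
    have "\<bar>\<Psi> \<omega> v\<bar> \<le> \<bar>\<Psi> \<omega> (?S xs)\<bar> + \<bar>\<Psi> \<omega> (v - ?S xs)\<bar>"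
      by (simp add: linear_diff[OF \<Psi>(1)])
    also have "\<dots> \<le> R * lip_const_on K (?S xs) + e'"
      using N(2) \<omega> xs(1,2) by (intro add_mono) auto
    also have "lip_const_on K (?S xs) \<le> lip_const_on K v + e'"
    proof -
      have "lip_const_on K (?S xs) \<le> lip_const_on K v + lip_const_on K (?S xs - v)"
        using lip_const_on_add[of K v "?S xs - v"] by simp
      moreover have "lip_const_on K (?S xs - v) \<le> norm (v - ?S xs)"
        using lip_const_on_le_norm[of K "?S xs - v"] by (simp add: norm_minus_commute)
      ultimately show ?thesis using xs(3) by simp
    qed
    then have "R * lip_const_on K (?S xs) + e' \<le> R * (lip_const_on K v + e') + e'"
      using R0 by (intro add_right_mono mult_left_mono)
    also have "\<dots> = R * lip_const_on K v + (R + 1) * e'" by (simp add: algebra_simps)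
    also have "(R + 1) * e' = e" using R0 by (simp add: e'_def)
    finally show "\<bar>\<Psi> \<omega> v\<bar> \<le> R * lip_const_on K v + e" .
  qed
  have "\<exists>u\<in>lipfree_on K. \<forall>v\<in>V. pairing u v = \<Psi> \<omega> v" if "\<omega> \<in> space P - N" for \<omega>
    by (rule functional_represented[OF K(1) V(1) lc V(2) E(2) norming \<Psi>(1) good[OF that]])
  then obtain u where u: "\<And>\<omega>. \<omega> \<in> space P - N \<Longrightarrow> u \<omega> \<in> lipfree_on K"
    "\<And>\<omega> v. \<omega> \<in> space P - N \<Longrightarrow> v \<in> V \<Longrightarrow> pairing (u \<omega>) v = \<Psi> \<omega> v" by metis
  define h where "h \<omega> = (if \<omega> \<in> space P - N then u \<omega> else 0)" for \<omega>
  have h_mem: "h \<omega> \<in> lipfree_on K" for \<omega>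
    using u(1) subspace_0[OF subspace_lipfree_on] by (auto simp: h_def)
  have hN: "pairing (h \<omega>) v = (if \<omega> \<in> N then 0 else \<Psi> \<omega> v)" if "\<omega> \<in> space P" "v \<in> V" for \<omega> v
    using that u(2) by (auto simp: h_def pairing_zero_left)
  have h_norm: "norm (h \<omega>) \<le> R" for \<omega>
  proof (cases "\<omega> \<in> space P - N")
    case True
    show ?thesis
    proof (rule norming[OF h_mem])
      fix e assume e: "e \<in> E"
      have "lip_const_on K e \<le> 1" using lip_const_on_le_norm[of K e] E(2)[OF e] by simp
      then have "R * lip_const_on K e \<le> R * 1" using R0 by (intro mult_left_mono)
      then show "pairing (h \<omega>) e \<le> R" using good[OF True, of e] u(2)[OF True, of e] e V(2) True
        by (auto simp: h_def abs_le_iff)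
    qed
  qed (auto simp: h_def R0)
  have pm: "(\<lambda>\<omega>. pairing (h \<omega>) v) \<in> borel_measurable P" if v: "v \<in> V" for v
  proof -
    have "(\<lambda>\<omega>. \<Psi> \<omega> v) \<in> borel_measurable P" using dens[OF v] by auto
    then have "(\<lambda>\<omega>. if \<omega> \<in> N then 0 else \<Psi> \<omega> v) \<in> borel_measurable P"
      using N(1) by (intro measurable_If_set) auto
    then show ?thesis by (rule measurable_cong[THEN iffD2, rotated]) (rule hN[OF _ v])
  qed
  \<comment> \<open>The norming set expresses the distance through countably many measurable
    pairings.\<close>
  have dist_m: "(\<lambda>\<omega>. dist c (h \<omega>)) \<in> borel_measurable P" if c: "c \<in> lipfree_on K" for c
    unfolding borel_measurable_iff_le
  proof
    fix t
    have "dist c (h \<omega>) \<le> t \<longleftrightarrow> (\<forall>e\<in>E. pairing (h \<omega>) e - pairing c e \<le> t)" for \<omega>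
    proof
      assume t: "dist c (h \<omega>) \<le> t"
      show "\<forall>e\<in>E. pairing (h \<omega>) e - pairing c e \<le> t"
      proof
        fix e assume e: "e \<in> E"
        have "pairing (h \<omega> - c) e \<le> norm (h \<omega> - c) * norm e"
          using lipfree_functional_le[of "h \<omega> - c" e] by simp
        also have "\<dots> \<le> norm (h \<omega> - c) * 1" using E(2)[OF e] by (intro mult_left_mono) auto
        finally show "pairing (h \<omega>) e - pairing c e \<le> t" using t
          by (simp add: pairing_diff_left dist_norm norm_minus_commute)
      qed
    next
      assume "\<forall>e\<in>E. pairing (h \<omega>) e - pairing c e \<le> t"
      then have "norm (h \<omega> - c) \<le> t"
        by (intro norming subspace_diff[OF subspace_lipfree_on] h_mem c) (auto simp:
            pairing_diff_left)
      then show "dist c (h \<omega>) \<le> t" by (simp add: dist_norm norm_minus_commute)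
    qed
    moreover have "{\<omega> \<in> space P. \<forall>e\<in>E. pairing (h \<omega>) e - pairing c e \<le> t}
      = space P - (\<Union>e\<in>E. {\<omega> \<in> space P. \<not> pairing (h \<omega>) e - pairing c e \<le> t})" by blast
    moreover have "(\<Union>e\<in>E. {\<omega> \<in> space P. \<not> pairing (h \<omega>) e - pairing c e \<le> t}) \<in> sets P"
    proof (intro sets.countable_UN'[OF E(1)] image_subsetI)
      fix e assume "e \<in> E"
      then have [measurable]: "(\<lambda>\<omega>. pairing (h \<omega>) e) \<in> borel_measurable P" using V(2)
        by (intro pm) auto
      show "{\<omega> \<in> space P. \<not> pairing (h \<omega>) e - pairing c e \<le> t} \<in> sets P" by measurable
    qed
    ultimately show "{\<omega> \<in> space P. dist c (h \<omega>) \<le> t} \<in> sets P" by simp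
  qed
  \<comment> \<open>Rational combinations of evaluations at a dense sequence show that the free
    space over \<open>K\<close> is separable, which yields both measurability and simple
    approximations of \<open>h\<close>.\<close>
  have "\<exists>Q. countable Q \<and> Q \<noteq> {} \<and> Q \<subseteq> lipfree_on K \<and> lipfree_on K \<subseteq> closure Q"
  proof -
    obtain D where D: "D \<subseteq> K" "countable D" "K \<subseteq> closure D" using compact_countable_dense[OF K(1)]
      by blast
    let ?T = "\<lambda>xs :: (rat \<times> 'a lipfree) list. (\<Sum>(q, b)\<leftarrow>xs. real_of_rat q *\<^sub>R b)"
    define Q where "Q = ?T ` lists (UNIV \<times> lipfree_delta ` D)"
    have "countable Q" unfolding Q_def using D(2) by (intro countable_image countable_lists) auto
    moreover have "Q \<noteq> {}" by (auto simp: Q_def)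
    moreover have "Q \<subseteq> lipfree_on K"
    proof -
      have "?T xs \<in> lipfree_on K" if "xs \<in> lists (UNIV \<times> lipfree_delta ` D)" for xs
        using that
      proof (induction xs)
        case (Cons x xs)
        have "lipfree_delta ` D \<subseteq> lipfree_on K"
          using span_delta_subset_lipfree_on[OF D(1)] span_superset by blast
        then have "snd x \<in> lipfree_on K" using Cons by auto
        then show ?case using Cons
          by (auto simp: case_prod_beta intro!: subspace_add[OF subspace_lipfree_on] subspace_scale[OF
              subspace_lipfree_on])
      qed (simp add: subspace_0[OF subspace_lipfree_on])
      then show ?thesis by (auto simp: Q_def)
    qed
    moreover have "lipfree_on K \<subseteq> closure Q"
    proof -
      have "span (lipfree_delta ` D) \<subseteq> closure Q"
      proof
        fix w assume w: "w \<in> span (lipfree_delta ` D)"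
        \<comment> \<open>Only norm approximation is wanted here, so the zero functional makes the
          other condition trivial.\<close>
        have lin0: "linear (\<lambda>_ :: 'a lipfree. 0 :: real)" by (rule linearI) auto
        show "w \<in> closure Q"
          unfolding closure_approachable
        proof (intro allI impI)
          fix e :: real assume "e > 0"
          from rational_span_dense[OF lin0 w this] obtain xs where
            "xs \<in> lists (UNIV \<times> lipfree_delta ` D)" "norm (w - ?T xs) < e" by blast
          then show "\<exists>y\<in>Q. dist y w < e" by (auto simp: Q_def dist_norm norm_minus_commute)
        qed
      qed
      then have "closure (span (lipfree_delta ` D)) \<subseteq> closure Q" by (intro closure_minimal) auto
      then show ?thesis using lipfree_on_dense[OF D(3)] by blast
    qed
    ultimately show ?thesis by blast
  qed
  then obtain Q where Q: "countable Q" "Q \<noteq> {}" "Q \<subseteq> lipfree_on K" "lipfree_on K \<subseteq> closure Q" by blast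
  have hQ: "h \<omega> \<in> closure Q" for \<omega> using h_mem Q(4) by blast
  have h_borel: "h \<in> borel_measurable P"
    by (rule borel_measurable_if_dist_measurable[OF Q(1) hQ]) (use Q(3) dist_m in auto)
  have "\<exists>s. simple_function P s \<and> (\<forall>\<omega>. s \<omega> \<in> insert 0 Q) \<and> (\<integral>\<^sup>+\<omega>. norm (h \<omega> - s \<omega>) \<partial>P)
    \<le> ennreal (1 / real (Suc i))" for i
    by (rule simple_function_approx[OF P Q(1,2) hQ _ h_norm]) (use Q(3) dist_m in auto)
  then obtain s where s: "\<And>i. simple_function P (s i)" "\<And>i \<omega>. s i \<omega> \<in> insert 0 Q"
    "\<And>i. (\<integral>\<^sup>+\<omega>. norm (h \<omega> - s i \<omega>) \<partial>P) \<le> ennreal (1 / real (Suc i))" by metis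
  have s_mem: "s i \<omega> \<in> lipfree_on K" for i \<omega>
    using s(2)[of i \<omega>] Q(3) subspace_0[OF subspace_lipfree_on] by auto
  have lim0: "(\<lambda>i. ennreal (1 / real (Suc i))) \<longlonglongrightarrow> 0"
    using tendsto_ennrealI[OF LIMSEQ_Suc[OF lim_1_over_n]] by simp
  have "has_banach_integral P (\<lambda>\<omega>. indicator A \<omega> *\<^sub>R h \<omega>) (m A)" if A: "A \<in> sets P" for A
  proof -
    define t where "t i \<omega> = indicator A \<omega> *\<^sub>R s i \<omega>" for i \<omega>
    have t_simple: "simple_function P (t i)" for i
      unfolding t_def using A s(1)
      by (intro simple_function_compose2[where h="\<lambda>r x. r *\<^sub>R x"] simple_function_indicator) auto
    have t_int: "sb_integrable P (t i)" for i
      using t_simple by (intro simple_bochner_integrable.intros) (auto simp: less_top[symmetric])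
    have t_mem: "t i \<omega> \<in> lipfree_on K" for i \<omega>
      unfolding t_def by (intro subspace_scale[OF subspace_lipfree_on] s_mem)
    have le: "(\<integral>\<^sup>+\<omega>. norm (indicator A \<omega> *\<^sub>R h \<omega> - t i \<omega>) \<partial>P) \<le> ennreal (1 / real (Suc i))" for i
      by (rule order_trans[OF nn_integral_mono s(3)[of i]])
        (auto simp: t_def split: split_indicator)
    \<comment> \<open>Tested on the norming set, the difference becomes a scalar integral, bounded
      by the mean distance between \<open>h\<close> and \<open>s i\<close>.\<close>
    have "norm (sbi P (t i) - m A) \<le> 1 / real (Suc i)" for i
    proof (rule norming)
      have "sbi P (t i) \<in> lipfree_on K"
        unfolding simple_bochner_integral_def using t_mem
        by (intro subspace_sum[OF subspace_lipfree_on] subspace_scale[OF subspace_lipfree_on]) auto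
      then show "sbi P (t i) - m A \<in> lipfree_on K"
        by (intro subspace_diff[OF subspace_lipfree_on] mem[OF A])
      fix e assume e: "e \<in> E"
      then have eV: "e \<in> V" using V(2) by blast
      have lin: "linear (\<lambda>u. pairing u e)"
        by (rule bounded_linear.linear[OF bounded_linear_lipfree_apply])
      have ti: "sb_integrable P (\<lambda>\<omega>. pairing (t i \<omega>) e)"
        using simple_bochner_integrable_compose2[where p="\<lambda>x y. pairing x e", OF _ t_int t_int, of i]
            by (simp add: pairing_zero_left)
      have 1: "pairing (sbi P (t i)) e = (\<integral>\<omega>. pairing (t i \<omega>) e \<partial>P)"
        using simple_bochner_integral_linear[OF lin t_int[of i]]
            simple_bochner_integrable_eq_integral[OF ti] by simp
      have i\<Psi>: "integrable P (\<lambda>\<omega>. indicator A \<omega> * \<Psi> \<omega> e)"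
        using integrable_real_mult_indicator[OF A conjunct1[OF dens[OF eV]]]
            by (simp add: mult.commute)
      have aeq: "AE \<omega> in P. indicator A \<omega> * pairing (h \<omega>) e = indicator A \<omega> * \<Psi> \<omega> e"
        using AE_not_in[OF N(1)] AE_space by eventually_elim (simp add: hN eV)
      have [measurable]: "(\<lambda>\<omega>. pairing (h \<omega>) e) \<in> borel_measurable P" by (rule pm[OF eV])
      have hm: "(\<lambda>\<omega>. indicator A \<omega> * pairing (h \<omega>) e) \<in> borel_measurable P" using A by measurable
      have ih: "integrable P (\<lambda>\<omega>. indicator A \<omega> * pairing (h \<omega>) e)"
        by (rule integrable_cong_AE_imp[OF i\<Psi> hm]) (use aeq in \<open>auto elim: eventually_mono\<close>)
      have "(\<integral>\<omega>. indicator A \<omega> * pairing (h \<omega>) e \<partial>P) = (\<integral>\<omega>. indicator A \<omega> * \<Psi> \<omega> e \<partial>P)"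
        using hm i\<Psi> aeq by (intro integral_cong_AE) auto
      then have 2: "pairing (m A) e = (\<integral>\<omega>. indicator A \<omega> * pairing (h \<omega>) e \<partial>P)" using dens[OF eV] A
        by simp
      have it: "integrable P (\<lambda>\<omega>. pairing (t i \<omega>) e)"
        by (rule integrableI_simple_bochner_integrable[OF ti])
      have "pairing (sbi P (t i) - m A) e = (\<integral>\<omega>. pairing (t i \<omega>) e - indicator A \<omega> * pairing (h \<omega>) e
        \<partial>P)"
        unfolding pairing_diff_left 1 2
            by (rule Bochner_Integration.integral_diff[OF it ih, symmetric])
      also have "\<dots> \<le> norm (\<integral>\<omega>. pairing (t i \<omega>) e - indicator A \<omega> * pairing (h \<omega>) e \<partial>P)" by simp
      finally have "ennreal (pairing (sbi P (t i) - m A) e) \<le> ennreal (norm (\<integral>\<omega>. pairing (t i \<omega>) e -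
        indicator A \<omega> * pairing (h \<omega>) e \<partial>P))"
        by (rule ennreal_leI)
      also have "\<dots> \<le> (\<integral>\<^sup>+\<omega>. norm (pairing (t i \<omega>) e - indicator A \<omega> * pairing (h \<omega>) e) \<partial>P)"
        by (rule integral_norm_bound_ennreal) (intro Bochner_Integration.integrable_diff it ih)
      also have "\<dots> \<le> (\<integral>\<^sup>+\<omega>. norm (indicator A \<omega> *\<^sub>R h \<omega> - t i \<omega>) \<partial>P)"
      proof (intro nn_integral_mono ennreal_leI)
        fix \<omega>
        have "pairing (t i \<omega>) e - indicator A \<omega> * pairing (h \<omega>) e
          = pairing (t i \<omega> - indicator A \<omega> *\<^sub>R h \<omega>) e"
          by (simp add: pairing_diff_left pairing_scale_left)
        then have "norm (pairing (t i \<omega>) e - indicator A \<omega> * pairing (h \<omega>) e)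
          \<le> norm (t i \<omega> - indicator A \<omega> *\<^sub>R h \<omega>) * norm e"
          using lipfree_functional_le by simp
        also have "\<dots> \<le> norm (t i \<omega> - indicator A \<omega> *\<^sub>R h \<omega>) * 1" using E(2)[OF e]
          by (intro mult_left_mono) auto
        finally show "norm (pairing (t i \<omega>) e - indicator A \<omega> * pairing (h \<omega>) e)
          \<le> norm (indicator A \<omega> *\<^sub>R h \<omega> - t i \<omega>)"
          by (simp add: norm_minus_commute)
      qed
      also note le[of i]
      finally show "pairing (sbi P (t i) - m A) e \<le> 1 / real (Suc i)" by (simp add: ennreal_le_iff)
    qed
    then have "(\<lambda>i. sbi P (t i) - m A) \<longlonglongrightarrow> 0"
      by (intro Lim_null_comparison[OF _ LIMSEQ_Suc[OF lim_1_over_n]]) (simp add: always_eventually)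
    then have "(\<lambda>i. sbi P (t i)) \<longlonglongrightarrow> m A" by (rule LIM_zero_cancel)
    moreover have "(\<lambda>i. \<integral>\<^sup>+\<omega>. norm (indicator A \<omega> *\<^sub>R h \<omega> - t i \<omega>) \<partial>P) \<longlonglongrightarrow> 0"
      by (rule tendsto_sandwich[OF _ _ tendsto_const lim0]) (use le in \<open>simp_all only: eventually_True
          zero_le\<close>)
    moreover have "(\<lambda>\<omega>. indicator A \<omega> *\<^sub>R h \<omega>) \<in> borel_measurable P"
    proof -
      have "(\<lambda>\<omega>. if \<omega> \<in> A then h \<omega> else 0) \<in> borel_measurable P"
        using A h_borel by (intro measurable_If_set) auto
      also have "(\<lambda>\<omega>. if \<omega> \<in> A then h \<omega> else 0) = (\<lambda>\<omega>. indicator A \<omega> *\<^sub>R h \<omega>)" by auto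
      finally show ?thesis .
    qed
    ultimately show ?thesis unfolding has_banach_integral_def using t_int by blast
  qed
  then show ?thesis by blast
qed

text \<open>Evaluations go to evaluations at points of \<open>range f\<close>, so the operator takes
  values in the closed subspace \<open>lipfree_on (range f)\<close>. Averages in the image of the
  ball then mean that the measure lives there and is dominated by a multiple of the
  probability.\<close>

lemma strong_radon_nikodym_if_null:
  fixes f :: "'a::{metric_space,zero} \<Rightarrow> 'b::{metric_space,zero}"
  assumes M: "compact (UNIV :: 'a set)" and f: "\<exists>L. L-lipschitz_on UNIV f" and f0: "f 0 = 0"
    and null: "hausdorff1 (range f) = 0"
  shows "strong_radon_nikodym TYPE('w) (lipfree_map f)"
proof -
  let ?T = "blinfun_apply (lipfree_map f)"
  let ?C = "closure (?T ` cball 0 1)"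
  obtain L where "L-lipschitz_on UNIV f" using f by blast
  then have K: "compact (range f)" by (intro compact_continuous_image lipschitz_on_continuous_on M)
  have K0: "0 \<in> range f" using f0 by (metis rangeI)
  have mem: "?T u \<in> lipfree_on (range f)" for u
  proof -
    have "?T ` closure (span (range lipfree_delta)) \<subseteq> closure (?T ` span (range lipfree_delta))"
      by (rule continuous_image_closure_subset[of UNIV]) (auto intro: linear_continuous_on
          blinfun.bounded_linear_right)
    also have "?T ` span (range lipfree_delta) = span (?T ` range lipfree_delta)"
      using linear_span_image[of ?T "range lipfree_delta"] bounded_linear.linear[OF
          blinfun.bounded_linear_right] by metis
    also have "?T ` range lipfree_delta = lipfree_delta ` range f"
      by (simp add: image_image lipfree_map_delta[OF f f0])
    finally show ?thesis unfolding lipfree_on_def closure_span_lipfree_delta by blast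
  qed
  have C_sub: "?C \<subseteq> lipfree_on (range f) \<inter> cball 0 (norm (lipfree_map f))"
  proof (rule closure_minimal)
    show "?T ` cball 0 1 \<subseteq> lipfree_on (range f) \<inter> cball 0 (norm (lipfree_map f))"
    proof (safe intro!: mem)
      fix u :: "'a lipfree" assume "u \<in> cball 0 1"
      then have "norm (lipfree_map f) * norm u \<le> norm (lipfree_map f) * 1"
        by (intro mult_left_mono) auto
      then show "?T u \<in> cball 0 (norm (lipfree_map f))" using norm_blinfun[of "lipfree_map f" u]
        by simp
    qed
  qed (intro closed_Int closed_lipfree_on closed_cball)
  show ?thesis
    unfolding strong_radon_nikodym_def rnp_set_def
  proof (intro conjI allI impI)
    show "closed ?C" by simp
    show "bounded ?C" using C_sub by (intro bounded_subset[OF bounded_cball]) auto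
    fix P :: "'w measure" and m
    assume P: "prob_space P" and vm: "vector_measure P m"
      and zero: "\<forall>B\<in>sets P. measure P B = 0 \<longrightarrow> m B = 0"
      and avg: "{m B /\<^sub>R measure P B |B. B \<in> sets P \<and> 0 < measure P B} \<subseteq> ?C"
    have "m B \<in> lipfree_on (range f) \<and> norm (m B) \<le> norm (lipfree_map f) * measure P B"
      if B: "B \<in> sets P" for B
    \<comment> \<open>A null set has no average; there the measure vanishes by
      \<open>zero\<close>.\<close>
    proof (cases "measure P B = 0")
      case True
      then show ?thesis using zero B subspace_0[OF subspace_lipfree_on] by simp
    next
      case False
      then have pos: "measure P B > 0" by (simp add: zero_less_measure_iff)
      then have "m B /\<^sub>R measure P B \<in> lipfree_on (range f) \<inter> cball 0 (norm (lipfree_map f))"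
        using avg B C_sub by blast
      then have c: "m B /\<^sub>R measure P B \<in> lipfree_on (range f)" "norm (m B /\<^sub>R measure P B)
        \<le> norm (lipfree_map f)" by auto
      have "m B = measure P B *\<^sub>R (m B /\<^sub>R measure P B)" using pos by simp
      then have "m B \<in> lipfree_on (range f)" using subspace_scale[OF subspace_lipfree_on c(1)]
        by metis
      moreover have "norm (m B) \<le> norm (lipfree_map f) * measure P B" using c(2) pos
        by (simp add: field_simps)
      ultimately show ?thesis by blast
    qed
    then show "\<exists>h. \<forall>B\<in>sets P. has_banach_integral P (\<lambda>\<omega>. indicator B \<omega> *\<^sub>R h \<omega>) (m B)"
      by (intro bounded_vector_measure_has_density[OF K null K0 P vm]) blast+
  qed
qed

theorem proposition5p1:
  fixes f :: "'a::{metric_space,zero} \<Rightarrow> 'b::{metric_space,zero}"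
  assumes "compact (UNIV :: 'a set)"
    and "countably_1_rectifiable (UNIV :: 'a set)"
    and "\<exists>L. L-lipschitz_on UNIV f"
    and "f 0 = 0"
  shows "(hausdorff1 (range f) = 0 \<longleftrightarrow> strong_radon_nikodym TYPE('w + real) (lipfree_map f)) \<and>
         (strong_radon_nikodym TYPE('w + real) (lipfree_map f) \<longleftrightarrow> \<not> fixes_copy_of_l1 (lipfree_map f))"
proof -
  \<comment> \<open>Both equivalences follow from a cycle of three implications.\<close>
  have "strong_radon_nikodym TYPE('w + real) (lipfree_map f)" if "hausdorff1 (range f) = 0"
    using assms(1,3,4) that by (rule strong_radon_nikodym_if_null)
  moreover have "\<not> fixes_copy_of_l1 (lipfree_map f)"
    if "strong_radon_nikodym TYPE('w + real) (lipfree_map f)"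
    using that by (rule strong_radon_nikodym_not_fixes_l1)
  moreover have "hausdorff1 (range f) = 0" if "\<not> fixes_copy_of_l1 (lipfree_map f)"
    using hausdorff1_range_eq_0_if_not_fixes_l1[OF assms(2) _ assms(4) that] assms(3) by blast
  ultimately show ?thesis by blast
qed

end
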